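(* Let $n,k,m$ be positive integers with $m\le k\le n$, let $\omega\in S_n$, and let $c[k,m]$ denote the $(m+1)$-cycle $(k-m+1\ \ k-m+2\ \ \ldots\ \ k\ \ k+1)$. Let $c[k,m]\cdot\mathcal T_\omega$ be the set of those elements of $k_{(m)}\cdot\mathcal T_\omega$, with labels $(1,a_1,b_1),\ldots,(m,a_m,b_m)$, such that $b_1\ge b_2\ge\cdots\ge b_m$ and the numbers $a_1,\ldots,a_m$ are pairwise distinct. Then $$\mathfrak S_\omega\,\mathfrak S_{c[k,m]}=\sum_{\mathcal T\in c[k,m]\cdot\mathcal T_\omega}\mathfrak S_{\omega_{\mathcal T}},$$ where $\omega_{\mathcal T}$ is the permutation whose tower diagram is the underlying diagram of $\mathcal T$.
   Context: $\mathfrak S_w$ is the Schubert polynomial of $w$. Permutations are composed as functions, $(\sigma\tau)(x)=\sigma(\tau(x))$; $t_{a,b}$ is the transposition of $a$ and $b$; $\ell$ is Coxeter length; a cycle $(c_1\,\ldots\,c_p)$ maps $c_1\mapsto c_2\mapsto\cdots\mapsto c_p\mapsto c_1$. A tower diagram is a sequence $(\mathcal T_1,\mathcal T_2,\ldots)$ of nonnegative integers, almost all zero. Sliding a positive integer $i$ into $\mathcal T$: set $s:=i$ and examine towers $p=1,2,\ldots$ with $h=\mathcal T_p$: if $s>p+h$ go on; if $s=p+h$ increase $\mathcal T_p$ by one and stop; if $h\ge 1$ and $s=p+h-1$ decrease $\mathcal T_p$ by one and stop; if $s<p+h-1$ set $s:=s+1$ and go on. A word is slid letter by letter from left to right. The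 tower diagram $\mathcal T_w$ of a permutation $w$ is the result of sliding a reduced word $\alpha$ of $w$ ($w=s_{\alpha_1}\cdots s_{\alpha_l}$, $l=\ell(w)$, $s_p=t_{p,p+1}$) into the empty diagram; this is independent of the reduced word and $w\mapsto\mathcal T_w$ is a bijection with inverse $\mathcal T\mapsto\omega_{\mathcal T}$. A saturated $k$-Bruhat chain of length $m$ from $\omega$ is a sequence $(a_1,b_1),\ldots,(a_m,b_m)$ of pairs of positive integers with $a_q\le k<b_q$ and $\ell(\omega^{(q)})=\ell(\omega^{(q-1)})+1$ for all $q$, where $\omega^{(0)}=\omega$, $\omega^{(q)}=\omega^{(q-1)}t_{a_q,b_q}$. The set $k_{(m)}\cdot\mathcal T_\omega$ consists, for each such chain, of the diagram $\mathcal T_{\omega^{(m)}}$ labelled by $(1,a_1,b_1),\ldots,(m,a_m,b_m)$ (distinct chains give distinct elements). *)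

theory Defs
  imports
    "HOL-Combinatorics.Cycles"
    "HOL-Library.Poly_Mapping"
begin

text \<open>
  Permutations are functions on \<open>nat\<close> composed with \<open>\<circ>\<close>. They fix \<open>0\<close>: the positive integers
  are the points being permuted, and \<open>S\<^sub>n\<close> consists of the \<open>w\<close> with \<open>w permutes {1..n}\<close>.
\<close>

definition fin_perms :: "(nat \<Rightarrow> nat) set" where
  "fin_perms = {w. \<exists>n. w permutes {1..n}}"

definition word_perm :: "nat list \<Rightarrow> nat \<Rightarrow> nat" where
  "word_perm \<alpha> = foldr (\<lambda>p w. transpose p (Suc p) \<circ> w) \<alpha> id"

definition coxeter_length :: "(nat \<Rightarrow> nat) \<Rightarrow> nat" where
  "coxeter_length w =
     (LEAST l. \<exists>\<alpha>. (\<forall>p\<in>set \<alpha>. 1 \<le> p) \<and> length \<alpha> = l \<and> word_perm \<alpha> = w)"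

definition reduced_word :: "(nat \<Rightarrow> nat) \<Rightarrow> nat list \<Rightarrow> bool" where
  "reduced_word w \<alpha> \<longleftrightarrow>
     (\<forall>p\<in>set \<alpha>. 1 \<le> p) \<and> word_perm \<alpha> = w \<and> length \<alpha> = coxeter_length w"


text \<open>
  Integer polynomials in \<open>x\<^sub>1, x\<^sub>2, \<dots>\<close>: an exponent vector \<open>nat \<Rightarrow>\<^sub>0 nat\<close> is a monomial, and a
  polynomial maps monomials to coefficients. The product of \<open>\<Rightarrow>\<^sub>0\<close> is convolution.
\<close>

type_synonym ipoly = "(nat \<Rightarrow>\<^sub>0 nat) \<Rightarrow>\<^sub>0 int"

definition var :: "nat \<Rightarrow> ipoly" where
  "var i = Poly_Mapping.single (Poly_Mapping.single i 1) 1"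

text \<open>
  The polynomial \<open>f\<close> with \<open>x\<^sub>i\<close> and \<open>x\<^bsub>i+1\<^esub>\<close> exchanged. \<open>map_key\<close> is precomposition, which
  is the right action here because the exchange is an involution.
\<close>

definition swap_vars :: "nat \<Rightarrow> ipoly \<Rightarrow> ipoly" where
  "swap_vars i f =
     Poly_Mapping.map_key (Poly_Mapping.map_key (transpose i (Suc i))) f"

text \<open>The exact quotient of \<open>f - s\<^sub>i f\<close> by \<open>x\<^sub>i - x\<^bsub>i+1\<^esub>\<close>.\<close>

definition divided_difference :: "nat \<Rightarrow> ipoly \<Rightarrow> ipoly" where
  "divided_difference i f = (THE g. g * (var i - var (Suc i)) = f - swap_vars i f)"

definition longest_perm :: "nat \<Rightarrow> nat \<Rightarrow> nat" where
  "longest_perm n x = (if x \<in> {1..n} then n + 1 - x else x)"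

text \<open>
  Lascoux and Schuetzenberger: the longest element of \<open>S\<^sub>n\<close> has Schubert polynomial
  \<open>x\<^sub>1\<^bsup>n-1\<^esup> x\<^sub>2\<^bsup>n-2\<^esup> \<dots> x\<^bsub>n-1\<^esub>\<close>, and the divided difference \<open>\<partial>\<^sub>i\<close> takes the Schubert polynomial of
  \<open>w\<close> to that of \<open>w s\<^sub>i\<close> whenever \<open>\<ell>(w s\<^sub>i) = \<ell>(w) - 1\<close>. The result depends neither on \<open>n\<close>
  nor on the descents chosen on the way down to \<open>w\<close>.
\<close>

inductive is_schubert :: "(nat \<Rightarrow> nat) \<Rightarrow> ipoly \<Rightarrow> bool" where
  longest: "is_schubert (longest_perm n) (\<Prod>i=1..n. var i ^ (n - i))"
| descent: "is_schubert w f \<Longrightarrow> 1 \<le> i \<Longrightarrow>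
    coxeter_length w = coxeter_length (w \<circ> transpose i (Suc i)) + 1 \<Longrightarrow>
    is_schubert (w \<circ> transpose i (Suc i)) (divided_difference i f)"

definition schubert :: "(nat \<Rightarrow> nat) \<Rightarrow> ipoly" where
  "schubert w = (THE f. is_schubert w f)"


text \<open>
  The towers of a diagram are its values at the positive integers; the value at \<open>0\<close> is never
  touched and stays \<open>0\<close>.
\<close>

type_synonym tower_diagram = "nat \<Rightarrow>\<^sub>0 nat"

text \<open>
  \<open>slide_from p s T\<close> slides the current value \<open>s\<close> into the towers \<open>p, p + 1, \<dots>\<close>. A slide starts
  with \<open>p = 1 \<le> s\<close> and \<open>p \<le> s\<close> is preserved, so the last branch is taken only when
  \<open>s < p + h - 1\<close>, and the recursion ends because almost all towers are zero.
\<close>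

partial_function (tailrec) slide_from :: "nat \<Rightarrow> nat \<Rightarrow> tower_diagram \<Rightarrow> tower_diagram" where
  "slide_from p s T =
     (let h = Poly_Mapping.lookup T p in
      if s > p + h then slide_from (p + 1) s T
      else if s = p + h then Poly_Mapping.update p (h + 1) T
      else if h \<ge> 1 \<and> s = p + h - 1 then Poly_Mapping.update p (h - 1) T
      else slide_from (p + 1) (s + 1) T)"

definition slide :: "nat \<Rightarrow> tower_diagram \<Rightarrow> tower_diagram" where
  "slide i T = slide_from 1 i T"

definition slide_word :: "nat list \<Rightarrow> tower_diagram" where
  "slide_word \<alpha> = fold slide \<alpha> 0"

definition tower_of :: "(nat \<Rightarrow> nat) \<Rightarrow> tower_diagram" where
  "tower_of w = slide_word (SOME \<alpha>. reduced_word w \<alpha>)"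

definition perm_of_tower :: "tower_diagram \<Rightarrow> nat \<Rightarrow> nat" where
  "perm_of_tower T = the_inv_into fin_perms tower_of T"


fun chain_end :: "(nat \<Rightarrow> nat) \<Rightarrow> (nat \<times> nat) list \<Rightarrow> nat \<Rightarrow> nat" where
  "chain_end w [] = w"
| "chain_end w ((a, b) # cs) = chain_end (w \<circ> transpose a b) cs"

fun k_bruhat_chain :: "nat \<Rightarrow> (nat \<Rightarrow> nat) \<Rightarrow> (nat \<times> nat) list \<Rightarrow> bool" where
  "k_bruhat_chain k w [] \<longleftrightarrow> True"
| "k_bruhat_chain k w ((a, b) # cs) \<longleftrightarrow>
     1 \<le> a \<and> a \<le> k \<and> k < b \<and>
     coxeter_length (w \<circ> transpose a b) = coxeter_length w + 1 \<and>
     k_bruhat_chain k (w \<circ> transpose a b) cs"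

text \<open>A diagram together with its labels \<open>(1, a\<^sub>1, b\<^sub>1), \<dots>, (m, a\<^sub>m, b\<^sub>m)\<close>, listed in this order.\<close>

type_synonym labelled_diagram = "tower_diagram \<times> (nat \<times> nat \<times> nat) list"

text \<open>The set \<open>k\<^bsub>(m)\<^esub> \<cdot> \<T>\<^sub>\<omega>\<close>.\<close>

definition bruhat_slides :: "nat \<Rightarrow> nat \<Rightarrow> (nat \<Rightarrow> nat) \<Rightarrow> labelled_diagram set" where
  "bruhat_slides k m \<omega> =
     {(tower_of (chain_end \<omega> cs), zip [1..<m+1] cs) | cs.
        length cs = m \<and> k_bruhat_chain k \<omega> cs}"

text \<open>The set \<open>c[k,m] \<cdot> \<T>\<^sub>\<omega>\<close>.\<close>

definition cycle_slides :: "nat \<Rightarrow> nat \<Rightarrow> (nat \<Rightarrow> nat) \<Rightarrow> labelled_diagram set" where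
  "cycle_slides k m \<omega> =
     {(T, ls) \<in> bruhat_slides k m \<omega>.
        sorted_wrt (\<ge>) (map (\<lambda>(q, a, b). b) ls) \<and> distinct (map (\<lambda>(q, a, b). a) ls)}"

text \<open>
  The cycle \<open>c[k,m] = (k-m+1 \<dots> k k+1)\<close>. \<open>cycle_of_list\<close> sends each entry of the list to the
  next one and the last to the first.
\<close>

definition pieri_cycle :: "nat \<Rightarrow> nat \<Rightarrow> nat \<Rightarrow> nat" where
  "pieri_cycle k m = cycle_of_list [k - m + 1..<k + 2]"

end

theory Submission
  imports Defs "HOL-Combinatorics.Multiset_Permutations"
begin

text \<open>
  The cycle \<open>c[k,m]\<close> has the elementary symmetric polynomial \<open>e\<^sub>m(x\<^sub>1, \<dots>, x\<^sub>k)\<close> as its Schubert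
  polynomial, so the claim is a Pieri rule. By Monk's rule, multiplication by \<open>x\<^sub>k\<close> acts on Schubert
  polynomials as the Dunkl element \<open>\<theta>\<^sub>k = \<Sum>\<^sub>b [k b]\<close>, where \<open>[a b] = - [b a]\<close> for \<open>a < b\<close> is the
  operator \<open>w \<mapsto> w t\<^bsub>a,b\<^esub>\<close> if that is a Bruhat cover and \<open>0\<close> otherwise. These operators satisfy the
  relations of the Fomin--Kirillov algebra, and following Postnikov one shows in that algebra that
  \<open>E\<^sub>m(I) = \<Sum> [a\<^sub>1 b\<^sub>1] \<dots> [a\<^sub>m b\<^sub>m]\<close>, summed over distinct \<open>a\<^sub>i \<in> I\<close> and weakly decreasing \<open>b\<^sub>i \<notin> I\<close>,
  satisfies the recursion \<open>E\<^sub>m(I \<union> {j}) = E\<^sub>m(I) + E\<^bsub>m-1\<^esub>(I) \<theta>\<^sub>j\<close> of the elementary symmetric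
  polynomials. Applied to the Schubert polynomial of \<open>\<omega>\<close>, the surviving products of
  \<open>E\<^sub>m({1, \<dots>, k})\<close> are the chains of the theorem.
\<close>

section \<open>Fomin--Kirillov algebras\<close>

text \<open>The leftmost factor of a product of edge operators is the first step of a chain. So in
  E_(m-1)(I) \<theta>_j the element \<theta>_j is evaluated at the ends of chains, where Monk's rule
  turns it into the scalar x_j. The recursion sorts the edges of \<theta>_j. For a product with
  source set A, the edges from j to A and to targets outside together turn j from a target into a
  source. An edge [j a] with a in I - A is -[a j] and lengthens the block of j; these terms cancel
  the products of E_m(I) that use j as a target. The first half rests on cyclic relations among
  edges at one point, which follow from the square and triangle relations. On all permutations
  \<theta>_j would be an infinite sum. A k-Bruhat step from S_n with k \<le> n ends in S_(n+1), so
  cutting off at n + m is harmless for chains of length m. Polynomials are compared by divided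
  differences: a homogeneous polynomial of positive degree killed by all of them is 0. This yields
  both Monk's rule and the polynomial of the cycle. Tower diagrams enter through injectivity of the
  map to diagrams, which recovers the end of each chain.\<close>

lemma sum_Pow_pointed:
  assumes "finite C"
  shows "(\<Sum>B\<in>Pow C. \<Sum>d\<in>B. f d (B - {d})) = (\<Sum>d\<in>C. \<Sum>B\<in>Pow (C - {d}). f d B)"
proof -
  have "(\<Sum>B\<in>Pow C. \<Sum>d\<in>B. f d (B - {d})) = (\<Sum>(B, d)\<in>Sigma (Pow C) (\<lambda>B. B). f d (B - {d}))"
    using assms by (subst sum.Sigma) (auto intro: finite_subset)
  also have "\<dots> = (\<Sum>(d, B)\<in>Sigma C (\<lambda>d. Pow (C - {d})). f d B)"
    by (rule sum.reindex_bij_witness[where i = "\<lambda>(d, B). (insert d B, d)" and j = "\<lambda>(B, d). (d, B - {d})"]) auto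
  also have "\<dots> = (\<Sum>d\<in>C. \<Sum>B\<in>Pow (C - {d}). f d B)"
    using assms by (subst sum.Sigma) auto
  finally show ?thesis .
qed

lemma sum_Pow_disjoint_pairs:
  assumes "finite A"
  shows "(\<Sum>B\<in>Pow A. \<Sum>D\<in>Pow (A - B). f B D) = (\<Sum>C\<in>Pow A. \<Sum>B\<in>Pow C. f B (C - B))"
proof -
  have fin: "\<forall>B\<in>Pow A. finite (Pow B)" "\<forall>B\<in>Pow A. finite (Pow (A - B))"
    using assms by (auto intro: finite_subset)
  have "(\<Sum>B\<in>Pow A. \<Sum>D\<in>Pow (A - B). f B D) = (\<Sum>(B, D)\<in>Sigma (Pow A) (\<lambda>B. Pow (A - B)). f B D)"
    using assms fin by (subst sum.Sigma) auto
  also have "\<dots> = (\<Sum>(C, B)\<in>Sigma (Pow A) Pow. f B (C - B))"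
    by (rule sum.reindex_bij_witness[where i = "\<lambda>(C, B). (B, C - B)" and j = "\<lambda>(B, D). (B \<union> D, B)"])
      (auto intro!: arg_cong[of _ _ "f _"])
  also have "\<dots> = (\<Sum>C\<in>Pow A. \<Sum>B\<in>Pow C. f B (C - B))"
    using assms fin by (subst sum.Sigma) auto
  finally show ?thesis .
qed

lemma sum_Pow_complement:
  "(\<Sum>B\<in>Pow A. f B (A - B)) = (\<Sum>B\<in>Pow A. f (A - B) B)"
  by (rule sum.reindex_bij_witness[where i = "\<lambda>B. A - B" and j = "\<lambda>B. A - B"]) (auto simp: double_diff)

lemma sum_Pow_disjoint_swap:
  assumes "finite A"
  shows "(\<Sum>B\<in>Pow A. \<Sum>D\<in>Pow (A - B). f B D) = (\<Sum>D\<in>Pow A. \<Sum>B\<in>Pow (A - D). f B D)"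
proof -
  have "(\<Sum>B\<in>Pow A. \<Sum>D\<in>Pow (A - B). f B D) = (\<Sum>C\<in>Pow A. \<Sum>B\<in>Pow C. f B (C - B))"
    by (rule sum_Pow_disjoint_pairs[OF assms])
  also have "\<dots> = (\<Sum>C\<in>Pow A. \<Sum>B\<in>Pow C. f (C - B) B)"
    by (simp add: sum_Pow_complement)
  also have "\<dots> = (\<Sum>D\<in>Pow A. \<Sum>B\<in>Pow (A - D). f B D)"
    by (rule sum_Pow_disjoint_pairs[OF assms, symmetric])
  finally show ?thesis .
qed

lemma sum_Pow_insert:
  assumes "finite A" "j \<notin> A"
  shows "(\<Sum>B\<in>Pow (insert j A). f B) = (\<Sum>B\<in>Pow A. f B) + (\<Sum>B\<in>Pow A. f (insert j B))"
proof -
  have "inj_on (insert j) (Pow A)" "Pow A \<inter> insert j ` Pow A = {}"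
    using assms(2) by (auto simp: inj_on_def)
  then show ?thesis
    using assms(1) by (simp add: Pow_insert sum.union_disjoint sum.reindex)
qed

lemma sum_permutations_of_set_Cons:
  assumes "finite A" "A \<noteq> {}"
  shows "(\<Sum>xs\<in>permutations_of_set A. f xs)
    = (\<Sum>a\<in>A. \<Sum>xs\<in>permutations_of_set (A - {a}). f (a # xs))"
proof -
  have "(\<Sum>xs\<in>permutations_of_set A. f xs)
      = (\<Sum>a\<in>A. \<Sum>xs\<in>(#) a ` permutations_of_set (A - {a}). f xs)"
    unfolding permutations_of_set_nonempty[OF assms(2)]
    using assms(1) by (intro sum.UNION_disjoint) auto
  then show ?thesis by (simp add: sum.reindex)
qed

lemma sum_permutations_of_set_rev:
  "(\<Sum>xs\<in>permutations_of_set A. f (rev xs)) = (\<Sum>xs\<in>permutations_of_set A. f xs)"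
  by (rule sum.reindex_bij_witness[where i = rev and j = rev]) (auto simp: permutations_of_set_def)

lemma sum_permutations_of_set_snoc:
  assumes "finite A" "A \<noteq> {}"
  shows "(\<Sum>xs\<in>permutations_of_set A. f xs)
    = (\<Sum>a\<in>A. \<Sum>xs\<in>permutations_of_set (A - {a}). f (xs @ [a]))"
  using sum_permutations_of_set_Cons[OF assms, of "\<lambda>xs. f (rev xs)"]
    sum_permutations_of_set_rev[of "\<lambda>xs. f (xs @ [a])" for a]
  by (simp add: sum_permutations_of_set_rev)

text \<open>The position of \<open>d\<close> determines the rotation, so each ordering of
  \<open>D\<close> arises exactly once from an ordering that starts with \<open>d\<close>. This
  groups orderings into cyclic classes, the form in which \<open>star_cyclic_sum\<close>
  applies.\<close>

lemma sum_permutations_of_set_rotate: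
  assumes "finite D" "d \<in> D"
  shows "(\<Sum>zs\<in>permutations_of_set (D - {d}). \<Sum>i<card D. f (rotate i (d # zs)))
    = (\<Sum>ys\<in>permutations_of_set D. f ys)"
proof -
  let ?S = "permutations_of_set (D - {d}) \<times> {..<card D}"
  let ?g = "\<lambda>(zs, i). rotate i (d # zs)"
  have len: "length zs = card D - 1" "distinct (d # zs)" "insert d (set zs) = D"
    if "zs \<in> permutations_of_set (D - {d})" for zs
    using that assms by (auto simp: permutations_of_set_def distinct_card[symmetric])
  have pos: "card D > 0" using assms by (auto simp: card_gt_0_iff)
  have inj: "inj_on ?g ?S"
  proof (rule inj_onI)
    fix p q assume pq: "p \<in> ?S" "q \<in> ?S" "?g p = ?g q"
    obtain zs i zs' i' where p: "p = (zs, i)" "q = (zs', i')" by fastforce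
    have z: "zs \<in> permutations_of_set (D - {d})" "zs' \<in> permutations_of_set (D - {d})"
      and i: "i \<in> {..<card D}" "i' \<in> {..<card D}"
      and eq: "rotate i (d # zs) = rotate i' (d # zs')"
      using pq p by auto
    have L: "length (d # zs) = card D" "length (d # zs') = card D"
      using len[OF z(1)] len[OF z(2)] pos by auto
    \<comment> \<open>Rotation by i moves the head to index -i modulo the length; the reduction
      modulo \<open>card D\<close> covers i = 0.\<close>
    have hd: "rotate i (d # zs) ! ((card D - i) mod card D) = d"
      "rotate i' (d # zs') ! ((card D - i') mod card D) = d"
      using L i pos by (simp_all only: nth_rotate mod_less_divisor mod_add_right_eq lessThan_iff) auto
    have "distinct (rotate i (d # zs))" using len[OF z(1)] by simp
    then have e: "(card D - i) mod card D = (card D - i') mod card D"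
      using hd eq L pos by (metis length_rotate mod_less_divisor nth_eq_iff_index_eq)
    have "i = i'"
    proof (cases "i = 0 \<or> i' = 0")
      case True
      then show ?thesis using e i pos by (cases "i = 0"; cases "i' = 0") (auto simp: mod_less)
    next
      case False
      then show ?thesis using e i by auto
    qed
    moreover have "d # zs = d # zs'" using eq unfolding \<open>i = i'\<close> rotate_def by (rule injD[OF inj_fn[OF inj_rotate1]])
    ultimately show "p = q" using p by simp
  qed
  have img: "?g ` ?S \<subseteq> permutations_of_set D"
    using len by (fastforce simp: permutations_of_set_def)
  \<comment> \<open>Both sides have n! = n (n-1)! elements, so injectivity already gives a
    bijection.\<close>
  have "card ?S = card (permutations_of_set D)"
    using assms pos by (simp add: fact_reduce[of "card D"] mult.commute)
  then have "bij_betw ?g ?S (permutations_of_set D)"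
    using inj img assms by (simp add: bij_betw_def card_image card_subset_eq)
  then have "(\<Sum>x\<in>?S. f (?g x)) = (\<Sum>ys\<in>permutations_of_set D. f ys)"
    by (rule sum.reindex_bij_betw)
  then show ?thesis by (simp add: sum.cartesian_product case_prod_unfold)
qed

text \<open>Only elements satisfying these relations are assumed, so the identities hold in any ring
  that represents the Fomin--Kirillov algebra. Indexing by oriented pairs is what gives the
  three-term relation its cyclic form.\<close>

locale fk_algebra =
  fixes t :: "nat \<Rightarrow> nat \<Rightarrow> 'r::ring_1"
  assumes square: "t i j * t i j = 0"
    and antisym: "t j i = - t i j"
    and disjoint_commute: "distinct [i, j, k, l] \<Longrightarrow> t i j * t k l = t k l * t i j"
    and triangle: "distinct [i, j, k] \<Longrightarrow> t i j * t j k + t j k * t k i + t k i * t i j = 0"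
begin

section \<open>Stars: products of edges with a common endpoint\<close>

definition star :: "nat list \<Rightarrow> nat \<Rightarrow> 'r" where
  "star cs l = prod_list (map (\<lambda>c. t c l) cs)"

lemma star_simps [simp]:
  "star [] l = 1" "star (c # cs) l = t c l * star cs l" "star (cs @ ds) l = star cs l * star ds l"
  by (simp_all add: star_def)

text \<open>Straightening rule: \<open>t j l\<close> passes \<open>t c j\<close> to the left and
  redirects c to l, or it stops there and leaves c attached to both l and j.\<close>

lemma edge_mult_edge: "distinct [c, j, l] \<Longrightarrow> t c j * t j l = t j l * t c l + t c l * t c j"
  using triangle[of c j l] by (simp add: antisym[of l c] algebra_simps)

lemma star_commute:
  assumes "\<And>c. c \<in> set cs \<Longrightarrow> t c j * x = x * t c j"
  shows "star cs j * x = x * star cs j"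
  using assms
proof (induction cs)
  case (Cons c cs)
  have "star cs j * x = x * star cs j" "t c j * x = x * t c j"
    using Cons by auto
  then show ?case by (metis mult.assoc star_simps(2))
qed simp

text \<open>Move \<open>t j l\<close> to the left by \<open>edge_mult_edge\<close>. If it passes
  everything, all edges are redirected to l. If it stops at the entry with index i, that entry is
  attached to both l and j, later ones to l, earlier ones to j, and the edges at l commute to the
  front past edges with disjoint indices.\<close>

lemma star_mult_edge:
  assumes "distinct cs" "j \<notin> set cs" "l \<notin> set cs" "j \<noteq> l"
  shows "star cs j * t j l = t j l * star cs l
    + (\<Sum>i<length cs. star (drop i cs) l * star (take (Suc i) cs) j)"
  using assms
proof (induction cs rule: rev_induct)
  case Nil
  then show ?case by simp
next
  case (snoc c cs)
  have comm: "star ds j * t c l = t c l * star ds j" if "set ds \<subseteq> set cs" for ds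
    using snoc.prems that by (intro star_commute disjoint_commute) auto
  have "star (cs @ [c]) j * t j l = star cs j * (t c j * t j l)"
    by (simp add: mult.assoc)
  also have "\<dots> = star cs j * t j l * t c l + star cs j * t c l * t c j"
    using snoc.prems by (subst edge_mult_edge) (auto simp: algebra_simps)
  also have "star cs j * t j l = t j l * star cs l
      + (\<Sum>i<length cs. star (drop i cs) l * star (take (Suc i) cs) j)"
    using snoc by auto
  also have "(t j l * star cs l + (\<Sum>i<length cs. star (drop i cs) l * star (take (Suc i) cs) j)) * t c l
      = t j l * star (cs @ [c]) l
        + (\<Sum>i<length cs. star (drop i cs) l * (star (take (Suc i) cs) j * t c l))"
    by (simp add: algebra_simps sum_distrib_right)
  also have "(\<Sum>i<length cs. star (drop i cs) l * (star (take (Suc i) cs) j * t c l))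
      = (\<Sum>i<length cs. star (drop i (cs @ [c])) l * star (take (Suc i) (cs @ [c])) j)"
    by (intro sum.cong refl) (simp add: comm set_take_subset mult.assoc)
  also have "star cs j * t c l * t c j = star (drop (length cs) (cs @ [c])) l * star (take (Suc (length cs)) (cs @ [c])) j"
    by (simp add: comm mult.assoc)
  finally show ?case by (simp add: add.assoc)
qed

text \<open>The cyclic relation: the words that run once around the cycle and repeat their first
  letter at the end add up to 0. For one letter this is the square relation; in general it comes
  from expanding a product that ends in \<open>t j l * t j l\<close>, with j the head of the
  list.\<close>

lemma star_cyclic_sum:
  assumes "distinct cs" "l \<notin> set cs" "cs \<noteq> []"
  shows "(\<Sum>i<length cs. star (drop i cs) l * star (take (Suc i) cs) l) = 0"
  using assms
proof (induction cs rule: length_induct)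
  case (1 xs)
  obtain j cs where xs: "xs = j # cs" using "1.prems" by (cases xs) auto
  have d: "distinct cs" "j \<notin> set cs" "l \<notin> set cs" "j \<noteq> l" using "1.prems" xs by auto
  let ?n = "length cs"
  let ?T = "\<lambda>i. take (Suc i) cs"
  have inner: "(\<Sum>i'<Suc i. star (drop i' (?T i)) l * star (take (Suc i') (?T i)) j)
      = (\<Sum>i'\<le>i. star (drop i' (?T i)) l * star (?T i') j)" for i
    by (simp add: lessThan_Suc_atMost min_def)
  have edge: "star (?T i) j * t j l = t j l * star (?T i) l
      + (\<Sum>i'\<le>i. star (drop i' (?T i)) l * star (?T i') j)" if "i < ?n" for i
  proof -
    have "distinct (?T i)" "j \<notin> set (?T i)" "l \<notin> set (?T i)"
      using d by (auto dest: in_set_takeD)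
    moreover have "length (?T i) = Suc i" using that by simp
    ultimately show ?thesis using star_mult_edge[of "?T i" j l] d(4) inner[of i] by simp
  qed
  \<comment> \<open>For fixed i' this is the cyclic relation of the suffix
    \<open>drop i' cs\<close>, which is shorter than \<open>xs\<close>.\<close>
  have zero: "(\<Sum>i=i'..<?n. star (drop i cs) l * star (drop i' (?T i)) l) = 0" if "i' < ?n" for i'
  proof -
    let ?ds = "drop i' cs"
    have "(\<Sum>i<length ?ds. star (drop i ?ds) l * star (take (Suc i) ?ds) l) = 0"
    proof (rule "1.IH"[rule_format])
      show "length ?ds < length xs" "?ds \<noteq> []" "distinct ?ds" "l \<notin> set ?ds"
        using d that xs by (auto dest: in_set_dropD)
    qed
    moreover have "(\<Sum>i=i'..<?n. star (drop i cs) l * star (drop i' (?T i)) l)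
        = (\<Sum>i<length ?ds. star (drop i ?ds) l * star (take (Suc i) ?ds) l)"
      by (rule sum.reindex_bij_witness[where i = "\<lambda>i. i + i'" and j = "\<lambda>i. i - i'"])
        (auto simp: drop_take Suc_diff_le)
    ultimately show ?thesis by simp
  qed
  \<comment> \<open>Both factors \<open>t j l\<close> are pulled through with
    \<open>star_mult_edge\<close>. The terms without a remaining star at j form the cyclic sum of j
    # cs; the others, grouped by the star that remains, vanish by \<open>zero\<close>.\<close>
  have "0 = star cs j * t j l * t j l" by (simp add: mult.assoc square)
  also have "\<dots> = t j l * star cs l * t j l + (\<Sum>i<?n. star (drop i cs) l * (star (?T i) j * t j l))"
    using star_mult_edge[OF d] by (simp add: algebra_simps sum_distrib_right)
  also have "(\<Sum>i<?n. star (drop i cs) l * (star (?T i) j * t j l))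
      = (\<Sum>i<?n. star (drop i cs) l * t j l * star (?T i) l)
        + (\<Sum>i<?n. \<Sum>i'\<le>i. star (drop i cs) l * star (drop i' (?T i)) l * star (?T i') j)"
    by (simp add: edge algebra_simps sum_distrib_left sum.distrib)
  also have "(\<Sum>i<?n. \<Sum>i'\<le>i. star (drop i cs) l * star (drop i' (?T i)) l * star (?T i') j)
      = (\<Sum>i'<?n. \<Sum>i=i'..<?n. star (drop i cs) l * star (drop i' (?T i)) l * star (?T i') j)"
    by (simp add: sum.Sigma) (rule sum.reindex_bij_witness[where i = prod.swap and j = prod.swap]; auto)
  also have "\<dots> = 0"
    by (simp add: sum_distrib_right[symmetric] zero)
  finally have "0 = t j l * star cs l * t j l + (\<Sum>i<?n. star (drop i cs) l * t j l * star (?T i) l)"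
    by simp
  also have "\<dots> = (\<Sum>i<length xs. star (drop i xs) l * star (take (Suc i) xs) l)"
    by (simp add: xs sum.lessThan_Suc_shift mult.assoc del: sum.lessThan_Suc)
  finally show ?case by simp
qed

definition star_sum :: "nat set \<Rightarrow> nat \<Rightarrow> 'r" where
  "star_sum A l = (\<Sum>xs\<in>permutations_of_set A. star xs l)"

lemma star_sum_empty [simp]: "star_sum {} l = 1"
  by (simp add: star_sum_def)

lemma star_sum_Cons:
  assumes "finite A" "A \<noteq> {}"
  shows "star_sum A l = (\<Sum>a\<in>A. t a l * star_sum (A - {a}) l)"
  unfolding star_sum_def sum_permutations_of_set_Cons[OF assms] by (simp add: sum_distrib_left)

lemma star_sum_snoc:
  assumes "finite A" "A \<noteq> {}"
  shows "star_sum A l = (\<Sum>a\<in>A. star_sum (A - {a}) l * t a l)"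
  unfolding star_sum_def sum_permutations_of_set_snoc[OF assms] by (simp add: sum_distrib_right)

lemma star_sum_commute:
  assumes "\<And>a. a \<in> A \<Longrightarrow> t a l * x = x * t a l"
  shows "star_sum A l * x = x * star_sum A l"
  unfolding star_sum_def sum_distrib_left sum_distrib_right
  by (intro sum.cong refl star_commute assms) (auto simp: permutations_of_set_def)

text \<open>These are all orderings of \<open>D\<close> with the first letter repeated at the end.
  Grouped into rotation classes, each class is one cyclic relation.\<close>

lemma star_sum_closed_cycle:
  assumes "finite D" "l \<notin> D" "D \<noteq> {}"
  shows "(\<Sum>d\<in>D. t d l * star_sum (D - {d}) l * t d l) = 0"
proof -
  obtain d0 where d0: "d0 \<in> D" using assms by auto
  have "(\<Sum>d\<in>D. t d l * star_sum (D - {d}) l * t d l)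
      = (\<Sum>ys\<in>permutations_of_set D. star ys l * t (hd ys) l)"
    unfolding sum_permutations_of_set_Cons[OF assms(1,3)] star_sum_def
    by (simp add: sum_distrib_left sum_distrib_right)
  also have "\<dots> = (\<Sum>zs\<in>permutations_of_set (D - {d0}).
      \<Sum>i<card D. star (rotate i (d0 # zs)) l * t (hd (rotate i (d0 # zs))) l)"
    by (rule sum_permutations_of_set_rotate[OF assms(1) d0, symmetric])
  also have "\<dots> = 0"
  proof (rule sum.neutral, rule ballI)
    fix zs assume zs: "zs \<in> permutations_of_set (D - {d0})"
    let ?cs = "d0 # zs"
    have cs: "distinct ?cs" "set ?cs = D"
      using zs d0 by (auto simp: permutations_of_set_def)
    then have len: "length ?cs = card D" using distinct_card by fastforce
    have "star (rotate i ?cs) l * t (hd (rotate i ?cs)) l = star (drop i ?cs) l * star (take (Suc i) ?cs) l"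
      if "i < card D" for i
    proof -
      have i: "i < length ?cs" using that len by simp
      have "rotate i ?cs = drop i ?cs @ take i ?cs" "hd (rotate i ?cs) = ?cs ! i"
        using i hd_drop_conv_nth[OF i] by (simp_all only: rotate_drop_take mod_less) simp
      then show ?thesis
        by (simp only: take_Suc_conv_app_nth[OF i] star_simps mult.assoc mult_1_right)
    qed
    note eq = this
    show "(\<Sum>i<card D. star (rotate i ?cs) l * t (hd (rotate i ?cs)) l) = 0"
    proof -
      have "(\<Sum>i<length ?cs. star (drop i ?cs) l * star (take (Suc i) ?cs) l) = 0"
        by (rule star_cyclic_sum) (use cs assms(2) in auto)
      then show ?thesis using eq unfolding len by (simp cong: sum.cong_simp)
    qed
  qed
  finally show ?thesis .
qed

text \<open>Peel off the first edge d of the star. The edges from elements other than d vanish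
  against the remaining star by induction, and the edge from d itself closes a cycle.\<close>

lemma star_sum_mult_edges:
  assumes "finite D" "l \<notin> D"
  shows "star_sum D l * (\<Sum>a\<in>D. t a l) = 0"
  using assms
proof (induction D rule: finite_psubset_induct)
  case (psubset D)
  show ?case
  proof (cases "D = {}")
    case False
    have "star_sum D l * (\<Sum>a\<in>D. t a l)
        = (\<Sum>d\<in>D. t d l * (star_sum (D - {d}) l * ((\<Sum>a\<in>D - {d}. t a l) + t d l)))"
    proof -
      have "(\<Sum>a\<in>D. t a l) = (\<Sum>a\<in>D - {d}. t a l) + t d l" if "d \<in> D" for d
        using sum.remove[OF psubset(1) that, of "\<lambda>a. t a l"] by (simp add: add.commute)
      then show ?thesis
        by (simp add: star_sum_Cons[OF psubset(1) False] sum_distrib_right mult.assoc cong: sum.cong)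
    qed
    also have "\<dots> = (\<Sum>d\<in>D. t d l * (star_sum (D - {d}) l * (\<Sum>a\<in>D - {d}. t a l)))
        + (\<Sum>d\<in>D. t d l * star_sum (D - {d}) l * t d l)"
      by (simp only: distrib_left sum.distrib mult.assoc)
    also have "(\<Sum>d\<in>D. t d l * star_sum (D - {d}) l * t d l) = 0"
      using psubset False by (intro star_sum_closed_cycle) auto
    also have "(\<Sum>d\<in>D. t d l * (star_sum (D - {d}) l * (\<Sum>a\<in>D - {d}. t a l))) = 0"
    proof (intro sum.neutral ballI)
      fix d assume "d \<in> D"
      then have "D - {d} \<subset> D" "l \<notin> D - {d}" using psubset.prems by auto
      then show "t d l * (star_sum (D - {d}) l * (\<Sum>a\<in>D - {d}. t a l)) = 0"
        using psubset.IH by simp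
    qed
    finally show ?thesis by simp
  qed simp
qed

section \<open>Two stars sharing a set of sources\<close>

definition pair_sum :: "nat set \<Rightarrow> nat \<Rightarrow> nat \<Rightarrow> 'r" where
  "pair_sum C l j = (\<Sum>B\<in>Pow C. star_sum B l * star_sum (C - B) j)"

lemma sum_Pow_star_sum_Cons:
  assumes "finite C"
  shows "(\<Sum>B\<in>Pow C. star_sum B l * f B)
    = f {} + (\<Sum>c\<in>C. t c l * (\<Sum>B\<in>Pow (C - {c}). star_sum B l * f (insert c B)))"
proof -
  have "(\<Sum>B\<in>Pow C. star_sum B l * f B)
      = star_sum {} l * f {} + (\<Sum>B\<in>Pow C - {{}}. star_sum B l * f B)"
    using assms by (intro sum.remove) auto
  also have "(\<Sum>B\<in>Pow C - {{}}. star_sum B l * f B)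
      = (\<Sum>B\<in>Pow C - {{}}. \<Sum>c\<in>B. t c l * star_sum (B - {c}) l * f (insert c (B - {c})))"
  proof (intro sum.cong refl)
    fix B assume "B \<in> Pow C - {{}}"
    then have "finite B" "B \<noteq> {}" using assms finite_subset by auto
    then show "star_sum B l * f B = (\<Sum>c\<in>B. t c l * star_sum (B - {c}) l * f (insert c (B - {c})))"
      by (simp add: star_sum_Cons sum_distrib_right insert_absorb cong: sum.cong)
  qed
  also have "\<dots> = (\<Sum>B\<in>Pow C. \<Sum>c\<in>B. t c l * star_sum (B - {c}) l * f (insert c (B - {c})))"
    using assms by (intro sum.mono_neutral_left) auto
  also have "\<dots> = (\<Sum>c\<in>C. \<Sum>B\<in>Pow (C - {c}). t c l * star_sum B l * f (insert c B))"
    by (rule sum_Pow_pointed[OF assms])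
  finally show ?thesis by (simp add: sum_distrib_left mult.assoc)
qed

lemma pair_sum_Cons:
  assumes "finite C"
  shows "pair_sum C l j = star_sum C j + (\<Sum>c\<in>C. t c l * pair_sum (C - {c}) l j)"
  unfolding pair_sum_def
  by (subst sum_Pow_star_sum_Cons[OF assms]) (simp add: Diff_insert2[symmetric])

lemma pair_sum_snoc:
  assumes "finite C" "j \<notin> C" "l \<notin> C" "j \<noteq> l"
  shows "pair_sum C l j = star_sum C j + (\<Sum>c\<in>C. pair_sum (C - {c}) l j * t c l)"
proof -
  let ?f = "\<lambda>B. star_sum (C - B) j"
  have "pair_sum C l j = star_sum {} l * ?f {} + (\<Sum>B\<in>Pow C - {{}}. star_sum B l * ?f B)"
    unfolding pair_sum_def using assms by (intro sum.remove) auto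
  also have "(\<Sum>B\<in>Pow C - {{}}. star_sum B l * ?f B)
      = (\<Sum>B\<in>Pow C - {{}}. \<Sum>c\<in>B. star_sum (B - {c}) l * ?f (insert c (B - {c})) * t c l)"
  proof (intro sum.cong refl)
    fix B assume B: "B \<in> Pow C - {{}}"
    then have "finite B" "B \<noteq> {}" using assms(1) finite_subset by auto
    \<comment> \<open>The last edge at l may be moved behind the star at j, because c lies in B and
      so is not among the sources of that star.\<close>
    moreover have "t c l * ?f B = ?f B * t c l" if "c \<in> B" for c
      by (rule star_sum_commute[symmetric]) (use assms B that in \<open>auto intro!: disjoint_commute\<close>)
    ultimately show "star_sum B l * ?f B
        = (\<Sum>c\<in>B. star_sum (B - {c}) l * ?f (insert c (B - {c})) * t c l)"
      by (simp add: star_sum_snoc sum_distrib_right insert_absorb mult.assoc cong: sum.cong)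
  qed
  also have "\<dots> = (\<Sum>B\<in>Pow C. \<Sum>c\<in>B. star_sum (B - {c}) l * ?f (insert c (B - {c})) * t c l)"
    using assms by (intro sum.mono_neutral_left) auto
  also have "\<dots> = (\<Sum>c\<in>C. \<Sum>B\<in>Pow (C - {c}). star_sum B l * ?f (insert c B) * t c l)"
    by (rule sum_Pow_pointed[OF assms(1)])
  finally show ?thesis
    by (simp add: pair_sum_def sum_distrib_right Diff_insert2[symmetric])
qed

text \<open>Symmetrised \<open>star_mult_edge\<close>: the element c where \<open>t j l\<close>
  stops is the first source at l and the last one at j. Over all orderings the other elements are
  distributed freely over the two stars, which is what \<open>pair_sum\<close> records.\<close>

lemma star_sum_mult_edge:
  assumes "finite C" "j \<notin> C" "l \<notin> C" "j \<noteq> l"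
  shows "star_sum C j * t j l
    = t j l * star_sum C l + (\<Sum>c\<in>C. t c l * pair_sum (C - {c}) l j * t c j)"
  using assms
proof (induction C rule: finite_psubset_induct)
  case (psubset C)
  show ?case
  proof (cases "C = {}")
    case False
    have "star_sum C j * t j l = (\<Sum>d\<in>C. star_sum (C - {d}) j * (t d j * t j l))"
      by (simp add: star_sum_snoc[OF psubset(1) False] sum_distrib_right mult.assoc)
    also have "\<dots> = (\<Sum>d\<in>C. t j l * star_sum (C - {d}) l * t d l
        + (\<Sum>c\<in>C - {d}. t c l * pair_sum (C - {d} - {c}) l j * t d l * t c j)
        + t d l * star_sum (C - {d}) j * t d j)"
    proof (intro sum.cong refl)
      fix d assume d: "d \<in> C"
      have "star_sum (C - {d}) j * (t d j * t j l)
          = star_sum (C - {d}) j * t j l * t d l + star_sum (C - {d}) j * t d l * t d j"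
        using d psubset.prems by (subst edge_mult_edge) (auto simp: algebra_simps)
      also have "star_sum (C - {d}) j * t j l = t j l * star_sum (C - {d}) l
          + (\<Sum>c\<in>C - {d}. t c l * pair_sum (C - {d} - {c}) l j * t c j)"
        using d psubset.prems by (intro psubset.IH) auto
      also have "star_sum (C - {d}) j * t d l = t d l * star_sum (C - {d}) j"
        using d psubset.prems by (intro star_sum_commute disjoint_commute) auto
      also have "(t j l * star_sum (C - {d}) l
          + (\<Sum>c\<in>C - {d}. t c l * pair_sum (C - {d} - {c}) l j * t c j)) * t d l
          = t j l * star_sum (C - {d}) l * t d l
            + (\<Sum>c\<in>C - {d}. t c l * pair_sum (C - {d} - {c}) l j * (t c j * t d l))"
        by (simp add: algebra_simps sum_distrib_right)
      also have "(\<Sum>c\<in>C - {d}. t c l * pair_sum (C - {d} - {c}) l j * (t c j * t d l))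
          = (\<Sum>c\<in>C - {d}. t c l * pair_sum (C - {d} - {c}) l j * t d l * t c j)"
      proof (intro sum.cong refl)
        fix c assume "c \<in> C - {d}"
        then have "t c j * t d l = t d l * t c j"
          using d psubset.prems by (intro disjoint_commute) auto
        then show "t c l * pair_sum (C - {d} - {c}) l j * (t c j * t d l)
            = t c l * pair_sum (C - {d} - {c}) l j * t d l * t c j"
          by (simp add: mult.assoc)
      qed
      finally show "star_sum (C - {d}) j * (t d j * t j l) = t j l * star_sum (C - {d}) l * t d l
          + (\<Sum>c\<in>C - {d}. t c l * pair_sum (C - {d} - {c}) l j * t d l * t c j)
          + t d l * star_sum (C - {d}) j * t d j" .
    qed
    also have "\<dots> = t j l * star_sum C l
        + (\<Sum>d\<in>C. \<Sum>c\<in>C - {d}. t c l * pair_sum (C - {d} - {c}) l j * t d l * t c j)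
        + (\<Sum>d\<in>C. t d l * star_sum (C - {d}) j * t d j)"
      by (simp add: star_sum_snoc[OF psubset(1) False] sum.distrib sum_distrib_left mult.assoc)
    \<comment> \<open>Exchanging the order of summation makes d the last edge of a pair sum over C -
      {c}, ready for \<open>pair_sum_snoc\<close>.\<close>
    also have "(\<Sum>d\<in>C. \<Sum>c\<in>C - {d}. t c l * pair_sum (C - {d} - {c}) l j * t d l * t c j)
        = (\<Sum>c\<in>C. \<Sum>d\<in>C - {c}. t c l * pair_sum (C - {c} - {d}) l j * t d l * t c j)"
      using psubset(1)
      by (simp add: sum.Sigma)
         (rule sum.reindex_bij_witness[where i = prod.swap and j = prod.swap];
          auto simp: Diff_insert[symmetric] insert_commute)
    also have "t j l * star_sum C l
        + (\<Sum>c\<in>C. \<Sum>d\<in>C - {c}. t c l * pair_sum (C - {c} - {d}) l j * t d l * t c j)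
        + (\<Sum>d\<in>C. t d l * star_sum (C - {d}) j * t d j)
        = t j l * star_sum C l + (\<Sum>c\<in>C. t c l * (star_sum (C - {c}) j
          + (\<Sum>d\<in>C - {c}. pair_sum (C - {c} - {d}) l j * t d l)) * t c j)"
      by (simp add: algebra_simps sum.distrib sum_distrib_left sum_distrib_right)
    also have "\<dots> = t j l * star_sum C l + (\<Sum>c\<in>C. t c l * pair_sum (C - {c}) l j * t c j)"
      using psubset by (subst pair_sum_snoc[of "C - {_}", symmetric]) auto
    finally show ?thesis .
  qed simp
qed

text \<open>The pair sum is \<open>matching_sum C [l, j]\<close>, and the edges leaving j turn j
  into a source at l. Peel off the first edge c at l: induction handles all edges but [j c], and
  these leftovers cancel the correction terms of \<open>star_sum_mult_edge\<close>, because [j c] =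
  -[c j].\<close>

lemma pair_sum_mult_edges:
  assumes "finite C" "j \<notin> C" "l \<notin> C" "j \<noteq> l"
  shows "pair_sum C l j * (t j l + (\<Sum>a\<in>C. t j a)) = star_sum (insert j C) l"
  using assms
proof (induction C rule: finite_psubset_induct)
  case (psubset C)
  have neg: "star_sum C j * (\<Sum>a\<in>C. t j a) = 0"
    using star_sum_mult_edges[OF psubset(1), of j] psubset.prems
    by (simp add: antisym[of _ j] sum_negf)
  have "(\<Sum>c\<in>C. t c l * pair_sum (C - {c}) l j * (t j l + (\<Sum>a\<in>C. t j a)))
      = (\<Sum>c\<in>C. t c l * star_sum (insert j (C - {c})) l + t c l * pair_sum (C - {c}) l j * t j c)"
  proof (intro sum.cong refl)
    fix c assume c: "c \<in> C"
    have eq: "t j l + (\<Sum>a\<in>C. t j a) = (t j l + (\<Sum>a\<in>C - {c}. t j a)) + t j c"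
      using sum.remove[OF psubset(1) c, of "t j"] by simp
    have IH: "pair_sum (C - {c}) l j * (t j l + (\<Sum>a\<in>C - {c}. t j a)) = star_sum (insert j (C - {c})) l"
      using c psubset.prems by (intro psubset.IH) auto
    show "t c l * pair_sum (C - {c}) l j * (t j l + (\<Sum>a\<in>C. t j a))
      = t c l * star_sum (insert j (C - {c})) l + t c l * pair_sum (C - {c}) l j * t j c"
      unfolding eq IH[symmetric] by (simp only: distrib_left mult.assoc)
  qed
  moreover have "star_sum C j * (t j l + (\<Sum>a\<in>C. t j a)) = star_sum C j * t j l"
    using neg by (simp add: distrib_left)
  ultimately have "pair_sum C l j * (t j l + (\<Sum>a\<in>C. t j a)) = star_sum C j * t j l
      + (\<Sum>c\<in>C. t c l * star_sum (insert j (C - {c})) l) + (\<Sum>c\<in>C. t c l * pair_sum (C - {c}) l j * t j c)"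
    by (subst pair_sum_Cons[OF psubset(1)])
       (simp only: distrib_right[of "star_sum C j"] sum_distrib_right sum.distrib add.assoc)
  also have "star_sum C j * t j l = t j l * star_sum C l + (\<Sum>c\<in>C. t c l * pair_sum (C - {c}) l j * t c j)"
    using psubset by (intro star_sum_mult_edge) auto
  also have "(\<Sum>c\<in>C. t c l * pair_sum (C - {c}) l j * t j c) = - (\<Sum>c\<in>C. t c l * pair_sum (C - {c}) l j * t c j)"
    by (simp add: antisym[of _ j] sum_negf)
  finally have "pair_sum C l j * (t j l + (\<Sum>a\<in>C. t j a))
      = t j l * star_sum C l + (\<Sum>c\<in>C. t c l * star_sum (insert j (C - {c})) l)"
    by simp
  also have "\<dots> = star_sum (insert j C) l"
  proof -
    have "insert j C - {c} = insert j (C - {c})" if "c \<in> C" for c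
      using that psubset.prems by auto
    then show ?thesis
      using psubset by (simp add: star_sum_Cons[of "insert j C"] cong: sum.cong)
  qed
  finally show ?case .
qed

text \<open>Edges from j to sources of the star at j vanish against that star, so in each summand
  only the sources of the star at l matter. In this form the identity applies to one block of a
  matching.\<close>

lemma sum_star_sum_mult_edges:
  assumes "finite C" "j \<notin> C" "l \<notin> C" "j \<noteq> l"
  shows "(\<Sum>B\<in>Pow C. star_sum B l * star_sum (C - B) j * (t j l + (\<Sum>a\<in>B. t j a)))
    = star_sum (insert j C) l"
proof -
  have "star_sum B l * star_sum (C - B) j * (t j l + (\<Sum>a\<in>B. t j a))
      = star_sum B l * star_sum (C - B) j * (t j l + (\<Sum>a\<in>C. t j a))" if "B \<in> Pow C" for B
  proof -
    have "star_sum (C - B) j * (\<Sum>a\<in>C - B. t j a) = 0"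
      using star_sum_mult_edges[of "C - B" j] assms
      by (simp add: antisym[of _ j] sum_negf)
    moreover have "(\<Sum>a\<in>C. t j a) = (\<Sum>a\<in>B. t j a) + (\<Sum>a\<in>C - B. t j a)"
      using assms(1) that by (simp add: sum.subset_diff add.commute)
    ultimately show ?thesis by (simp add: distrib_left mult.assoc)
  qed
  then show ?thesis
    using pair_sum_mult_edges[OF assms] by (simp add: pair_sum_def sum_distrib_right)
qed

section \<open>Matching sources with targets, several sources to a target\<close>

primrec matching_sum :: "nat set \<Rightarrow> nat list \<Rightarrow> 'r" where
  "matching_sum A [] = (if A = {} then 1 else 0)"
| "matching_sum A (b # bs) = (\<Sum>B\<in>Pow A. star_sum B b * matching_sum (A - B) bs)"

lemma matching_sum_snoc:
  assumes "finite A"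
  shows "matching_sum A (bs @ [j]) = (\<Sum>D\<in>Pow A. matching_sum (A - D) bs * star_sum D j)"
  using assms
proof (induction bs arbitrary: A)
  case Nil
  have 1: "(\<Sum>B\<in>Pow A. star_sum B j * matching_sum (A - B) []) = (\<Sum>B\<in>{A}. star_sum B j * matching_sum (A - B) [])"
    using Nil by (intro sum.mono_neutral_right) auto
  have 2: "(\<Sum>B\<in>Pow A. matching_sum (A - B) [] * star_sum B j) = (\<Sum>B\<in>{A}. matching_sum (A - B) [] * star_sum B j)"
    using Nil by (intro sum.mono_neutral_right) auto
  show ?case using 1 2 by (simp add: if_distrib)
next
  case (Cons b bs)
  have diff: "A - D - B = A - B - D" for B D by auto
  have "matching_sum A ((b # bs) @ [j])
      = (\<Sum>B\<in>Pow A. \<Sum>D\<in>Pow (A - B). star_sum B b * matching_sum (A - B - D) bs * star_sum D j)"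
    using Cons.prems by (simp add: Cons.IH sum_distrib_left mult.assoc)
  also have "\<dots> = (\<Sum>D\<in>Pow A. \<Sum>B\<in>Pow (A - D). star_sum B b * matching_sum (A - B - D) bs * star_sum D j)"
    by (rule sum_Pow_disjoint_swap[OF Cons.prems])
  also have "\<dots> = (\<Sum>D\<in>Pow A. matching_sum (A - D) (b # bs) * star_sum D j)"
    by (simp add: sum_distrib_right diff)
  finally show ?case .
qed

lemma matching_sum_commute:
  assumes "\<And>a b. a \<in> A \<Longrightarrow> b \<in> set bs \<Longrightarrow> t a b * x = x * t a b"
  shows "matching_sum A bs * x = x * matching_sum A bs"
  using assms
proof (induction bs arbitrary: A)
  case (Cons b bs)
  have "star_sum B b * matching_sum (A - B) bs * x = x * (star_sum B b * matching_sum (A - B) bs)"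
    if "B \<in> Pow A" for B
  proof -
    have "matching_sum (A - B) bs * x = x * matching_sum (A - B) bs"
      using Cons.prems by (intro Cons.IH) auto
    moreover have "star_sum B b * x = x * star_sum B b"
      using Cons.prems that by (intro star_sum_commute) auto
    ultimately show ?thesis by (metis mult.assoc)
  qed
  then show ?case by (simp add: sum_distrib_left sum_distrib_right)
qed simp

text \<open>The edges leaving j turn it from the last target into a source. For the block B of the
  first target b, the edges to b and B only involve the stars at b and j, and the two-star identity
  makes j join the block of b. The remaining edges are treated by induction and make j join a later
  block. With no target left, the edges vanish against the star at j.\<close>

lemma matching_sum_mult_edges:
  assumes "finite A" "distinct (bs @ [j])" "A \<inter> set (bs @ [j]) = {}"
  shows "matching_sum A (bs @ [j]) * ((\<Sum>b\<in>set bs. t j b) + (\<Sum>a\<in>A. t j a))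
    = matching_sum (insert j A) bs"
  using assms
proof (induction bs arbitrary: A)
  case Nil
  have "matching_sum A [j] = star_sum A j"
  proof -
    have "(\<Sum>B\<in>Pow A. star_sum B j * matching_sum (A - B) []) = (\<Sum>B\<in>{A}. star_sum B j * matching_sum (A - B) [])"
      using Nil by (intro sum.mono_neutral_right) auto
    then show ?thesis by simp
  qed
  then show ?case
    using star_sum_mult_edges[of A j] Nil by (simp add: antisym[of _ j] sum_negf del: matching_sum.simps(2))
next
  case (Cons b bs)
  let ?th = "\<lambda>A. (\<Sum>b\<in>set bs. t j b) + (\<Sum>a\<in>A. t j a)"
  have "j \<notin> A" using Cons.prems by auto
  have diff: "A - (B \<union> D) = A - B - D" for B D by auto
  have split: "(\<Sum>b\<in>set (b # bs). t j b) + (\<Sum>a\<in>A. t j a)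
      = ?th (A - B) + (t j b + (\<Sum>a\<in>B. t j a))" if "B \<in> Pow A" for B
    using that Cons.prems sum.subset_diff[of B A "t j"] by (simp add: algebra_simps)
  have "matching_sum A ((b # bs) @ [j]) * ((\<Sum>b\<in>set (b # bs). t j b) + (\<Sum>a\<in>A. t j a))
      = (\<Sum>B\<in>Pow A. star_sum B b * (matching_sum (A - B) (bs @ [j]) * ?th (A - B)))
        + (\<Sum>B\<in>Pow A. star_sum B b * matching_sum (A - B) (bs @ [j]) * (t j b + (\<Sum>a\<in>B. t j a)))"
    unfolding append_Cons matching_sum.simps sum_distrib_right sum.distrib[symmetric]
    by (intro sum.cong refl) (simp only: split distrib_left mult.assoc)
  also have "(\<Sum>B\<in>Pow A. star_sum B b * (matching_sum (A - B) (bs @ [j]) * ?th (A - B)))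
      = (\<Sum>B\<in>Pow A. star_sum B b * matching_sum (insert j (A - B)) bs)"
    using Cons.prems by (intro sum.cong refl arg_cong2[where f = "(*)"] Cons.IH) auto
  also have "(\<Sum>B\<in>Pow A. star_sum B b * matching_sum (A - B) (bs @ [j]) * (t j b + (\<Sum>a\<in>B. t j a)))
      = (\<Sum>B\<in>Pow A. \<Sum>D\<in>Pow (A - B).
          star_sum B b * star_sum D j * (t j b + (\<Sum>a\<in>B. t j a)) * matching_sum (A - (B \<union> D)) bs)"
  proof (intro sum.cong refl)
    fix B assume B: "B \<in> Pow A"
    have "star_sum B b * matching_sum (A - B) (bs @ [j]) * (t j b + (\<Sum>a\<in>B. t j a))
        = (\<Sum>D\<in>Pow (A - B). star_sum B b * (matching_sum (A - B - D) bs * (star_sum D j * (t j b + (\<Sum>a\<in>B. t j a)))))"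
      using Cons.prems by (simp add: matching_sum_snoc sum_distrib_left sum_distrib_right mult.assoc)
    also have "\<dots> = (\<Sum>D\<in>Pow (A - B).
          star_sum B b * star_sum D j * (t j b + (\<Sum>a\<in>B. t j a)) * matching_sum (A - (B \<union> D)) bs)"
    proof (intro sum.cong refl)
      fix D assume D: "D \<in> Pow (A - B)"
      let ?x = "star_sum D j * (t j b + (\<Sum>a\<in>B. t j a))"
      \<comment> \<open>The middle blocks have sources in A - B - D and targets in
        \<open>bs\<close>, disjoint from the indices of \<open>?x\<close>, so the stars at b and j
        can be brought together.\<close>
      have "matching_sum (A - B - D) bs * ?x = ?x * matching_sum (A - B - D) bs"
      proof (rule matching_sum_commute)
        fix a' b' assume ab: "a' \<in> A - B - D" "b' \<in> set bs"
        have "star_sum D j * t a' b' = t a' b' * star_sum D j"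
          using ab D B Cons.prems by (intro star_sum_commute disjoint_commute) auto
        moreover have "t j c * t a' b' = t a' b' * t j c" if "c \<in> insert b B" for c
          using ab B Cons.prems that by (intro disjoint_commute) auto
        then have "(t j b + (\<Sum>a\<in>B. t j a)) * t a' b' = t a' b' * (t j b + (\<Sum>a\<in>B. t j a))"
          by (simp add: distrib_left distrib_right sum_distrib_left sum_distrib_right)
        ultimately show "t a' b' * ?x = ?x * t a' b'"
          by (metis mult.assoc)
      qed
      then show "star_sum B b * (matching_sum (A - B - D) bs * ?x)
          = star_sum B b * star_sum D j * (t j b + (\<Sum>a\<in>B. t j a)) * matching_sum (A - (B \<union> D)) bs"
        by (simp add: mult.assoc diff)
    qed
    finally show "star_sum B b * matching_sum (A - B) (bs @ [j]) * (t j b + (\<Sum>a\<in>B. t j a))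
        = (\<Sum>D\<in>Pow (A - B).
          star_sum B b * star_sum D j * (t j b + (\<Sum>a\<in>B. t j a)) * matching_sum (A - (B \<union> D)) bs)" .
  qed
  \<comment> \<open>Regroup by C = B \<union> D, the sources used at b or at j; the inner sum then
    is the two-star identity.\<close>
  also have "\<dots> = (\<Sum>C\<in>Pow A. \<Sum>B\<in>Pow C.
      star_sum B b * star_sum (C - B) j * (t j b + (\<Sum>a\<in>B. t j a)) * matching_sum (A - (B \<union> (C - B))) bs)"
    by (rule sum_Pow_disjoint_pairs) (use Cons.prems in auto)
  also have "\<dots> = (\<Sum>C\<in>Pow A. (\<Sum>B\<in>Pow C.
      star_sum B b * star_sum (C - B) j * (t j b + (\<Sum>a\<in>B. t j a))) * matching_sum (A - C) bs)"
    by (auto simp: sum_distrib_right Un_absorb1 intro!: sum.cong)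
  also have "\<dots> = (\<Sum>C\<in>Pow A. star_sum (insert j C) b * matching_sum (A - C) bs)"
    using Cons.prems by (intro sum.cong refl arg_cong2[where f = "(*)"] sum_star_sum_mult_edges)
      (auto intro: finite_subset)
  \<comment> \<open>The two sums are the cases j outside and j inside the block of b.\<close>
  also have "(\<Sum>B\<in>Pow A. star_sum B b * matching_sum (insert j (A - B)) bs)
      + (\<Sum>C\<in>Pow A. star_sum (insert j C) b * matching_sum (A - C) bs)
      = (\<Sum>B\<in>Pow (insert j A). star_sum B b * matching_sum (insert j A - B) bs)"
  proof -
    have "insert j A - B = insert j (A - B)" "insert j A - insert j B = A - B" if "B \<in> Pow A" for B
      using that \<open>j \<notin> A\<close> by auto
    then show ?thesis
      using Cons.prems(1) \<open>j \<notin> A\<close>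
      by (subst sum_Pow_insert) (auto intro!: arg_cong2[where f = "(+)"] sum.cong)
  qed
  finally show ?case by simp
qed

definition e_sum :: "nat \<Rightarrow> nat set \<Rightarrow> nat list \<Rightarrow> 'r" where
  "e_sum m I bs = (\<Sum>A | A \<subseteq> I \<and> card A = m. matching_sum A bs)"

text \<open>The first term has an empty block at j. In all others the block at j comes last, so the
  product ends in some \<open>t a j\<close>.\<close>

lemma matching_sum_last_edge:
  assumes "finite A"
  shows "matching_sum A (bs @ [j]) = matching_sum A bs
    + (\<Sum>a\<in>A. matching_sum (A - {a}) (bs @ [j]) * t a j)"
proof -
  let ?f = "\<lambda>D. matching_sum (A - D) bs"
  have "matching_sum A (bs @ [j]) = ?f {} * star_sum {} j + (\<Sum>D\<in>Pow A - {{}}. ?f D * star_sum D j)"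
    unfolding matching_sum_snoc[OF assms] using assms by (intro sum.remove) auto
  also have "(\<Sum>D\<in>Pow A - {{}}. ?f D * star_sum D j)
      = (\<Sum>D\<in>Pow A - {{}}. \<Sum>a\<in>D. ?f (insert a (D - {a})) * star_sum (D - {a}) j * t a j)"
  proof (intro sum.cong refl)
    fix D assume "D \<in> Pow A - {{}}"
    then have "finite D" "D \<noteq> {}" using assms finite_subset by auto
    then show "?f D * star_sum D j = (\<Sum>a\<in>D. ?f (insert a (D - {a})) * star_sum (D - {a}) j * t a j)"
      by (simp add: star_sum_snoc sum_distrib_left insert_absorb mult.assoc cong: sum.cong)
  qed
  also have "\<dots> = (\<Sum>D\<in>Pow A. \<Sum>a\<in>D. ?f (insert a (D - {a})) * star_sum (D - {a}) j * t a j)"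
    using assms by (intro sum.mono_neutral_left) auto
  also have "\<dots> = (\<Sum>a\<in>A. \<Sum>D\<in>Pow (A - {a}). ?f (insert a D) * star_sum D j * t a j)"
    by (rule sum_Pow_pointed[OF assms])
  finally show ?thesis
    using assms by (simp add: matching_sum_snoc sum_distrib_right Diff_insert2[symmetric])
qed

text \<open>For a source set A, the edges from j to \<open>bs\<close> and to A produce the matchings
  with j as a new source. Those to a in I - A append -[a j] and cancel the surplus of
  \<open>e_sum (Suc m) I (bs @ [j])\<close> over \<open>e_sum (Suc m) I bs\<close>, the matchings
  that use the target j.\<close>

lemma e_sum_insert:
  assumes "finite I" "distinct (bs @ [j])" "I \<inter> set (bs @ [j]) = {}"
  shows "e_sum (Suc m) (insert j I) bs = e_sum (Suc m) I (bs @ [j])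
    + e_sum m I (bs @ [j]) * ((\<Sum>b\<in>set bs. t j b) + (\<Sum>a\<in>I. t j a))"
proof -
  let ?P = "\<lambda>m. {A. A \<subseteq> I \<and> card A = m}"
  have fin: "finite (?P m)" for m using assms(1) by auto
  have finS: "finite A" if "A \<subseteq> I" for A using that assms(1) finite_subset by auto
  have finA: "finite A" if "A \<in> ?P m" for A m using that assms(1) finite_subset by auto
  have j: "j \<notin> I" using assms by auto
  have "{A. A \<subseteq> insert j I \<and> card A = Suc m} = ?P (Suc m) \<union> insert j ` ?P m"
  proof (intro set_eqI iffI)
    fix A assume A: "A \<in> {A. A \<subseteq> insert j I \<and> card A = Suc m}"
    then have f: "finite A" by (intro card_ge_0_finite) simp
    show "A \<in> ?P (Suc m) \<union> insert j ` ?P m"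
    proof (cases "j \<in> A")
      case True
      then have "A = insert j (A - {j})" "A - {j} \<in> ?P m" using A f by auto
      then show ?thesis by blast
    qed (use A in auto)
  next
    fix A assume "A \<in> ?P (Suc m) \<union> insert j ` ?P m"
    then show "A \<in> {A. A \<subseteq> insert j I \<and> card A = Suc m}"
      using j finS by (auto simp: card_insert_if subset_iff)
  qed
  moreover have "?P (Suc m) \<inter> insert j ` ?P m = {}" "inj_on (insert j) (?P m)"
    using j by (auto simp: inj_on_def)
  ultimately have 1: "e_sum (Suc m) (insert j I) bs
      = e_sum (Suc m) I bs + (\<Sum>A\<in>?P m. matching_sum (insert j A) bs)"
    unfolding e_sum_def using fin by (simp add: sum.union_disjoint sum.reindex)
  have "e_sum m I (bs @ [j]) * ((\<Sum>b\<in>set bs. t j b) + (\<Sum>a\<in>I. t j a))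
      = (\<Sum>A\<in>?P m. matching_sum A (bs @ [j]) * ((\<Sum>b\<in>set bs. t j b) + (\<Sum>a\<in>A. t j a))
          + (\<Sum>a\<in>I - A. matching_sum A (bs @ [j]) * t j a))"
    unfolding e_sum_def sum_distrib_right
  proof (intro sum.cong refl)
    fix A assume "A \<in> ?P m"
    then have "(\<Sum>a\<in>I. t j a) = (\<Sum>a\<in>A. t j a) + (\<Sum>a\<in>I - A. t j a)"
      using assms(1) sum.subset_diff[of A I "t j"] by (simp add: add.commute)
    then show "matching_sum A (bs @ [j]) * ((\<Sum>b\<in>set bs. t j b) + (\<Sum>a\<in>I. t j a))
      = matching_sum A (bs @ [j]) * ((\<Sum>b\<in>set bs. t j b) + (\<Sum>a\<in>A. t j a))
          + (\<Sum>a\<in>I - A. matching_sum A (bs @ [j]) * t j a)"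
      by (simp add: algebra_simps sum_distrib_left)
  qed
  also have "\<dots> = (\<Sum>A\<in>?P m. matching_sum (insert j A) bs)
      + (\<Sum>A\<in>?P m. \<Sum>a\<in>I - A. matching_sum A (bs @ [j]) * t j a)"
    unfolding sum.distrib
  proof (intro arg_cong2[where f = "(+)"] sum.cong refl matching_sum_mult_edges)
    fix A assume A: "A \<in> ?P m"
    then show "finite A" "distinct (bs @ [j])" "A \<inter> set (bs @ [j]) = {}"
      using assms finA[OF A] by auto
  qed
  also have "(\<Sum>A\<in>?P m. \<Sum>a\<in>I - A. matching_sum A (bs @ [j]) * t j a)
      = - (\<Sum>A\<in>?P m. \<Sum>a\<in>I - A. matching_sum A (bs @ [j]) * t a j)"
    by (simp add: antisym[of _ j] sum_negf)
  \<comment> \<open>A set with a new element a corresponds to a set of size m + 1 with a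
    distinguished element, as in \<open>matching_sum_last_edge\<close>.\<close>
  also have "(\<Sum>A\<in>?P m. \<Sum>a\<in>I - A. matching_sum A (bs @ [j]) * t a j)
      = (\<Sum>A\<in>?P (Suc m). \<Sum>a\<in>A. matching_sum (A - {a}) (bs @ [j]) * t a j)"
  proof -
    have "(\<Sum>(A, a)\<in>Sigma (?P m) (\<lambda>A. I - A). matching_sum A (bs @ [j]) * t a j)
        = (\<Sum>(A, a)\<in>Sigma (?P (Suc m)) (\<lambda>A. A). matching_sum (A - {a}) (bs @ [j]) * t a j)"
      by (rule sum.reindex_bij_witness[where i = "\<lambda>(A, a). (A - {a}, a)" and j = "\<lambda>(A, a). (insert a A, a)"])
        (auto simp: card_insert_if finS)
    then show ?thesis
      using fin finS assms(1) by (subst (1 2) sum.Sigma) auto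
  qed
  also have "(\<Sum>A\<in>?P (Suc m). \<Sum>a\<in>A. matching_sum (A - {a}) (bs @ [j]) * t a j)
      = e_sum (Suc m) I (bs @ [j]) - e_sum (Suc m) I bs"
    unfolding e_sum_def sum_subtractf[symmetric]
  proof (intro sum.cong refl)
    fix A assume "A \<in> ?P (Suc m)"
    then show "(\<Sum>a\<in>A. matching_sum (A - {a}) (bs @ [j]) * t a j)
        = matching_sum A (bs @ [j]) - matching_sum A bs"
      using matching_sum_last_edge[OF finA, of A] by simp
  qed
  finally show ?thesis using 1 by simp
qed

end

section \<open>Divided differences\<close>

lemma monomial_induct [case_names zero single]:
  fixes m :: "nat \<Rightarrow>\<^sub>0 nat"
  assumes "P 0" "\<And>j m. P m \<Longrightarrow> P (Poly_Mapping.single j 1 + m)"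
  shows "P m"
proof (induction m rule: update_induct)
  case (update f a b)
  have "P (Poly_Mapping.single a n + f)" for n
  proof (induction n)
    case (Suc n)
    have "Poly_Mapping.single a (Suc n) = Poly_Mapping.single a 1 + Poly_Mapping.single a n"
      by (simp add: single_add[symmetric])
    then show ?case using assms(2)[OF Suc] by (simp add: add.assoc)
  qed (use update in simp)
  moreover have "Poly_Mapping.update a b f = Poly_Mapping.single a b + f"
    using update by (intro poly_mapping_eqI) (auto simp: lookup_update lookup_add lookup_single in_keys_iff when_def)
  ultimately show ?case by simp
qed (rule assms(1))

text \<open>Integer polynomials form the free abelian group on the monomials, hence closure under
  differences suffices.\<close>

lemma ipoly_monomial_induct [case_names zero monomial diff]:
  fixes f :: ipoly
  assumes "P 0" "\<And>m. P (frag_of m)" "\<And>f g. P f \<Longrightarrow> P g \<Longrightarrow> P (f - g)"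
  shows "P f"
  by (rule frag_induction[of f UNIV P]) (simp_all only: assms subset_UNIV)

lemma var_times_single:
  "var j * Poly_Mapping.single m c = Poly_Mapping.single (Poly_Mapping.single j 1 + m) c"
  by (simp add: var_def mult_single)

lemma ipoly_induct [case_names zero one var diff]:
  fixes f :: ipoly
  assumes "P 0" "P 1" "\<And>j f. P f \<Longrightarrow> P (var j * f)" "\<And>f g. P f \<Longrightarrow> P g \<Longrightarrow> P (f - g)"
  shows "P f"
proof -
  have "P (frag_of m)" for m
  proof (induction m rule: monomial_induct)
    case (single j m)
    then show ?case using assms(3)[OF single] by (simp add: var_times_single)
  qed (use assms(2) in simp)
  then show ?thesis by (rule ipoly_monomial_induct[of P, OF assms(1) _ assms(4)])
qed

lemma inj_map_key_transpose: "inj (Poly_Mapping.map_key (transpose i j) :: _ \<Rightarrow> ('a \<Rightarrow>\<^sub>0 'b::zero))"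
  and map_key_transpose_involutory:
    "Poly_Mapping.map_key (transpose i j) (Poly_Mapping.map_key (transpose i j) m) = (m :: 'a \<Rightarrow>\<^sub>0 'b)"
proof -
  show eq: "Poly_Mapping.map_key (transpose i j) (Poly_Mapping.map_key (transpose i j) m) = m" for m :: "'a \<Rightarrow>\<^sub>0 'b"
    using map_key_id[of m] by (simp add: map_key_compose id_def)
  show "inj (Poly_Mapping.map_key (transpose i j) :: _ \<Rightarrow> ('a \<Rightarrow>\<^sub>0 'b::zero))"
    by (rule inj_on_inverseI[where g = "Poly_Mapping.map_key (transpose i j)"]) (rule eq)
qed

lemma swap_vars_single:
  "swap_vars i (Poly_Mapping.single m c) = Poly_Mapping.single (Poly_Mapping.map_key (transpose i (Suc i)) m) c"
  unfolding swap_vars_def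
  using map_key_single[OF inj_map_key_transpose, of i "Suc i" "Poly_Mapping.map_key (transpose i (Suc i)) m" c]
  by (simp add: map_key_transpose_involutory)

lemma lookup_swap_vars:
  "Poly_Mapping.lookup (swap_vars i f) m = Poly_Mapping.lookup f (Poly_Mapping.map_key (transpose i (Suc i)) m)"
  unfolding swap_vars_def by (simp add: map_key.rep_eq[OF inj_map_key_transpose])

lemma swap_vars_0 [simp]: "swap_vars i 0 = 0"
  and swap_vars_add: "swap_vars i (f + g) = swap_vars i f + swap_vars i g"
  and swap_vars_diff: "swap_vars i (f - g) = swap_vars i f - swap_vars i g"
  and swap_vars_swap_vars [simp]: "swap_vars i (swap_vars i f) = f"
  by (intro poly_mapping_eqI; simp add: lookup_swap_vars lookup_add lookup_minus map_key_transpose_involutory)+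

lemma swap_vars_1 [simp]: "swap_vars i 1 = 1"
  unfolding single_one[symmetric] swap_vars_single by simp

lemma swap_vars_var: "swap_vars i (var j) = var (transpose i (Suc i) j)"
  unfolding var_def swap_vars_single
  using map_key_single[OF inj_transpose, of i "Suc i" "transpose i (Suc i) j" "1::nat"]
  by simp

lemma swap_vars_var_mult: "swap_vars i (var j * f) = swap_vars i (var j) * swap_vars i f"
proof (induction f rule: ipoly_monomial_induct)
  case (monomial m)
  have "Poly_Mapping.map_key (transpose i (Suc i)) (Poly_Mapping.single j 1 + m)
      = Poly_Mapping.single (transpose i (Suc i) j) 1 + Poly_Mapping.map_key (transpose i (Suc i)) m"
    using map_key_single[OF inj_transpose, of i "Suc i" "transpose i (Suc i) j" "1::nat"]
    by (simp add: map_key_plus[OF inj_transpose])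
  then show ?case by (simp add: var_times_single swap_vars_single swap_vars_var del: One_nat_def)
qed (auto simp: right_diff_distrib swap_vars_diff)

lemma swap_vars_mult: "swap_vars i (f * g) = swap_vars i f * swap_vars i g"
  by (induction f rule: ipoly_induct)
    (auto simp: left_diff_distrib swap_vars_diff swap_vars_var_mult mult.assoc)

lemma var_eq_iff [simp]: "var i = var j \<longleftrightarrow> i = j"
proof
  assume "var i = var j"
  then have "Poly_Mapping.single i (1::nat) = Poly_Mapping.single j 1"
    unfolding var_def by (metis frag_of_eq)
  then show "i = j" by (metis lookup_single_eq lookup_single_not_eq zero_neq_one)
qed simp

text \<open>The twisted Leibniz rule builds the quotient for x_j f from those for x_j and f, so only
  single variables have to be divided.\<close>

lemma divided_difference_exists:
  "\<exists>g. g * (var i - var (Suc i)) = f - swap_vars i f"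
proof (induction f rule: ipoly_induct)
  case (var j f)
  then obtain g where g: "g * (var i - var (Suc i)) = f - swap_vars i f" by auto
  have *: "var j * f - swap_vars i (var j * f)
      = (var j - swap_vars i (var j)) * f + swap_vars i (var j) * (f - swap_vars i f)"
    by (simp add: swap_vars_mult algebra_simps)
  obtain h where "h * (var i - var (Suc i)) = var j - swap_vars i (var j)"
  proof -
    have "\<exists>h. h * (var i - var (Suc i)) = var j - swap_vars i (var j)"
      \<comment> \<open>The quotients are 1 for x_i, -1 for x_(i+1), and 0 for every other
        variable.\<close>
      by (cases "j = i"; cases "j = Suc i")
        (auto simp: swap_vars_var intro: exI[of _ 0] exI[of _ 1] exI[of _ "-1"])
    then show thesis using that by blast
  qed
  then have "(h * f + swap_vars i (var j) * g) * (var i - var (Suc i)) = var j * f - swap_vars i (var j * f)"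
    unfolding * g[symmetric] by (simp only: distrib_right mult.assoc) (simp only: mult_ac)
  then show ?case by blast
next
  case (diff f g)
  then obtain f' g' where "f' * (var i - var (Suc i)) = f - swap_vars i f"
    "g' * (var i - var (Suc i)) = g - swap_vars i g" by auto
  then have "(f' - g') * (var i - var (Suc i)) = (f - g) - swap_vars i (f - g)"
    by (simp add: left_diff_distrib swap_vars_diff)
  then show ?case by blast
qed (auto intro: exI[of _ 0])

text \<open>The quotient is unique because polynomials form an integral domain and x_i differs from
  x_(i+1). Together with existence this justifies the definite description.\<close>

lemma divided_difference_eqI:
  assumes "g * (var i - var (Suc i)) = f - swap_vars i f"
  shows "divided_difference i f = g"
  unfolding divided_difference_def
proof (rule the_equality)
  show "g * (var i - var (Suc i)) = f - swap_vars i f" by (rule assms)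
next
  fix h assume "h * (var i - var (Suc i)) = f - swap_vars i f"
  then show "h = g" using assms mult_cancel_right[of h "var i - var (Suc i)" g] by simp
qed

lemma divided_difference_mult_vars:
  "divided_difference i f * (var i - var (Suc i)) = f - swap_vars i f"
  using divided_difference_exists divided_difference_eqI by metis

lemma divided_difference_add:
  "divided_difference i (f + g) = divided_difference i f + divided_difference i g"
  by (rule divided_difference_eqI) (simp add: distrib_right divided_difference_mult_vars swap_vars_add)

lemma divided_difference_diff:
  "divided_difference i (f - g) = divided_difference i f - divided_difference i g"
  by (rule divided_difference_eqI) (simp add: left_diff_distrib divided_difference_mult_vars swap_vars_diff)

lemma divided_difference_eq_0: "swap_vars i f = f \<Longrightarrow> divided_difference i f = 0"
  by (rule divided_difference_eqI) simp

lemma divided_difference_eq_0D: "divided_difference i f = 0 \<Longrightarrow> swap_vars i f = f"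
  using divided_difference_mult_vars[of i f] by simp

lemma divided_difference_sum:
  "divided_difference i (sum f A) = (\<Sum>x\<in>A. divided_difference i (f x))"
  by (induction A rule: infinite_finite_induct) (auto simp: divided_difference_add divided_difference_eq_0)

lemma divided_difference_mult:
  "divided_difference i (f * g) = divided_difference i f * g + swap_vars i f * divided_difference i g"
proof (rule divided_difference_eqI)
  have "(divided_difference i f * g + swap_vars i f * divided_difference i g) * (var i - var (Suc i))
      = (divided_difference i f * (var i - var (Suc i))) * g
        + swap_vars i f * (divided_difference i g * (var i - var (Suc i)))"
    by (simp add: algebra_simps)
  also have "\<dots> = f * g - swap_vars i (f * g)"
    unfolding divided_difference_mult_vars swap_vars_mult by (simp add: algebra_simps)
  finally show "(divided_difference i f * g + swap_vars i f * divided_difference i g) * (var i - var (Suc i))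
      = f * g - swap_vars i (f * g)" .
qed

lemma divided_difference_var:
  "divided_difference i (var j) = of_bool (j = i) - of_bool (j = Suc i)"
  by (rule divided_difference_eqI) (auto simp: swap_vars_var transpose_def)

lemma swap_vars_divided_difference [simp]: "swap_vars i (divided_difference i f) = divided_difference i f"
proof -
  have "swap_vars i (divided_difference i f * (var i - var (Suc i))) = swap_vars i (f - swap_vars i f)"
    by (simp add: divided_difference_mult_vars)
  then have "swap_vars i (divided_difference i f) * (var (Suc i) - var i) = swap_vars i f - f"
    by (simp add: swap_vars_mult swap_vars_diff swap_vars_var)
  then have "swap_vars i (divided_difference i f) * (var i - var (Suc i)) = f - swap_vars i f"
    by (simp add: algebra_simps)
  then show ?thesis using divided_difference_eqI by metis
qed

lemma divided_difference_twice [simp]: "divided_difference i (divided_difference i f) = 0"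
  by (simp add: divided_difference_eq_0)

section \<open>Commutation and braid relations\<close>

lemma swap_vars_commute:
  assumes "Suc i < j"
  shows "swap_vars i (swap_vars j f) = swap_vars j (swap_vars i f)"
proof (induction f rule: ipoly_induct)
  case (var k f)
  then show ?case using assms by (simp add: swap_vars_mult swap_vars_var transpose_def)
qed (auto simp: swap_vars_diff)

lemma swap_vars_braid:
  "swap_vars i (swap_vars (Suc i) (swap_vars i f)) = swap_vars (Suc i) (swap_vars i (swap_vars (Suc i) f))"
proof (induction f rule: ipoly_induct)
  case (var k f)
  then show ?case by (simp add: swap_vars_mult swap_vars_var transpose_def)
qed (auto simp: swap_vars_diff)

lemma swap_vars_divided_difference_commute:
  assumes "Suc i < j"
  shows "swap_vars j (divided_difference i f) = divided_difference i (swap_vars j f)"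
proof (rule divided_difference_eqI[symmetric])
  have "swap_vars j (divided_difference i f * (var i - var (Suc i))) = swap_vars j (f - swap_vars i f)"
    by (simp add: divided_difference_mult_vars)
  then show "swap_vars j (divided_difference i f) * (var i - var (Suc i)) = swap_vars j f - swap_vars i (swap_vars j f)"
    using assms by (simp add: swap_vars_mult swap_vars_diff swap_vars_var swap_vars_commute[OF assms])
qed

lemma divided_difference_commute:
  assumes "Suc i < j"
  shows "divided_difference i (divided_difference j f) = divided_difference j (divided_difference i f)"
proof (rule divided_difference_eqI[symmetric])
  show "divided_difference i (divided_difference j f) * (var j - var (Suc j))
      = divided_difference i f - swap_vars j (divided_difference i f)"
  proof -
    have "divided_difference i (divided_difference j f * (var j - var (Suc j)))
        = divided_difference i (divided_difference j f) * (var j - var (Suc j))"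
      using assms by (simp add: divided_difference_mult divided_difference_diff divided_difference_var)
    then show ?thesis
      using assms by (simp add: divided_difference_mult_vars divided_difference_diff swap_vars_divided_difference_commute)
  qed
qed

text \<open>Times the Vandermonde product in three variables, both composites give the signed sum of
  the images of f under S_3. The two sums differ only in how the longest element is written, s r s
  or r s r.\<close>

lemma divided_difference_braid_expand:
  fixes f :: ipoly and i :: nat
  defines "a \<equiv> var i" and "b \<equiv> var (Suc i)" and "c \<equiv> var (Suc (Suc i))"
  defines "s \<equiv> swap_vars i" and "r \<equiv> swap_vars (Suc i)"
  defines "d \<equiv> divided_difference i" and "e \<equiv> divided_difference (Suc i)"
  shows "d (e (d f)) * ((a - b) * (b - c) * (a - c)) = f - s f - r f + s (r f) + r (s f) - s (r (s f))"
    and "e (d (e f)) * ((a - b) * (b - c) * (a - c)) = f - s f - r f + s (r f) + r (s f) - r (s (r f))"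
proof -
  have d: "d f * (a - b) = f - s f" and e: "e f * (b - c) = f - r f" for f
    unfolding a_def b_def c_def d_def e_def s_def r_def by (rule divided_difference_mult_vars)+
  have sv: "s a = b" "s b = a" "s c = c" "r a = a" "r b = c" "r c = b"
    unfolding a_def b_def c_def s_def r_def by (auto simp: swap_vars_var transpose_def)
  have hom: "s (f * g) = s f * s g" "s (f - g) = s f - s g" "r (f * g) = r f * r g" "r (f - g) = r f - r g" for f g
    unfolding s_def r_def by (rule swap_vars_mult swap_vars_diff)+
  have inv: "s (d f) = d f" "r (e f) = e f" for f
    unfolding s_def r_def d_def e_def by simp_all
  have ded: "s (e (d f)) * (a - c) = d f - s (r (d f))"
    using arg_cong[OF e[of "d f"], of s] by (simp add: hom sv inv)
  have rdf: "r (d f) * (a - c) = r f - r (s f)"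
    using arg_cong[OF d[of f], of r] by (simp add: hom sv)
  have srdf: "s (r (d f)) * (b - c) = s (r f) - s (r (s f))"
    using arg_cong[OF rdf, of s] by (simp add: hom sv)
  have "d (e (d f)) * ((a - b) * (b - c) * (a - c)) = (d (e (d f)) * (a - b)) * ((b - c) * (a - c))"
    by (simp only: mult_ac)
  also have "\<dots> = (e (d f) * (b - c)) * (a - c) - (s (e (d f)) * (a - c)) * (b - c)"
    unfolding d by (simp add: algebra_simps)
  also have "\<dots> = d f * (a - b) - r (d f) * (a - c) + s (r (d f)) * (b - c)"
    unfolding e ded by (simp add: algebra_simps)
  also have "\<dots> = f - s f - r f + s (r f) + r (s f) - s (r (s f))"
    unfolding d rdf srdf by simp
  finally show "d (e (d f)) * ((a - b) * (b - c) * (a - c)) = f - s f - r f + s (r f) + r (s f) - s (r (s f))" .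
  have ede: "r (d (e f)) * (a - c) = e f - r (s (e f))"
    using arg_cong[OF d[of "e f"], of r] by (simp add: hom sv inv)
  have sef: "s (e f) * (a - c) = s f - s (r f)"
    using arg_cong[OF e[of f], of s] by (simp add: hom sv)
  have rsef: "r (s (e f)) * (a - b) = r (s f) - r (s (r f))"
    using arg_cong[OF sef, of r] by (simp add: hom sv)
  have "e (d (e f)) * ((a - b) * (b - c) * (a - c)) = (e (d (e f)) * (b - c)) * ((a - b) * (a - c))"
    by (simp only: mult_ac)
  also have "\<dots> = (d (e f) * (a - b)) * (a - c) - (r (d (e f)) * (a - c)) * (a - b)"
    unfolding e by (simp add: algebra_simps)
  also have "\<dots> = e f * (b - c) - s (e f) * (a - c) + r (s (e f)) * (a - b)"
    unfolding d ede by (simp add: algebra_simps)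
  also have "\<dots> = f - s f - r f + s (r f) + r (s f) - r (s (r f))"
    unfolding e sef rsef by simp
  finally show "e (d (e f)) * ((a - b) * (b - c) * (a - c)) = f - s f - r f + s (r f) + r (s f) - r (s (r f))" .
qed

lemma divided_difference_braid:
  "divided_difference i (divided_difference (Suc i) (divided_difference i f))
    = divided_difference (Suc i) (divided_difference i (divided_difference (Suc i) f))"
proof -
  let ?v = "(var i - var (Suc i)) * (var (Suc i) - var (Suc (Suc i))) * (var i - var (Suc (Suc i)))"
  have "?v \<noteq> 0" by simp
  moreover have "divided_difference i (divided_difference (Suc i) (divided_difference i f)) * ?v
      = divided_difference (Suc i) (divided_difference i (divided_difference (Suc i) f)) * ?v"
    unfolding divided_difference_braid_expand swap_vars_braid ..
  ultimately show ?thesis by (metis mult_cancel_right)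
qed

text \<open>Homogeneous without \<open>x\<^sub>0\<close>, the variable that no \<open>\<partial>\<^sub>i\<close> with \<open>i \<ge> 1\<close> detects.\<close>

inductive homogeneous :: "nat \<Rightarrow> ipoly \<Rightarrow> bool" where
  one: "homogeneous 0 1"
| zero: "homogeneous d 0"
| add: "homogeneous d f \<Longrightarrow> homogeneous d g \<Longrightarrow> homogeneous d (f + g)"
| uminus: "homogeneous d f \<Longrightarrow> homogeneous d (- f)"
| var: "homogeneous d f \<Longrightarrow> 1 \<le> j \<Longrightarrow> homogeneous (Suc d) (var j * f)"

lemma homogeneous_diff: "homogeneous d f \<Longrightarrow> homogeneous d g \<Longrightarrow> homogeneous d (f - g)"
  using homogeneous.add[OF _ homogeneous.uminus] by fastforce

lemma homogeneous_sum: "(\<And>x. x \<in> A \<Longrightarrow> homogeneous d (f x)) \<Longrightarrow> homogeneous d (sum f A)"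
  by (induction A rule: infinite_finite_induct) (auto intro: homogeneous.intros)

lemma homogeneous_mult: "homogeneous d f \<Longrightarrow> homogeneous e g \<Longrightarrow> homogeneous (d + e) (f * g)"
  by (induction rule: homogeneous.induct) (auto simp: distrib_right mult.assoc intro: homogeneous.intros)

lemma homogeneous_power: "1 \<le> j \<Longrightarrow> homogeneous d (var j ^ d)"
  by (induction d) (auto intro: homogeneous.intros)

lemma homogeneous_prod:
  "finite A \<Longrightarrow> (\<And>x. x \<in> A \<Longrightarrow> homogeneous (d x) (f x)) \<Longrightarrow> homogeneous (sum d A) (prod f A)"
  by (induction A rule: finite_induct) (auto intro: homogeneous.one homogeneous_mult)

text \<open>Subtraction is truncated at 0, so degree 0 needs its own clause: constants are sent to
  0. In the induction this clause serves x_j f with f constant.\<close>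

lemma homogeneous_divided_difference:
  assumes "homogeneous d f" "1 \<le> i"
  shows "(d = 0 \<longrightarrow> divided_difference i f = 0) \<and> homogeneous (d - 1) (divided_difference i f)"
  using assms(1)
proof (induction rule: homogeneous.induct)
  case (add d f g)
  then show ?case by (auto simp: divided_difference_add intro: homogeneous.intros)
next
  case (uminus d f)
  have "divided_difference i (- f) = - divided_difference i f"
    using divided_difference_diff[of i 0 f] by (simp add: divided_difference_eq_0)
  then show ?case using uminus by (auto intro: homogeneous.intros)
next
  case (var d f j)
  have "homogeneous d (swap_vars i (var j) * divided_difference i f)"
  proof (cases d)
    case (Suc e)
    have "1 \<le> transpose i (Suc i) j" using assms(2) var by (auto simp: transpose_def)
    then show ?thesis using var Suc by (auto simp: swap_vars_var intro: homogeneous.intros)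
  qed (use var in \<open>auto intro: homogeneous.intros\<close>)
  moreover have "homogeneous d (divided_difference i (var j) * f)"
    using var by (auto simp: divided_difference_var of_bool_def intro: homogeneous.intros)
  ultimately show ?case by (auto simp: divided_difference_mult intro: homogeneous.intros)
qed (auto simp: divided_difference_eq_0 intro: homogeneous.intros)

lemma homogeneous_keys:
  assumes "homogeneous d f" "m \<in> Poly_Mapping.keys f"
  shows "Poly_Mapping.lookup m 0 = 0 \<and> (0 < d \<longrightarrow> m \<noteq> 0)"
  using assms
proof (induction arbitrary: m rule: homogeneous.induct)
  case (add d f g)
  then show ?case using keys_add[of f g] by blast
next
  case (var d f j)
  obtain n where n: "n \<in> Poly_Mapping.keys f" "m = Poly_Mapping.single j 1 + n"
    using var.prems keys_mult[of "var j" f] by (auto simp: var_def)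
  have "Poly_Mapping.lookup m j \<noteq> 0" using n by (simp add: lookup_add)
  then have "m \<noteq> 0" by auto
  then show ?case using var.IH[OF n(1)] n(2) var.hyps(2) by (auto simp: lookup_add lookup_single)
qed auto

text \<open>
  A monomial of \<open>f\<close> that involves \<open>x\<^sub>p\<close> would bring with it, by invariance, monomials that
  involve \<open>x\<^sub>q\<close> for every \<open>q \<ge> p\<close>.
\<close>

lemma homogeneous_symmetric_eq_0:
  assumes "homogeneous d f" "0 < d" "\<And>i. 1 \<le> i \<Longrightarrow> divided_difference i f = 0"
  shows "f = 0"
proof (rule ccontr)
  assume "f \<noteq> 0"
  then obtain m where m: "m \<in> Poly_Mapping.keys f" by (metis ex_in_conv keys_eq_empty)
  then obtain p where p: "p \<in> Poly_Mapping.keys m"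
    using homogeneous_keys[OF assms(1) m] assms(2) by (metis ex_in_conv in_keys_iff lookup_zero poly_mapping_eqI)
  then have "1 \<le> p"
    using homogeneous_keys[OF assms(1) m] by (metis in_keys_iff less_one not_le)
  have "\<exists>m\<in>Poly_Mapping.keys f. q \<in> Poly_Mapping.keys m" if "p \<le> q" for q
    using that
  proof (induction q rule: dec_induct)
    case base
    then show ?case using m p by auto
  next
    case (step q)
    then obtain n where n: "n \<in> Poly_Mapping.keys f" "q \<in> Poly_Mapping.keys n" by auto
    let ?n = "Poly_Mapping.map_key (transpose q (Suc q)) n"
    have "swap_vars q f = f"
      using assms(3) step.hyps \<open>1 \<le> p\<close> by (intro divided_difference_eq_0D) auto
    then have "?n \<in> Poly_Mapping.keys f"
      using n(1) by (metis in_keys_iff lookup_swap_vars map_key_transpose_involutory)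
    moreover have "Suc q \<in> Poly_Mapping.keys ?n"
      using n(2) by (simp add: keys_map_key)
    ultimately show ?case by auto
  qed
  then have "{p..} \<subseteq> (\<Union>m\<in>Poly_Mapping.keys f. Poly_Mapping.keys m)" by auto
  moreover have "finite (\<Union>m\<in>Poly_Mapping.keys f. Poly_Mapping.keys m)" by auto
  ultimately show False using infinite_Ici finite_subset by blast
qed

section \<open>Length and Bruhat covers\<close>

lemma word_perm_simps [simp]:
  "word_perm [] = id" "word_perm (\<alpha> @ [i]) = word_perm \<alpha> \<circ> transpose i (Suc i)"
proof -
  have "foldr (\<lambda>p w. transpose p (Suc p) \<circ> w) \<alpha> v = word_perm \<alpha> \<circ> v" for v
    unfolding word_perm_def by (induction \<alpha>) (auto simp: comp_assoc)
  then show "word_perm (\<alpha> @ [i]) = word_perm \<alpha> \<circ> transpose i (Suc i)"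
    by (simp add: word_perm_def)
qed (simp add: word_perm_def)

lemma permutes_comp_transpose:
  "w permutes {1..n} \<Longrightarrow> 1 \<le> a \<Longrightarrow> a \<le> n \<Longrightarrow> 1 \<le> b \<Longrightarrow> b \<le> n \<Longrightarrow> w \<circ> transpose a b permutes {1..n}"
  by (intro permutes_compose permutes_swap_id) auto

lemma permutes_atLeastAtMost_mono: "w permutes {1..n} \<Longrightarrow> n \<le> m \<Longrightarrow> w permutes {1..m::nat}"
  by (erule permutes_subset) auto

lemma fin_perms_comp_transpose:
  assumes "w \<in> fin_perms" "1 \<le> a" "1 \<le> b"
  shows "w \<circ> transpose a b \<in> fin_perms"
proof -
  obtain n where n: "w permutes {1..n}" using assms by (auto simp: fin_perms_def)
  have "w permutes {1..max n (max a b)}"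
    by (rule permutes_atLeastAtMost_mono[OF n]) simp
  then have "w \<circ> transpose a b permutes {1..max n (max a b)}"
    by (rule permutes_comp_transpose) (use assms in simp_all)
  then show ?thesis by (auto simp: fin_perms_def)
qed

lemma fin_perms_id [simp]: "id \<in> fin_perms"
  by (auto simp: fin_perms_def intro!: permutes_id)

lemma fin_perms_inj: "w \<in> fin_perms \<Longrightarrow> inj w"
  by (auto simp: fin_perms_def dest: permutes_inj)

lemma fin_perms_0: "w \<in> fin_perms \<Longrightarrow> w 0 = 0"
  by (auto simp: fin_perms_def intro: permutes_not_in)

section \<open>Inversions and length\<close>

definition inversions :: "(nat \<Rightarrow> nat) \<Rightarrow> (nat \<times> nat) set" where
  "inversions w = {(i, j). i < j \<and> w j < w i}"

lemma inversions_id [simp]: "inversions id = {}" "inversions (\<lambda>x. x) = {}"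
  by (auto simp: inversions_def)

lemma inversions_subset:
  assumes "w permutes {1..n}"
  shows "inversions w \<subseteq> {1..n} \<times> {1..n}"
proof -
  have "1 \<le> i \<and> j \<le> n" if "i < j" "w j < w i" for i j
  proof -
    have out: "w x = x" if "x = 0 \<or> n < x" for x
      using assms that by (intro permutes_not_in[of w "{1..n}"]) auto
    have "w i \<le> n" if "i \<le> n"
      using permutes_in_image[OF assms, of i] out[of i] that by (cases "i = 0") auto
    then have "j \<le> n" using that out[of i] out[of j] by (metis le_trans less_imp_le_nat linorder_not_le)
    moreover have "i \<noteq> 0" using that(2) out[of i] by (intro notI) simp
    ultimately show ?thesis by simp
  qed
  then have "i \<in> {1..n}" "j \<in> {1..n}" if "i < j" "w j < w i" for i j
    using that by (meson atLeastAtMost_iff le_trans less_imp_le_nat)+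
  then show ?thesis unfolding inversions_def by blast
qed

lemma finite_inversions: "w \<in> fin_perms \<Longrightarrow> finite (inversions w)"
  unfolding fin_perms_def using finite_subset[OF inversions_subset] by blast

text \<open>Applying s_i to both positions keeps the order of every pair except (i, i+1), and that
  pair becomes a new inversion.\<close>

lemma card_inversions_ascent:
  assumes "w \<in> fin_perms" "w i < w (Suc i)"
  shows "card (inversions (w \<circ> transpose i (Suc i))) = Suc (card (inversions w))"
proof -
  let ?s = "transpose i (Suc i)"
  let ?g = "\<lambda>(x, y). (?s x, ?s y)"
  have s: "?s x < ?s y" if "x < y" "(x, y) \<noteq> (i, Suc i)" for x y
    using that by (auto simp: transpose_def)
  have "inversions (w \<circ> ?s) = insert (i, Suc i) (?g ` inversions w)"
  proof (intro set_eqI iffI)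
    fix p assume p: "p \<in> inversions (w \<circ> ?s)"
    then obtain x y where xy: "p = (x, y)" "x < y" "w (?s y) < w (?s x)" by (auto simp: inversions_def)
    show "p \<in> insert (i, Suc i) (?g ` inversions w)"
    proof (cases "p = (i, Suc i)")
      case False
      then have "(?s x, ?s y) \<in> inversions w" using xy s by (auto simp: inversions_def)
      moreover have "p = ?g (?s x, ?s y)" using xy by simp
      ultimately show ?thesis by blast
    qed simp
  next
    fix p assume "p \<in> insert (i, Suc i) (?g ` inversions w)"
    then show "p \<in> inversions (w \<circ> ?s)"
    proof
      assume "p \<in> ?g ` inversions w"
      then obtain x y where xy: "p = (?s x, ?s y)" "x < y" "w y < w x" by (auto simp: inversions_def)
      then have "?s x < ?s y" using assms(2) by (intro s) auto
      then show ?thesis using xy by (simp add: inversions_def)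
    qed (use assms(2) in \<open>simp add: inversions_def\<close>)
  qed
  moreover have "(i, Suc i) \<notin> ?g ` inversions w"
  proof
    assume "(i, Suc i) \<in> ?g ` inversions w"
    then obtain x y where "(x, y) \<in> inversions w" "?s x = i" "?s y = Suc i" by auto
    then have "(Suc i, i) \<in> inversions w" by (metis transpose_apply_first transpose_apply_second transpose_involutory)
    then show False by (simp add: inversions_def)
  qed
  moreover have "inj_on ?g (inversions w)" by (rule inj_onI) (auto dest: transpose_eq_imp_eq)
  ultimately show ?thesis
    using finite_inversions[OF assms(1)] by (simp add: card_image)
qed

lemma card_inversions_descent:
  assumes "w \<in> fin_perms" "1 \<le> i" "w (Suc i) < w i"
  shows "card (inversions w) = Suc (card (inversions (w \<circ> transpose i (Suc i))))"
  using card_inversions_ascent[of "w \<circ> transpose i (Suc i)" i] fin_perms_comp_transpose[of w i "Suc i"] assms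
  by (simp add: comp_assoc)

lemma fin_perms_neq: "w \<in> fin_perms \<Longrightarrow> i \<noteq> j \<Longrightarrow> w i \<noteq> w j"
  using fin_perms_inj by (auto dest: injD)

text \<open>Such a permutation and its inverse are strictly increasing maps of the natural numbers,
  and a strictly increasing map never lies below the identity.\<close>

lemma no_descent_id:
  assumes "w \<in> fin_perms" "\<And>i. 1 \<le> i \<Longrightarrow> w i < w (Suc i)"
  shows "w = id"
proof -
  have bij: "bij w" using assms(1) by (auto simp: fin_perms_def dest: permutes_bij)
  \<comment> \<open>At i = 0 the inequality comes from w 0 = 0 and injectivity.\<close>
  have "w i < w (Suc i)" for i
    using assms(2)[of i] fin_perms_0[OF assms(1)] fin_perms_neq[OF assms(1), of 0 "Suc 0"]
    by (cases "i = 0") auto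
  then have mono: "strict_mono w" by (simp add: strict_mono_Suc_iff)
  have mono': "strict_mono (inv w)"
  proof (rule strict_monoI)
    fix x y :: nat assume "x < y"
    then show "inv w x < inv w y"
      using mono bij by (metis bij_inv_eq_iff linorder_not_le not_less_iff_gr_or_eq strict_mono_less)
  qed
  show ?thesis
  proof
    fix x
    have "x \<le> w x" by (rule strict_mono_imp_increasing[OF mono])
    moreover have "w x \<le> inv w (w x)" by (rule strict_mono_imp_increasing[OF mono'])
    ultimately show "w x = id x" using bij by (simp add: bij_is_inj)
  qed
qed

lemma fin_perms_descent_cases:
  assumes "w \<in> fin_perms"
  obtains "w = id" | i where "1 \<le> i" "w (Suc i) < w i"
  using no_descent_id[OF assms] fin_perms_neq[OF assms] by (metis linorder_neqE_nat n_not_Suc_n)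

lemma word_perm_fin_perms: "\<forall>p\<in>set \<alpha>. 1 \<le> p \<Longrightarrow> word_perm \<alpha> \<in> fin_perms"
  by (induction \<alpha> rule: rev_induct) (auto intro!: fin_perms_comp_transpose)

lemma card_inversions_word_perm:
  "\<forall>p\<in>set \<alpha>. 1 \<le> p \<Longrightarrow> card (inversions (word_perm \<alpha>)) \<le> length \<alpha>"
proof (induction \<alpha> rule: rev_induct)
  case Nil
  then show ?case by simp
next
  case (snoc p \<alpha>)
  then have w: "word_perm \<alpha> \<in> fin_perms" and p: "1 \<le> p"
    and IH: "card (inversions (word_perm \<alpha>)) \<le> length \<alpha>" by (auto intro: word_perm_fin_perms)
  have l: "length (\<alpha> @ [p]) = Suc (length \<alpha>)" by simp
  show ?case
  proof (cases "word_perm \<alpha> p < word_perm \<alpha> (Suc p)")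
    case True
    then show ?thesis using IH card_inversions_ascent[OF w True] unfolding word_perm_simps l by linarith
  next
    case False
    then have "word_perm \<alpha> (Suc p) < word_perm \<alpha> p"
      using fin_perms_neq[OF w, of p "Suc p"] by simp
    then show ?thesis using IH card_inversions_descent[OF w p] unfolding word_perm_simps l by linarith
  qed
qed

lemma exists_word:
  "w \<in> fin_perms \<Longrightarrow> \<exists>\<alpha>. (\<forall>p\<in>set \<alpha>. 1 \<le> p) \<and> length \<alpha> = card (inversions w) \<and> word_perm \<alpha> = w"
proof (induction "card (inversions w)" arbitrary: w rule: less_induct)
  case less
  show ?case
  proof (rule fin_perms_descent_cases[OF less.prems])
    fix i assume i: "1 \<le> i" "w (Suc i) < w i"
    let ?v = "w \<circ> transpose i (Suc i)"
    have v: "?v \<in> fin_perms" using i less.prems by (intro fin_perms_comp_transpose) auto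
    have c: "card (inversions w) = Suc (card (inversions ?v))"
      using i less.prems by (intro card_inversions_descent)
    then obtain \<alpha> where a: "\<forall>p\<in>set \<alpha>. 1 \<le> p" "length \<alpha> = card (inversions ?v)" "word_perm \<alpha> = ?v"
      using less.hyps[OF _ v] by auto
    show ?thesis
      using i a c by (intro exI[of _ "\<alpha> @ [i]"]) (auto simp: comp_assoc)
  qed (auto intro!: exI[of _ "[]"])
qed

text \<open>Each letter changes the number of inversions by one, which bounds words from below;
  removing descents yields a word attaining the bound.\<close>

lemma coxeter_length_eq: "w \<in> fin_perms \<Longrightarrow> coxeter_length w = card (inversions w)"
  unfolding coxeter_length_def
  by (rule Least_equality) (use exists_word card_inversions_word_perm in fastforce)+

definition between :: "(nat \<Rightarrow> nat) \<Rightarrow> nat \<Rightarrow> nat \<Rightarrow> nat set" where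
  "between w a b = {c. a < c \<and> c < b \<and> w a < w c \<and> w c < w b}"

text \<open>Induction through t_(a,b) = s_a t_(a+1,b) s_a. The two outer steps add 2 if w (a+1) lies
  between w a and w b, and cancel otherwise, which is the contribution of position a+1 to
  \<open>between\<close>.\<close>

lemma card_inversions_transpose:
  assumes "w \<in> fin_perms" "1 \<le> a" "a < b" "w a < w b"
  shows "card (inversions (w \<circ> transpose a b)) = card (inversions w) + 1 + 2 * card (between w a b)"
  using assms
proof (induction "b - a" arbitrary: a w rule: less_induct)
  case less
  show ?case
  proof (cases "b = Suc a")
    case True
    then have "between w a b = {}" by (auto simp: between_def)
    then show ?thesis using True less.prems card_inversions_ascent[of w a] by simp
  next
    case False
    let ?s = "transpose a (Suc a)"
    let ?x = "w a" and ?y = "w (Suc a)" and ?z = "w b"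
    let ?w = "w \<circ> ?s" and ?u = "w \<circ> ?s \<circ> transpose (Suc a) b"
    have ab: "Suc a < b" using False less.prems by simp
    have fw: "?w \<in> fin_perms" and fu: "?u \<in> fin_perms"
      using less.prems by (auto intro!: fin_perms_comp_transpose)
    have w: "?w a = ?y" "?w (Suc a) = ?x" "?w b = ?z"
      using ab by (auto simp: transpose_def)
    have u: "?u a = ?y" "?u (Suc a) = ?z" using ab by (auto simp: transpose_def)
    have conj: "?u \<circ> ?s = w \<circ> transpose a b"
      using ab by (auto simp: fun_eq_iff transpose_def)
    have IH: "card (inversions ?u) = card (inversions ?w) + 1 + 2 * card (between ?w (Suc a) b)"
      using less.prems ab fw w by (intro less.hyps) auto
    have bt: "between w a b = (if ?x < ?y \<and> ?y < ?z then insert (Suc a) (between ?w (Suc a) b) else between ?w (Suc a) b)"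
    proof (intro set_eqI)
      fix c
      show "c \<in> between w a b \<longleftrightarrow> c \<in> (if ?x < ?y \<and> ?y < ?z then insert (Suc a) (between ?w (Suc a) b) else between ?w (Suc a) b)"
      proof (cases "c = Suc a")
        case True
        then show ?thesis using ab by (auto simp: between_def)
      next
        case False
        then have "c \<in> between w a b \<longleftrightarrow> c \<in> between ?w (Suc a) b"
          using ab by (auto simp: between_def transpose_def)
        then show ?thesis using False by simp
      qed
    qed
    have fin: "finite (between ?w (Suc a) b)" and notin: "Suc a \<notin> between ?w (Suc a) b"
      by (auto simp: between_def intro: finite_subset[of _ "{..b}"])
    have "?x \<noteq> ?y" "?y \<noteq> ?z" using fin_perms_neq[OF less.prems(1)] ab by auto
    then consider "?x < ?y" "?y < ?z" | "?x < ?y" "?z < ?y" | "?y < ?x" "?y < ?z"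
      using less.prems(4) by linarith
    then show ?thesis
    proof cases
      case 1
      then show ?thesis
        using IH bt fin notin card_inversions_ascent[OF less.prems(1), of a] card_inversions_ascent[OF fu, of a] u conj
        by simp
    next
      case 2
      then show ?thesis
        using IH bt fin notin card_inversions_ascent[OF less.prems(1), of a] card_inversions_descent[OF fu, of a] u conj less.prems(2)
        by simp
    next
      case 3
      then show ?thesis
        using IH bt fin notin card_inversions_descent[OF less.prems(1), of a] card_inversions_ascent[OF fu, of a] u conj less.prems(2)
        by simp
    qed
  qed
qed

definition bruhat_cover :: "(nat \<Rightarrow> nat) \<Rightarrow> nat \<Rightarrow> nat \<Rightarrow> bool" where
  "bruhat_cover w a b \<longleftrightarrow> w a < w b \<and> (\<forall>c. a < c \<and> c < b \<longrightarrow> \<not> (w a < w c \<and> w c < w b))"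

lemma bruhat_cover_iff:
  assumes "w \<in> fin_perms" "1 \<le> a" "a < b"
  shows "coxeter_length (w \<circ> transpose a b) = coxeter_length w + 1 \<longleftrightarrow> bruhat_cover w a b"
proof -
  have f: "w \<circ> transpose a b \<in> fin_perms" using assms by (intro fin_perms_comp_transpose) auto
  have fin: "finite (between w a b)" by (auto simp: between_def intro: finite_subset[of _ "{..b}"])
  show ?thesis
  proof (cases "w a < w b")
    case True
    then show ?thesis
      using card_inversions_transpose[OF assms True] fin
      by (auto simp: coxeter_length_eq assms(1) f bruhat_cover_def between_def)
  next
    case False
    then have "w b < w a" using fin_perms_neq[OF assms(1), of a b] assms(3) by simp
    then have "card (inversions w) > card (inversions (w \<circ> transpose a b))"
      using card_inversions_transpose[OF f assms(2,3)] by (simp add: comp_assoc)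
    then show ?thesis using False by (simp add: coxeter_length_eq assms(1) f bruhat_cover_def)
  qed
qed

section \<open>Well-definedness of Schubert polynomials\<close>

text \<open>
  The Schubert polynomials that arise by descending from the longest element inside a fixed \<open>S\<^sub>n\<close>.
\<close>

inductive schubert_in :: "nat \<Rightarrow> (nat \<Rightarrow> nat) \<Rightarrow> ipoly \<Rightarrow> bool" for n where
  longest: "schubert_in n (longest_perm n) (\<Prod>i=1..n. var i ^ (n - i))"
| descent: "schubert_in n w f \<Longrightarrow> 1 \<le> i \<Longrightarrow> i < n \<Longrightarrow> w (Suc i) < w i \<Longrightarrow>
    schubert_in n (w \<circ> transpose i (Suc i)) (divided_difference i f)"

lemma longest_perm_permutes: "longest_perm n permutes {1..n}"
proof (rule bij_imp_permutes)
  show "bij_betw (longest_perm n) {1..n} {1..n}"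
    by (rule bij_betw_byWitness[where f' = "longest_perm n"]) (auto simp: longest_perm_def)
qed (simp only: longest_perm_def if_False)

lemma schubert_in_permutes: "schubert_in n w f \<Longrightarrow> w permutes {1..n}"
proof (induction rule: schubert_in.induct)
  case (descent w f i)
  then show ?case by (intro permutes_comp_transpose) auto
qed (rule longest_perm_permutes)

lemma permutes_fin_perms: "w permutes {1..n} \<Longrightarrow> w \<in> fin_perms"
  by (auto simp: fin_perms_def)

lemma card_inversions_le:
  assumes "w permutes {1..n}"
  shows "card (inversions w) \<le> n * n"
  using card_mono[OF _ inversions_subset[OF assms]] by simp

text \<open>Without ascents inside {1..n}, composing with the order-reversing longest element on the
  values leaves no descent, hence gives the identity.\<close>

lemma ascent_cases:
  assumes "w permutes {1..n}"
  obtains "w = longest_perm n" | i where "1 \<le> i" "i < n" "w i < w (Suc i)"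
proof (cases "\<exists>i. 1 \<le> i \<and> i < n \<and> w i < w (Suc i)")
  case False
  have w: "w \<in> fin_perms" using assms by (rule permutes_fin_perms)
  have in_range: "w i \<in> {1..n}" if "i \<in> {1..n}" for i
    using that assms by (simp only: permutes_in_image)
  have out: "w i = i" if "i \<notin> {1..n}" for i using assms that by (rule permutes_not_in)
  let ?v = "longest_perm n \<circ> w"
  have "?v = id"
  proof (rule no_descent_id)
    show "?v \<in> fin_perms"
      by (rule permutes_fin_perms[OF permutes_compose[OF assms longest_perm_permutes]])
    fix i :: nat assume i: "1 \<le> i"
    consider "i < n" | "i = n" | "n < i" by linarith
    then show "?v i < ?v (Suc i)"
    proof cases
      case 1
      have "w (Suc i) < w i" using False i 1 fin_perms_neq[OF w, of i "Suc i"] by auto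
      moreover have "w i \<in> {1..n}" "w (Suc i) \<in> {1..n}" using i 1 by (intro in_range; simp)+
      ultimately show ?thesis by (auto simp: longest_perm_def)
    next
      case 2
      have "w i \<in> {1..n}" "w (Suc i) = Suc i" using i 2 in_range[of i] out[of "Suc i"] by auto
      then show ?thesis using 2 by (auto simp: longest_perm_def)
    next
      case 3
      then show ?thesis using out[of i] out[of "Suc i"] by (auto simp: longest_perm_def)
    qed
  qed
  then have "longest_perm n (longest_perm n (w x)) = longest_perm n x" for x
    by (simp add: fun_eq_iff)
  moreover have "longest_perm n (longest_perm n x) = x" for x by (auto simp: longest_perm_def)
  ultimately have "w = longest_perm n" by (simp add: fun_eq_iff)
  then show thesis by (rule that(1))
qed (use that(2) in blast)

text \<open>Climb from w through ascents up to the longest element. The crude bound n * n on the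
  number of inversions makes the climb end.\<close>

lemma schubert_in_exists: "w permutes {1..n} \<Longrightarrow> \<exists>f. schubert_in n w f"
proof (induction "n * n - card (inversions w)" arbitrary: w rule: less_induct)
  case less
  show ?case
  proof (rule ascent_cases[OF less.prems])
    assume "w = longest_perm n"
    then show ?thesis using schubert_in.longest by blast
  next
    fix i assume i: "1 \<le> i" "i < n" "w i < w (Suc i)"
    let ?v = "w \<circ> transpose i (Suc i)"
    have v: "?v permutes {1..n}" using less.prems i by (intro permutes_comp_transpose) auto
    have "card (inversions ?v) = Suc (card (inversions w))"
      using less.prems i by (intro card_inversions_ascent) (auto intro: permutes_fin_perms)
    then have "n * n - card (inversions ?v) < n * n - card (inversions w)"
      using card_inversions_le[OF v] by (intro diff_less_mono2) auto
    then obtain f where "schubert_in n ?v f"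
      using less.hyps[OF _ v] by blast
    then have "schubert_in n (?v \<circ> transpose i (Suc i)) (divided_difference i f)"
      using i by (intro schubert_in.descent) auto
    then show ?thesis by (auto simp: comp_assoc)
  qed
qed

lemma schubert_in_cases:
  assumes "schubert_in n w f"
  obtains "w = longest_perm n" "f = (\<Prod>i=1..n. var i ^ (n - i))"
  | i g where "1 \<le> i" "i < n" "w i < w (Suc i)" "schubert_in n (w \<circ> transpose i (Suc i)) g" "f = divided_difference i g"
  using assms
proof (cases rule: schubert_in.cases)
  case (descent v g i)
  then have "w \<circ> transpose i (Suc i) = v" by (simp add: comp_assoc)
  then show thesis using descent that(2)[of i g] by auto
qed (use that(1) in blast)

lemma transpose_commute_far:
  "Suc i < j \<Longrightarrow> transpose i (Suc i) \<circ> transpose j (Suc j) = transpose j (Suc j) \<circ> transpose i (Suc i)"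
  by (auto simp: fun_eq_iff transpose_def)

lemma transpose_braid:
  "transpose i (Suc i) \<circ> transpose (Suc i) (Suc (Suc i)) \<circ> transpose i (Suc i)
    = transpose (Suc i) (Suc (Suc i)) \<circ> transpose i (Suc i) \<circ> transpose (Suc i) (Suc (Suc i))"
  by (auto simp: fun_eq_iff transpose_def)

text \<open>Local confluence. Two ascents i < j of w lead up to a common permutation, w s_i s_j or,
  if they are adjacent, w s_i s_j s_i. By uniqueness for longer permutations f and g are obtained
  from its polynomial h, and the commutation or braid relation makes the two descents to w
  agree.\<close>

lemma schubert_in_confluent:
  assumes w: "w permutes {1..n}" and ij: "1 \<le> i" "i < j" "j < n" "w i < w (Suc i)" "w j < w (Suc j)"
    and IH: "\<And>v f g. v permutes {1..n} \<Longrightarrow> card (inversions w) < card (inversions v) \<Longrightarrow>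
      schubert_in n v f \<Longrightarrow> schubert_in n v g \<Longrightarrow> f = g"
    and f: "schubert_in n (w \<circ> transpose i (Suc i)) f"
    and g: "schubert_in n (w \<circ> transpose j (Suc j)) g"
  shows "divided_difference i f = divided_difference j g"
proof -
  let ?s = "transpose i (Suc i)" and ?r = "transpose j (Suc j)"
  have p: "w \<circ> ?s permutes {1..n}" "w \<circ> ?r permutes {1..n}"
    by (rule permutes_comp_transpose[OF w]; use ij in simp)+
  have c: "card (inversions w) < card (inversions (w \<circ> ?s))" "card (inversions w) < card (inversions (w \<circ> ?r))"
    using card_inversions_ascent[OF permutes_fin_perms[OF w]] ij by simp_all
  show ?thesis
  proof (cases "Suc i = j")
    case False
    then have far: "Suc i < j" using ij by simp
    have top: "w \<circ> ?s \<circ> ?r permutes {1..n}"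
      by (rule permutes_comp_transpose[OF p(1)]; use ij in simp)
    then obtain h where h: "schubert_in n (w \<circ> ?s \<circ> ?r) h" using schubert_in_exists by blast
    have "schubert_in n (w \<circ> ?s \<circ> ?r \<circ> ?r) (divided_difference j h)"
      using ij far by (intro schubert_in.descent h) (auto simp: transpose_def)
    then have "f = divided_difference j h"
      using IH[OF p(1) c(1) f] by (simp add: comp_assoc)
    moreover have "schubert_in n (w \<circ> ?s \<circ> ?r \<circ> ?s) (divided_difference i h)"
      using ij far by (intro schubert_in.descent h) (auto simp: transpose_def)
    then have "g = divided_difference i h"
      using IH[OF p(2) c(2) g] far
      by (simp add: comp_assoc transpose_commute_far[symmetric]) (simp add: comp_assoc[symmetric])
    ultimately show ?thesis using divided_difference_commute[OF far] by simp
  next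
    case True
    have "w \<circ> ?s \<circ> ?r permutes {1..n}"
      by (rule permutes_comp_transpose[OF p(1)]; use ij in simp)
    then have top: "w \<circ> ?s \<circ> ?r \<circ> ?s permutes {1..n}"
      by (rule permutes_comp_transpose; use ij in simp)
    then obtain h where h: "schubert_in n (w \<circ> ?s \<circ> ?r \<circ> ?s) h" using schubert_in_exists by blast
    have "schubert_in n (w \<circ> ?s \<circ> ?r \<circ> ?s \<circ> ?s \<circ> ?r) (divided_difference j (divided_difference i h))"
      using ij True by (intro schubert_in.descent h) (auto simp: transpose_def)
    then have "f = divided_difference j (divided_difference i h)"
      using IH[OF p(1) c(1) f] by (simp add: comp_assoc)
    moreover have eq: "w \<circ> ?s \<circ> ?r \<circ> ?s = w \<circ> ?r \<circ> ?s \<circ> ?r"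
      using transpose_braid[of i] True by (simp add: comp_assoc)
    have "schubert_in n (w \<circ> ?r \<circ> ?s \<circ> ?r \<circ> ?r \<circ> ?s) (divided_difference i (divided_difference j h))"
      using ij True h unfolding eq by (intro schubert_in.descent) (auto simp: transpose_def)
    then have "g = divided_difference i (divided_difference j h)"
      using IH[OF p(2) c(2) g] by (simp add: comp_assoc)
    ultimately show ?thesis using divided_difference_braid[of i h] True by simp
  qed
qed

lemma schubert_in_unique:
  "schubert_in n w f \<Longrightarrow> schubert_in n w g \<Longrightarrow> f = g"
proof (induction "n * n - card (inversions w)" arbitrary: w f g rule: less_induct)
  case less
  have w: "w permutes {1..n}" using less.prems(1) by (rule schubert_in_permutes)
  have IH: "f = g" if "v permutes {1..n}" "card (inversions w) < card (inversions v)"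
    "schubert_in n v f" "schubert_in n v g" for v f g
    using that card_inversions_le[OF that(1)] by (intro less.hyps[of v]) auto
  have no_ascent: "\<not> longest_perm n i < longest_perm n (Suc i)" if "1 \<le> i" "i < n" for i
    using that by (auto simp: longest_perm_def)
  from less.prems(1) show ?case
  proof (cases rule: schubert_in_cases)
    case 1
    from less.prems(2) show ?thesis
      by (cases rule: schubert_in_cases) (use 1 no_ascent in auto)
  next
    case i: (2 i f')
    from less.prems(2) show ?thesis
    proof (cases rule: schubert_in_cases)
      case 1
      then show ?thesis using i no_ascent by auto
    next
      case j: (2 j g')
      consider "i = j" | "i < j" | "j < i" by linarith
      then show ?thesis
      proof cases
        case 1
        have "w \<circ> transpose i (Suc i) permutes {1..n}"
          using schubert_in_permutes i by blast
        moreover have "card (inversions w) < card (inversions (w \<circ> transpose i (Suc i)))"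
          using card_inversions_ascent[OF permutes_fin_perms[OF w]] i by simp
        ultimately show ?thesis using IH i j 1 by blast
      next
        case 2
        then show ?thesis
          using schubert_in_confluent[OF w i(1) 2 j(2) i(3) j(3) IH i(4) j(4)] i j by simp
      next
        case 3
        then show ?thesis
          using schubert_in_confluent[OF w j(1) 3 i(2) j(3) i(3) IH j(4) i(4)] i j by simp
      qed
    qed
  qed
qed

section \<open>Stability in passing from S_n to S_(n+1)\<close>

lemma swap_vars_prod_exponents:
  assumes "finite A" "transpose k (Suc k) ` A = A" "e k = e (Suc k)"
  shows "swap_vars k (\<Prod>i\<in>A. var i ^ e i) = (\<Prod>i\<in>A. var i ^ e i)"
proof -
  have pow: "swap_vars k (f ^ m) = swap_vars k f ^ m" for f m
    by (induction m) (auto simp: swap_vars_mult)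
  have "swap_vars k (\<Prod>i\<in>A. f i) = (\<Prod>i\<in>A. swap_vars k (f i))" for f :: "nat \<Rightarrow> ipoly"
    using assms(1) by (induction rule: finite_induct) (auto simp: swap_vars_mult)
  then have "swap_vars k (\<Prod>i\<in>A. var i ^ e i) = (\<Prod>i\<in>A. var (transpose k (Suc k) i) ^ e i)"
    by (simp add: pow swap_vars_var)
  also have "\<dots> = (\<Prod>i\<in>A. var i ^ e i)"
    using assms
    by (intro prod.reindex_bij_witness[where i = "transpose k (Suc k)" and j = "transpose k (Suc k)"])
      (auto simp: transpose_def split: if_splits)
  finally show ?thesis .
qed

text \<open>Descend from the longest element of S_(n+1) by s_1, ..., s_n. After k steps the value n
  + 1 has moved to position k + 1 and the exponents of x_1, ..., x_k have dropped by one; k = n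
  gives the longest element of S_n.\<close>

lemma schubert_in_Suc_longest:
  "k \<le> n \<Longrightarrow> schubert_in (Suc n)
     (\<lambda>x. if x = Suc k then Suc n else if Suc k < x \<and> x \<le> Suc n then n + 2 - x else longest_perm n x)
     (\<Prod>i=1..Suc n. var i ^ (if i \<le> k then n - i else Suc n - i))"
proof (induction k)
  case 0
  have "(\<lambda>x. if x = Suc 0 then Suc n else if Suc 0 < x \<and> x \<le> Suc n then n + 2 - x else longest_perm n x) = longest_perm (Suc n)"
    by (auto simp: fun_eq_iff longest_perm_def)
  moreover have "(\<Prod>i=1..Suc n. var i ^ (if i \<le> 0 then n - i else Suc n - i)) = (\<Prod>i=1..Suc n. var i ^ (Suc n - i))"
    by (intro prod.cong) auto
  ultimately show ?case using schubert_in.longest[of "Suc n"] by (simp only:)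
next
  case (Suc k)
  let ?v = "\<lambda>k x. if x = Suc k then Suc n else if Suc k < x \<and> x \<le> Suc n then n + 2 - x else longest_perm n x"
  let ?e = "\<lambda>k i. if i \<le> k then n - i else Suc n - i"
  let ?p = "\<lambda>k. \<Prod>i=1..Suc n. var i ^ ?e k i"
  let ?q = "?p (Suc k)"
  have "?v k \<circ> transpose (Suc k) (Suc (Suc k)) = ?v (Suc k)"
    using Suc.prems by (auto simp: fun_eq_iff transpose_def longest_perm_def)
  \<comment> \<open>In \<open>?q\<close> the exponents of x_(k+1) and x_(k+2) agree, so it is a
    constant for the divided difference, which only removes the factor x_(k+1).\<close>
  moreover have "?p k = var (Suc k) * ?q"
  proof -
    have "?p k = var (Suc k) ^ ?e k (Suc k) * (\<Prod>i\<in>{1..Suc n} - {Suc k}. var i ^ ?e k i)"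
      using Suc.prems by (intro prod.remove) auto
    also have "(\<Prod>i\<in>{1..Suc n} - {Suc k}. var i ^ ?e k i) = (\<Prod>i\<in>{1..Suc n} - {Suc k}. var i ^ ?e (Suc k) i)"
      by (intro prod.cong) auto
    also have "var (Suc k) ^ ?e k (Suc k) = var (Suc k) * var (Suc k) ^ ?e (Suc k) (Suc k)"
    proof -
      have "n - k = Suc (n - Suc k)" using Suc.prems by simp
      then show ?thesis by simp
    qed
    also have "var (Suc k) * var (Suc k) ^ ?e (Suc k) (Suc k) * (\<Prod>i\<in>{1..Suc n} - {Suc k}. var i ^ ?e (Suc k) i)
      = var (Suc k) * ?q"
      unfolding mult.assoc using Suc.prems by (intro arg_cong[of _ _ "(*) _"] prod.remove[symmetric]) auto
    finally show ?thesis .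
  qed
  moreover have "swap_vars (Suc k) ?q = ?q"
    using Suc.prems
    by (intro swap_vars_prod_exponents) (auto simp: image_iff transpose_def Suc_le_eq intro: exI split: if_splits)
  ultimately have "divided_difference (Suc k) (?p k) = ?q"
    by (simp only: divided_difference_mult divided_difference_var divided_difference_eq_0) simp
  moreover have "schubert_in (Suc n) (?v k \<circ> transpose (Suc k) (Suc (Suc k))) (divided_difference (Suc k) (?p k))"
    using Suc by (intro schubert_in.descent) auto
  ultimately show ?case
    using \<open>?v k \<circ> transpose (Suc k) (Suc (Suc k)) = ?v (Suc k)\<close> by (simp only:)
qed

lemma schubert_in_Suc: "schubert_in n w f \<Longrightarrow> schubert_in (Suc n) w f"
proof (induction rule: schubert_in.induct)
  case longest
  have "(\<lambda>x. if x = Suc n then Suc n else if Suc n < x \<and> x \<le> Suc n then n + 2 - x else longest_perm n x) = longest_perm n"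
    by (auto simp: fun_eq_iff longest_perm_def)
  moreover have "(\<Prod>i=1..Suc n. var i ^ (if i \<le> n then n - i else Suc n - i)) = (\<Prod>i=1..n. var i ^ (n - i))"
    by (auto intro!: prod.cong)
  ultimately show ?case using schubert_in_Suc_longest[of n n] by (simp only: le_refl simp_thms)
next
  case (descent w f i)
  show ?case by (rule schubert_in.descent) (use descent in auto)
qed

lemma schubert_in_mono: "n \<le> m \<Longrightarrow> schubert_in n w f \<Longrightarrow> schubert_in m w f"
  by (induction rule: dec_induct) (auto intro: schubert_in_Suc)

lemma is_schubert_schubert_in: "is_schubert w f \<Longrightarrow> \<exists>n. schubert_in n w f"
proof (induction rule: is_schubert.induct)
  case (longest n)
  then show ?case using schubert_in.longest by blast
next
  case (descent w f i)
  then obtain n where n: "schubert_in n w f" by auto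
  then have w: "w \<in> fin_perms" by (intro permutes_fin_perms schubert_in_permutes)
  have v: "w \<circ> transpose i (Suc i) \<in> fin_perms"
    using w descent.hyps by (intro fin_perms_comp_transpose) auto
  have "w (Suc i) < w i"
  proof (rule ccontr)
    assume "\<not> w (Suc i) < w i"
    then have "w i < w (Suc i)" using fin_perms_neq[OF w, of i "Suc i"] by simp
    then show False
      using card_inversions_ascent[OF w, of i] descent.hyps by (simp add: coxeter_length_eq w v)
  qed
  moreover have "schubert_in (max n (Suc i)) w f" by (rule schubert_in_mono[OF _ n]) simp
  ultimately have "schubert_in (max n (Suc i)) (w \<circ> transpose i (Suc i)) (divided_difference i f)"
    using descent.hyps(2) by (intro schubert_in.descent) auto
  then show ?case by blast
qed

lemma schubert_in_is_schubert: "schubert_in n w f \<Longrightarrow> is_schubert w f"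
proof (induction rule: schubert_in.induct)
  case (descent w f i)
  then have w: "w \<in> fin_perms" by (intro permutes_fin_perms schubert_in_permutes)
  have v: "w \<circ> transpose i (Suc i) \<in> fin_perms"
    using w descent.hyps by (intro fin_perms_comp_transpose) auto
  show ?case
    using descent card_inversions_descent[OF w, of i]
    by (intro is_schubert.descent) (auto simp: coxeter_length_eq w v)
qed (rule is_schubert.longest)

section \<open>The Schubert polynomial of a permutation\<close>

lemma schubert_eqI: "is_schubert w f \<Longrightarrow> schubert w = f"
  unfolding schubert_def
proof (rule the_equality)
  fix g assume "is_schubert w f" "is_schubert w g"
  then obtain n m where "schubert_in n w f" "schubert_in m w g"
    using is_schubert_schubert_in by meson
  then have "schubert_in (max n m) w f" "schubert_in (max n m) w g"
    by (auto intro: schubert_in_mono[rotated])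
  then show "g = f" by (rule schubert_in_unique[rotated])
qed

lemma is_schubert_schubert:
  assumes "w \<in> fin_perms"
  shows "is_schubert w (schubert w)"
proof -
  obtain f where "is_schubert w f"
    using assms schubert_in_exists schubert_in_is_schubert by (fastforce simp: fin_perms_def)
  then show ?thesis using schubert_eqI by simp
qed

lemma schubert_id [simp]: "schubert id = 1"
proof -
  have "longest_perm 0 = id" by (auto simp: longest_perm_def)
  then show ?thesis using is_schubert.longest[of 0] by (intro schubert_eqI) simp
qed

text \<open>At an ascent the Schubert polynomial is itself a value of the divided difference, whose
  square is 0.\<close>

lemma divided_difference_schubert:
  assumes "w \<in> fin_perms" "1 \<le> i"
  shows "divided_difference i (schubert w)
    = (if w (Suc i) < w i then schubert (w \<circ> transpose i (Suc i)) else 0)"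
proof -
  have v: "w \<circ> transpose i (Suc i) \<in> fin_perms"
    using assms by (intro fin_perms_comp_transpose) auto
  have step: "divided_difference i (schubert w) = schubert (w \<circ> transpose i (Suc i))"
    if "w \<in> fin_perms" "w \<circ> transpose i (Suc i) \<in> fin_perms" "w (Suc i) < w i" for w
    using is_schubert.descent[OF is_schubert_schubert assms(2), of w] card_inversions_descent[of w i] that assms(2)
    by (intro schubert_eqI[symmetric]) (simp add: coxeter_length_eq)
  show ?thesis
  proof (cases "w (Suc i) < w i")
    case True
    then show ?thesis using step assms v by simp
  next
    case False
    then have "w i < w (Suc i)" using fin_perms_neq[OF assms(1), of i "Suc i"] by simp
    then have "schubert w = divided_difference i (schubert (w \<circ> transpose i (Suc i)))"
      using step[OF v] assms by (simp add: comp_assoc)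
    then show ?thesis using False by simp
  qed
qed

lemma card_inversions_longest: "card (inversions (longest_perm n)) = (\<Sum>i=1..n. n - i)"
proof -
  have "inversions (longest_perm n) = Sigma {1..n} (\<lambda>i. {i<..n})"
  proof
    show "inversions (longest_perm n) \<subseteq> Sigma {1..n} (\<lambda>i. {i<..n})"
      using inversions_subset[OF longest_perm_permutes, of n] unfolding inversions_def by auto
    show "Sigma {1..n} (\<lambda>i. {i<..n}) \<subseteq> inversions (longest_perm n)"
      unfolding inversions_def longest_perm_def by auto
  qed
  then show ?thesis by simp
qed

lemma homogeneous_is_schubert: "is_schubert w f \<Longrightarrow> w \<in> fin_perms \<and> homogeneous (card (inversions w)) f"
proof (induction rule: is_schubert.induct)
  case (longest n)
  have "homogeneous (\<Sum>i=1..n. n - i) (\<Prod>i=1..n. var i ^ (n - i))"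
    by (intro homogeneous_prod homogeneous_power) auto
  then show ?case by (simp add: card_inversions_longest permutes_fin_perms[OF longest_perm_permutes])
next
  case (descent w f i)
  then have v: "w \<circ> transpose i (Suc i) \<in> fin_perms" by (intro fin_perms_comp_transpose) auto
  then have "card (inversions w) - 1 = card (inversions (w \<circ> transpose i (Suc i)))"
    using descent by (simp add: coxeter_length_eq)
  then have "homogeneous (card (inversions (w \<circ> transpose i (Suc i)))) (divided_difference i f)"
    using homogeneous_divided_difference[of "card (inversions w)" f i] descent by metis
  with v show ?case by (rule conjI)
qed

lemma homogeneous_schubert: "w \<in> fin_perms \<Longrightarrow> homogeneous (card (inversions w)) (schubert w)"
  using homogeneous_is_schubert is_schubert_schubert by blast

section \<open>Bruhat operators\<close>

text \<open>Composition of arbitrary operators is distributive on one side only; additivity supplies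
  the other side, so that the operators form a ring as \<open>fk_algebra\<close> demands.\<close>

typedef (overloaded) ('a, 'b::ring_1) fun_endo =
  "{F :: ('a \<Rightarrow> 'b) \<Rightarrow> 'a \<Rightarrow> 'b. \<forall>f g. F (\<lambda>x. f x + g x) = (\<lambda>x. F f x + F g x)}"
  morphisms endo_apply Abs_fun_endo
  by (rule exI[of _ "\<lambda>f. f"]) simp

setup_lifting type_definition_fun_endo

instantiation fun_endo :: (type, ring_1) ring_1
begin

lift_definition zero_fun_endo :: "('a, 'b) fun_endo" is "\<lambda>f x. 0" by simp
lift_definition one_fun_endo :: "('a, 'b) fun_endo" is "\<lambda>f. f" by simp
lift_definition plus_fun_endo :: "('a, 'b) fun_endo \<Rightarrow> ('a, 'b) fun_endo \<Rightarrow> ('a, 'b) fun_endo"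
  is "\<lambda>F G f x. F f x + G f x" by (auto simp: fun_eq_iff algebra_simps)
lift_definition uminus_fun_endo :: "('a, 'b) fun_endo \<Rightarrow> ('a, 'b) fun_endo"
  is "\<lambda>F f x. - F f x" by (auto simp: fun_eq_iff)
lift_definition minus_fun_endo :: "('a, 'b) fun_endo \<Rightarrow> ('a, 'b) fun_endo \<Rightarrow> ('a, 'b) fun_endo"
  is "\<lambda>F G f x. F f x - G f x" by (auto simp: fun_eq_iff)
lift_definition times_fun_endo :: "('a, 'b) fun_endo \<Rightarrow> ('a, 'b) fun_endo \<Rightarrow> ('a, 'b) fun_endo"
  is "\<lambda>F G f. F (G f)" by simp

instance
proof
  show "(0::('a, 'b) fun_endo) \<noteq> 1"
    by transfer (auto simp: fun_eq_iff intro: exI[of _ "\<lambda>_. 1"])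
qed (transfer; auto simp: fun_eq_iff algebra_simps)+

end

lemma endo_apply_simps [simp]:
  "endo_apply 0 f x = 0" "endo_apply 1 f x = f x"
  "endo_apply (F + G) f x = endo_apply F f x + endo_apply G f x"
  "endo_apply (F - G) f x = endo_apply F f x - endo_apply G f x"
  "endo_apply (- F) f x = - endo_apply F f x"
  "endo_apply (F * G) f x = endo_apply F (endo_apply G f) x"
  by (transfer; simp)+

lemma endo_apply_sum [simp]: "endo_apply (sum F A) f x = (\<Sum>a\<in>A. endo_apply (F a) f x)"
  by (induction A rule: infinite_finite_induct) auto

lemma fun_endo_eqI: "(\<And>f x. endo_apply F f x = endo_apply G f x) \<Longrightarrow> F = G"
  by (simp add: endo_apply_inject[symmetric] fun_eq_iff)

text \<open>A left factor acts on the permutation first: in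
  \<open>cover_op a b * cover_op c d\<close> the function is evaluated at w t_(a,b) t_(c,d), so
  words read as chains from left to right. The guard \<open>inj w\<close> is there because the
  functions live on all maps, whereas the relations require distinct values.\<close>

definition cover_op :: "nat \<Rightarrow> nat \<Rightarrow> (nat \<Rightarrow> nat, 'b::ring_1) fun_endo" where
  "cover_op a b = Abs_fun_endo
     (\<lambda>\<phi> w. if inj w \<and> bruhat_cover w a b then \<phi> (w \<circ> transpose a b) else 0)"

lemma endo_apply_cover_op [simp]:
  "endo_apply (cover_op a b) \<phi> w = (if inj w \<and> bruhat_cover w a b then \<phi> (w \<circ> transpose a b) else 0)"
  unfolding cover_op_def by (subst Abs_fun_endo_inverse) auto

section \<open>Relations among the cover operators\<close>

lemma inj_comp_transpose: "inj w \<Longrightarrow> inj (w \<circ> transpose a b)"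
  by (intro inj_compose) auto

lemma inj_neq: "inj w \<Longrightarrow> a \<noteq> b \<Longrightarrow> w a \<noteq> w b"
  by (auto dest: injD)

text \<open>Emptiness of a rectangle in the permutation matrix. The value bounds are independent of
  w a and w b, since a transposition moves the values but leaves the open range of positions
  alone.\<close>

definition gap :: "(nat \<Rightarrow> nat) \<Rightarrow> nat \<Rightarrow> nat \<Rightarrow> nat \<Rightarrow> nat \<Rightarrow> bool" where
  "gap w a b u v \<longleftrightarrow> (\<forall>c. a < c \<and> c < b \<longrightarrow> \<not> (u < w c \<and> w c < v))"

lemma bruhat_cover_gap: "bruhat_cover w a b \<longleftrightarrow> w a < w b \<and> gap w a b (w a) (w b)"
  by (simp add: bruhat_cover_def gap_def)

lemma gap_split:
  assumes "a < j" "j < b"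
  shows "gap w a b u v \<longleftrightarrow> gap w a j u v \<and> gap w j b u v \<and> \<not> (u < w j \<and> w j < v)" (is "?lhs \<longleftrightarrow> ?rhs")
proof
  assume ?lhs
  with assms show ?rhs by (auto simp: gap_def)
next
  assume r: ?rhs
  show ?lhs unfolding gap_def
  proof (intro allI impI)
    fix c assume "a < c \<and> c < b"
    then show "\<not> (u < w c \<and> w c < v)"
      using r by (cases c j rule: linorder_cases) (auto simp: gap_def)
  qed
qed

lemma gap_cong: "(\<And>c. a < c \<Longrightarrow> c < b \<Longrightarrow> w c = w' c) \<Longrightarrow> gap w a b u v \<longleftrightarrow> gap w' a b u v"
  unfolding gap_def by metis

lemma gap_values:
  assumes "inj w" "u < y" "y < v" "y = w j" "\<not> (a < j \<and> j < b)"
  shows "gap w a b u v \<longleftrightarrow> gap w a b u y \<and> gap w a b y v"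
proof -
  have "w c \<noteq> y" if "a < c" "c < b" for c
    using that assms(4,5) inj_neq[OF assms(1), of c j] by auto
  then have "u < w c \<and> w c < v \<longleftrightarrow> u < w c \<and> w c < y \<or> y < w c \<and> w c < v" if "a < c" "c < b" for c
    using assms(2,3) that by (metis less_trans linorder_neqE_nat)
  then show ?thesis unfolding gap_def by blast
qed

lemma gap_sub: "gap w a b u v \<Longrightarrow> u \<le> u' \<Longrightarrow> v' \<le> v \<Longrightarrow> gap w a b u' v'"
  unfolding gap_def by (auto dest: le_less_trans less_le_trans)

text \<open>Every cover condition after one transposition is expressed by the original w and the
  three values x, y, z, so that two-step products can be compared.\<close>

lemma cover_op_triangle_cases:
  assumes "i < j" "j < l" "inj w"
  defines "x \<equiv> w i" and "y \<equiv> w j" and "z \<equiv> w l"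
  shows "bruhat_cover (w \<circ> transpose i j) j l \<longleftrightarrow> x < z \<and> gap w j l x z"
    and "bruhat_cover (w \<circ> transpose j l) i l \<longleftrightarrow> x < y \<and> gap w i j x y \<and> gap w j l x y \<and> \<not> (x < z \<and> z < y)"
    and "bruhat_cover (w \<circ> transpose i l) i j \<longleftrightarrow> z < y \<and> gap w i j z y"
    and "bruhat_cover (w \<circ> transpose j l) i j \<longleftrightarrow> x < z \<and> gap w i j x z"
    and "bruhat_cover (w \<circ> transpose i l) j l \<longleftrightarrow> y < x \<and> gap w j l y x"
    and "bruhat_cover (w \<circ> transpose i j) i l \<longleftrightarrow> y < z \<and> gap w i j y z \<and> gap w j l y z \<and> \<not> (y < x \<and> x < z)"
    and "bruhat_cover w i l \<longleftrightarrow> x < z \<and> gap w i j x z \<and> gap w j l x z \<and> \<not> (x < y \<and> y < z)"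
proof -
  have c1: "gap (w \<circ> transpose a b) i j u v = gap w i j u v" if "a \<in> {i, j, l}" "b \<in> {i, j, l}" for a b u v
    by (rule gap_cong) (use that assms(1,2) in \<open>auto simp: transpose_def\<close>)
  have c2: "gap (w \<circ> transpose a b) j l u v = gap w j l u v" if "a \<in> {i, j, l}" "b \<in> {i, j, l}" for a b u v
    by (rule gap_cong) (use that assms(1,2) in \<open>auto simp: transpose_def\<close>)
  note simps = bruhat_cover_gap gap_split[OF assms(1,2)] c1 c2 x_def y_def z_def
  show "bruhat_cover (w \<circ> transpose i j) j l \<longleftrightarrow> x < z \<and> gap w j l x z"
    "bruhat_cover (w \<circ> transpose j l) i l \<longleftrightarrow> x < y \<and> gap w i j x y \<and> gap w j l x y \<and> \<not> (x < z \<and> z < y)"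
    "bruhat_cover (w \<circ> transpose i l) i j \<longleftrightarrow> z < y \<and> gap w i j z y"
    "bruhat_cover (w \<circ> transpose j l) i j \<longleftrightarrow> x < z \<and> gap w i j x z"
    "bruhat_cover (w \<circ> transpose i l) j l \<longleftrightarrow> y < x \<and> gap w j l y x"
    "bruhat_cover (w \<circ> transpose i j) i l \<longleftrightarrow> y < z \<and> gap w i j y z \<and> gap w j l y z \<and> \<not> (y < x \<and> x < z)"
    "bruhat_cover w i l \<longleftrightarrow> x < z \<and> gap w i j x z \<and> gap w j l x z \<and> \<not> (x < y \<and> y < z)"
    using assms(1,2) by (auto simp: simps)
qed

text \<open>The order of two of the three values decides which product on the right can survive. The
  other one is then 0, and the surviving one imposes the same empty rectangles as the left side,
  once an interval of values is cut at the third value.\<close>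

lemma cover_op_triangle:
  assumes "i < j" "j < l"
  shows "cover_op i j * cover_op j l = cover_op j l * cover_op i l + cover_op i l * cover_op i j"
    and "cover_op j l * cover_op i j = cover_op i l * cover_op j l + cover_op i j * cover_op i l"
proof -
  have perm: "w \<circ> transpose j l \<circ> transpose i l = w \<circ> transpose i j \<circ> transpose j l"
    "w \<circ> transpose i l \<circ> transpose i j = w \<circ> transpose i j \<circ> transpose j l"
    "w \<circ> transpose i l \<circ> transpose j l = w \<circ> transpose j l \<circ> transpose i j"
    "w \<circ> transpose i j \<circ> transpose i l = w \<circ> transpose j l \<circ> transpose i j" for w :: "nat \<Rightarrow> nat"
    using assms by (auto simp: fun_eq_iff transpose_def)
  note chars = cover_op_triangle_cases[OF assms]
  show "cover_op i j * cover_op j l = cover_op j l * cover_op i l + cover_op i l * cover_op i j"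
  proof (rule fun_endo_eqI)
    fix \<phi> and w :: "nat \<Rightarrow> nat"
    show "endo_apply (cover_op i j * cover_op j l) \<phi> w
      = endo_apply (cover_op j l * cover_op i l + cover_op i l * cover_op i j) \<phi> w"
    proof (cases "inj w")
      case True
      let ?A = "bruhat_cover w i j \<and> bruhat_cover (w \<circ> transpose i j) j l"
      let ?B = "bruhat_cover w j l \<and> bruhat_cover (w \<circ> transpose j l) i l"
      let ?C = "bruhat_cover w i l \<and> bruhat_cover (w \<circ> transpose i l) i j"
      have ne: "w j \<noteq> w l" using inj_neq[OF True] assms by auto
      have "?A \<longleftrightarrow> ?B" if "w j < w l"
        using that assms gap_values[OF True _ _ refl, of "w i" j "w l" j l]
        unfolding chars[OF True] unfolding bruhat_cover_gap by (auto intro: gap_sub)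
      moreover have "?A \<longleftrightarrow> ?C" if "w l < w j"
        using that assms gap_values[OF True _ _ refl, of "w i" l "w j" i j]
        unfolding chars[OF True] unfolding bruhat_cover_gap by (auto intro: gap_sub)
      moreover have "\<not> ?C" if "w j < w l" using that chars[OF True] by auto
      moreover have "\<not> ?B" if "w l < w j" using that unfolding bruhat_cover_gap by auto
      ultimately show ?thesis
        using ne True inj_comp_transpose[OF True] by (cases "w j < w l") (auto simp: perm)
    qed simp
  qed
  show "cover_op j l * cover_op i j = cover_op i l * cover_op j l + cover_op i j * cover_op i l"
  proof (rule fun_endo_eqI)
    fix \<phi> and w :: "nat \<Rightarrow> nat"
    show "endo_apply (cover_op j l * cover_op i j) \<phi> w
      = endo_apply (cover_op i l * cover_op j l + cover_op i j * cover_op i l) \<phi> w"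
    proof (cases "inj w")
      case True
      let ?A = "bruhat_cover w j l \<and> bruhat_cover (w \<circ> transpose j l) i j"
      let ?B = "bruhat_cover w i l \<and> bruhat_cover (w \<circ> transpose i l) j l"
      let ?C = "bruhat_cover w i j \<and> bruhat_cover (w \<circ> transpose i j) i l"
      have ne: "w i \<noteq> w j" using inj_neq[OF True] assms by auto
      have "?A \<longleftrightarrow> ?B" if "w j < w i"
        using that assms gap_values[OF True _ _ refl, of "w j" i "w l" j l]
        unfolding chars[OF True] unfolding bruhat_cover_gap by (auto intro: gap_sub)
      moreover have "?A \<longleftrightarrow> ?C" if "w i < w j"
        using that assms gap_values[OF True _ _ refl, of "w i" j "w l" i j]
        unfolding chars[OF True] unfolding bruhat_cover_gap by (auto intro: gap_sub)
      moreover have "\<not> ?C" if "w j < w i" using that unfolding bruhat_cover_gap by auto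
      moreover have "\<not> ?B" if "w i < w j" using that chars[OF True] by auto
      ultimately show ?thesis
        using ne True inj_comp_transpose[OF True] by (cases "w i < w j") (auto simp: perm)
    qed simp
  qed
qed

text \<open>Splitting off the positions in X separates the part of the cover condition that is
  unaffected by a transposition of X from a comparison of finitely many values.\<close>

definition gap_off :: "nat set \<Rightarrow> (nat \<Rightarrow> nat) \<Rightarrow> nat \<Rightarrow> nat \<Rightarrow> bool" where
  "gap_off X w a b \<longleftrightarrow> (\<forall>e. a < e \<and> e < b \<and> e \<notin> X \<longrightarrow> \<not> (w a < w e \<and> w e < w b))"

lemma bruhat_cover_off:
  "bruhat_cover w a b \<longleftrightarrow> w a < w b \<and> gap_off {p, q} w a b
    \<and> (a < p \<and> p < b \<longrightarrow> \<not> (w a < w p \<and> w p < w b)) \<and> (a < q \<and> q < b \<longrightarrow> \<not> (w a < w q \<and> w q < w b))"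
  unfolding bruhat_cover_def gap_off_def by auto

lemma bruhat_cover_commute:
  assumes "a < b" "c < d" "distinct [a, b, c, d]" "inj w" "bruhat_cover w a b" "bruhat_cover (w \<circ> transpose a b) c d"
  shows "bruhat_cover w c d \<and> bruhat_cover (w \<circ> transpose c d) a b"
proof -
  have ne: "w a \<noteq> w c" "w a \<noteq> w d" "w b \<noteq> w c" "w b \<noteq> w d"
    using assms(3) inj_neq[OF assms(4)] by auto
  have off: "gap_off {a, b} (w \<circ> transpose a b) c d = gap_off {a, b} w c d"
    "gap_off {c, d} (w \<circ> transpose c d) a b = gap_off {c, d} w a b"
    using assms(3) by (auto simp: gap_off_def transpose_def)
  have vals: "(w \<circ> transpose a b) a = w b" "(w \<circ> transpose a b) b = w a" "(w \<circ> transpose a b) c = w c" "(w \<circ> transpose a b) d = w d"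
    "(w \<circ> transpose c d) a = w a" "(w \<circ> transpose c d) b = w b" "(w \<circ> transpose c d) c = w d" "(w \<circ> transpose c d) d = w c"
    using assms(3) by (auto simp: transpose_def)
  show ?thesis
    using assms(1-3,5,6) ne
    unfolding bruhat_cover_off[of _ a b c d] bruhat_cover_off[of _ c d a b] off vals
    by (smt (verit) distinct.simps(2) list.set_intros linorder_neqE_nat less_trans)
qed

lemma cover_op_commute:
  assumes "a < b" "c < d" "distinct [a, b, c, d]"
  shows "cover_op a b * cover_op c d = cover_op c d * cover_op a b"
proof (rule fun_endo_eqI)
  fix \<phi> and w :: "nat \<Rightarrow> nat"
  have eq: "w \<circ> transpose a b \<circ> transpose c d = w \<circ> transpose c d \<circ> transpose a b"
    using assms(3) by (auto simp: fun_eq_iff transpose_def)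
  have "distinct [c, d, a, b]" using assms(3) by auto
  then have "inj w \<Longrightarrow> (bruhat_cover w a b \<and> bruhat_cover (w \<circ> transpose a b) c d)
      = (bruhat_cover w c d \<and> bruhat_cover (w \<circ> transpose c d) a b)"
    using bruhat_cover_commute[OF assms, of w] bruhat_cover_commute[OF assms(2,1), of w] by blast
  then show "endo_apply (cover_op a b * cover_op c d) \<phi> w = endo_apply (cover_op c d * cover_op a b) \<phi> w"
    using eq inj_comp_transpose[of w] by auto
qed

definition edge_op :: "nat \<Rightarrow> nat \<Rightarrow> (nat \<Rightarrow> nat, 'b::ring_1) fun_endo" where
  "edge_op a b = (if a < b then cover_op a b else if b < a then - cover_op b a else 0)"

lemma cover_op_square: "cover_op a b * cover_op a b = 0"
  by (rule fun_endo_eqI) (auto simp: bruhat_cover_def)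

text \<open>The cyclic relation is unchanged by rotating i, j, k, so the six relative orders reduce
  to the two identities of \<open>cover_op_triangle\<close>.\<close>

interpretation bruhat: fk_algebra edge_op
proof
  fix i j k l :: nat
  show "edge_op i j * edge_op i j = 0" by (simp add: edge_op_def cover_op_square)
  show "edge_op j i = - edge_op i j" by (simp add: edge_op_def)
  show "edge_op i j * edge_op k l = edge_op k l * edge_op i j" if "distinct [i, j, k, l]"
  proof -
    have "cover_op (min i j) (max i j) * cover_op (min k l) (max k l)
        = cover_op (min k l) (max k l) * cover_op (min i j) (max i j)"
      by (rule cover_op_commute) (use that in \<open>auto simp: min_def max_def\<close>)
    then show ?thesis using that by (auto simp: edge_op_def min_def max_def split: if_splits)
  qed
  assume "distinct [i, j, k]"
  then consider "i < j" "j < k" | "j < k" "k < i" | "k < i" "i < j"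
    | "i < k" "k < j" | "k < j" "j < i" | "j < i" "i < k" by force
  then show "edge_op i j * edge_op j k + edge_op j k * edge_op k i + edge_op k i * edge_op i j = 0"
  proof cases
    case 1 then show ?thesis using cover_op_triangle(1)[OF 1] by (simp add: edge_op_def algebra_simps)
  next
    case 2 then show ?thesis using cover_op_triangle(1)[OF 2] by (simp add: edge_op_def algebra_simps)
  next
    case 3 then show ?thesis using cover_op_triangle(1)[OF 3] by (simp add: edge_op_def algebra_simps)
  next
    case 4 then show ?thesis using cover_op_triangle(2)[OF 4] by (simp add: edge_op_def algebra_simps)
  next
    case 5 then show ?thesis using cover_op_triangle(2)[OF 5] by (simp add: edge_op_def algebra_simps)
  next
    case 6 then show ?thesis using cover_op_triangle(2)[OF 6] by (simp add: edge_op_def algebra_simps)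
  qed
qed

section \<open>Monk's rule\<close>

text \<open>The counterpart of the divided difference for functions of permutations: on
  \<open>schubert\<close> the two agree by \<open>divided_difference_schubert\<close>.\<close>

definition descent_step :: "nat \<Rightarrow> ((nat \<Rightarrow> nat) \<Rightarrow> ipoly) \<Rightarrow> (nat \<Rightarrow> nat) \<Rightarrow> ipoly" where
  "descent_step i \<phi> w = (if w (Suc i) < w i then \<phi> (w \<circ> transpose i (Suc i)) else 0)"

text \<open>Conjugation by s_i turns a cover followed by a descent at i into a descent followed by a
  cover. Positions other than i and i + 1 see the same condition on both sides, so the order of the
  values at a, b, i, i + 1 decides.\<close>

lemma bruhat_cover_descent:
  assumes "a < b" "(a, b) \<noteq> (i, Suc i)" "inj w"
  defines "s \<equiv> transpose i (Suc i)"
  shows "bruhat_cover w a b \<and> (w \<circ> transpose a b) (Suc i) < (w \<circ> transpose a b) i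
    \<longleftrightarrow> w (Suc i) < w i \<and> bruhat_cover (w \<circ> s) (s a) (s b)"
proof -
  have ne: "w x \<noteq> w y" if "x \<noteq> y" for x y using inj_neq[OF assms(3) that] .
  have s: "s i = Suc i" "s (Suc i) = i" "\<And>x. x \<noteq> i \<Longrightarrow> x \<noteq> Suc i \<Longrightarrow> s x = x" "\<And>x. s (s x) = x"
    by (auto simp: s_def)
  have off: "gap_off {i, Suc i} (w \<circ> s) (s a) (s b) = gap_off {i, Suc i} w a b"
  proof -
    have "s a < e \<and> e < s b \<longleftrightarrow> a < e \<and> e < b" if "e \<notin> {i, Suc i}" for e
      using that by (auto simp: s_def transpose_def split: if_splits)
    then show ?thesis unfolding gap_off_def by (auto simp: s)
  qed
  consider "a = i" "b \<noteq> Suc i" "Suc i < b" | "a = Suc i" "Suc i < b" | "b = i" "a < i"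
    | "b = Suc i" "a < i" | "a \<notin> {i, Suc i}" "b \<notin> {i, Suc i}"
    using assms(1,2) by fastforce
  then show ?thesis
  proof cases
    case 1
    then have "w (Suc i) \<noteq> w i" "w (Suc i) \<noteq> w b" using ne by auto
    then show ?thesis
      using 1 assms(1) unfolding bruhat_cover_off[of _ _ _ i "Suc i"] off by (auto simp: s transpose_def)
  next
    case 2
    then have "w (Suc i) \<noteq> w i" "w i \<noteq> w b" using ne by auto
    then show ?thesis
      using 2 assms(1) unfolding bruhat_cover_off[of _ _ _ i "Suc i"] off by (auto simp: s transpose_def)
  next
    case 3
    then have "w (Suc i) \<noteq> w i" "w (Suc i) \<noteq> w a" using ne by auto
    then show ?thesis
      using 3 assms(1) unfolding bruhat_cover_off[of _ _ _ i "Suc i"] off by (auto simp: s transpose_def)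
  next
    case 4
    then have "w (Suc i) \<noteq> w i" "w i \<noteq> w a" using ne by auto
    then show ?thesis
      using 4 assms(1) unfolding bruhat_cover_off[of _ _ _ i "Suc i"] off by (auto simp: s transpose_def)
  next
    case 5
    then show ?thesis
      using assms(1) unfolding bruhat_cover_off[of _ _ _ i "Suc i"] off by (auto simp: s transpose_def)
  qed
qed

lemma cover_op_descent_step:
  assumes "a < b" "(a, b) \<noteq> (i, Suc i)" "inj w"
  shows "endo_apply (cover_op a b) (descent_step i \<phi>) w
    = descent_step i (endo_apply (cover_op (transpose i (Suc i) a) (transpose i (Suc i) b)) \<phi>) w"
proof -
  have "w \<circ> transpose a b \<circ> transpose i (Suc i)
      = w \<circ> transpose i (Suc i) \<circ> transpose (transpose i (Suc i) a) (transpose i (Suc i) b)"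
    using assms(1) by (auto simp: fun_eq_iff transpose_def)
  then show ?thesis
    using bruhat_cover_descent[OF assms] inj_comp_transpose[OF assms(3), of i "Suc i"] assms(3)
    by (auto simp: descent_step_def simp del: o_apply)
qed

lemma cover_op_descent_step_adjacent:
  assumes "inj w"
  shows "endo_apply (cover_op i (Suc i)) (descent_step i \<phi>) w
    + descent_step i (endo_apply (cover_op i (Suc i)) \<phi>) w = \<phi> w"
  using assms inj_comp_transpose[OF assms, of i "Suc i"] inj_neq[OF assms, of i "Suc i"]
  by (auto simp: descent_step_def bruhat_cover_def comp_assoc)

text \<open>This mirrors the Leibniz rule for x_k f: the index is conjugated by s_i as the variable
  is, and the edge {i, i+1} alone gives a correction, with the sign of the divided difference of x_i
  or x_(i+1).\<close>

lemma edge_op_descent_step: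
  assumes "inj w"
  shows "endo_apply (edge_op a b) (descent_step i \<phi>) w
    = descent_step i (endo_apply (edge_op (transpose i (Suc i) a) (transpose i (Suc i) b)) \<phi>) w
      + (of_bool (a = i \<and> b = Suc i) - of_bool (a = Suc i \<and> b = i)) * \<phi> w"
proof -
  let ?s = "transpose i (Suc i)"
  have neg: "descent_step i (endo_apply (- F) \<phi>) w = - descent_step i (endo_apply F \<phi>) w"
    and zero: "descent_step i (endo_apply 0 \<phi>) w = 0" for F :: "(nat \<Rightarrow> nat, ipoly) fun_endo"
    by (auto simp: descent_step_def)
  have adj: "endo_apply (cover_op i (Suc i)) (descent_step i \<phi>) w
      = \<phi> w - descent_step i (endo_apply (cover_op i (Suc i)) \<phi>) w"
    using cover_op_descent_step_adjacent[OF assms] by (simp add: algebra_simps)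
  have s: "?s c < ?s d" if "c < d" "(c, d) \<noteq> (i, Suc i)" for c d
    using that by (auto simp: transpose_def)
  consider "a = b" | "(a, b) = (i, Suc i)" | "(b, a) = (i, Suc i)"
    | "a < b" "(a, b) \<noteq> (i, Suc i)" | "b < a" "(b, a) \<noteq> (i, Suc i)"
    by (metis linorder_neqE_nat)
  then show ?thesis
  proof cases
    case 1
    then show ?thesis by (auto simp: edge_op_def zero)
  next
    case 2
    then show ?thesis by (auto simp: edge_op_def adj neg simp del: endo_apply_cover_op)
  next
    case 3
    then show ?thesis by (auto simp: edge_op_def adj simp del: endo_apply_cover_op)
  next
    case 4
    then show ?thesis
      using cover_op_descent_step[OF 4 assms] s[OF 4] by (auto simp: edge_op_def)
  next
    case 5
    then have "\<not> ?s a < ?s b" "?s b < ?s a" using s[OF 5] by auto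
    with 5 show ?thesis
      using cover_op_descent_step[OF 5 assms] by (auto simp: edge_op_def neg)
  qed
qed

lemma no_descent_beyond:
  assumes "w permutes {1..n}" "n \<le> i"
  shows "w i < w (Suc i)"
proof -
  have "w (Suc i) = Suc i" using assms by (intro permutes_not_in[OF assms(1)]) auto
  moreover have "w i \<le> i"
  proof (cases "i \<in> {1..n}")
    case True
    then have "w i \<in> {1..n}" using assms(1) by (simp only: permutes_in_image)
    then show ?thesis using assms(2) by simp
  next
    case False
    then have "w i = i" by (rule permutes_not_in[OF assms(1)])
    then show ?thesis by simp
  qed
  ultimately show ?thesis by simp
qed

lemma divided_difference_edge_op:
  assumes "w permutes {1..N}" "1 \<le> i" "a \<in> {1..N}" "b \<in> {1..N}"
  shows "divided_difference i (endo_apply (edge_op a b) schubert w)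
    = endo_apply (edge_op a b) (descent_step i schubert) w"
proof -
  have "divided_difference i (endo_apply (cover_op a b) schubert w)
    = endo_apply (cover_op a b) (descent_step i schubert) w" if "a \<in> {1..N}" "b \<in> {1..N}" for a b
  proof -
    have "w \<circ> transpose a b permutes {1..N}"
      using assms that by (intro permutes_comp_transpose) auto
    then show ?thesis
      using divided_difference_schubert[OF permutes_fin_perms, of "w \<circ> transpose a b" N i] assms(2)
      by (auto simp: descent_step_def divided_difference_eq_0 simp del: o_apply)
  qed
  moreover have "divided_difference i (- f) = - divided_difference i f" for f
    using divided_difference_diff[of i 0 f] by (simp add: divided_difference_eq_0)
  ultimately show ?thesis
    using assms by (auto simp: edge_op_def divided_difference_eq_0)
qed

lemma homogeneous_edge_op:
  assumes "w \<in> fin_perms" "1 \<le> a" "1 \<le> b"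
  shows "homogeneous (Suc (card (inversions w))) (endo_apply (edge_op a b) schubert w)"
proof -
  have "homogeneous (Suc (card (inversions w))) (endo_apply (cover_op a b) schubert w)"
    if "1 \<le> a" "a < b" for a b
  proof -
    have f: "w \<circ> transpose a b \<in> fin_perms" using assms that by (intro fin_perms_comp_transpose) auto
    have "card (inversions (w \<circ> transpose a b)) = Suc (card (inversions w))" if "bruhat_cover w a b"
      using bruhat_cover_iff[OF assms(1) \<open>1 \<le> a\<close> \<open>a < b\<close>] that by (simp add: coxeter_length_eq f assms(1))
    then show ?thesis
      using homogeneous_schubert[OF f] by (auto intro: homogeneous.zero simp del: o_apply)
  qed
  then show ?thesis
    using assms
    by (auto simp: edge_op_def intro: homogeneous.zero homogeneous.uminus simp del: endo_apply_cover_op)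
qed

text \<open>For w in S_M and k \<le> M the cutoff N = M + 1 loses nothing: in a transposition of k
  with b > M + 1, the fixed point M + 1 lies between in position and in value.\<close>

definition dunkl_op :: "nat \<Rightarrow> nat \<Rightarrow> (nat \<Rightarrow> nat, ipoly) fun_endo" where
  "dunkl_op N k = (\<Sum>b\<in>{1..N} - {k}. edge_op k b)"

text \<open>
  The difference of the two sides is homogeneous of positive degree, and all its divided
  differences vanish by induction on the length.
\<close>

lemma monk:
  assumes "w permutes {1..M}" "k \<in> {1..M}"
  shows "endo_apply (dunkl_op (Suc M) k) schubert w = var k * schubert w"
  using assms
proof (induction "card (inversions w)" arbitrary: w k rule: less_induct)
  case less
  let ?N = "Suc M"
  have w: "w \<in> fin_perms" using less.prems(1) by (rule permutes_fin_perms)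
  have wN: "w permutes {1..?N}" using less.prems(1) by (rule permutes_atLeastAtMost_mono) simp
  let ?D = "var k * schubert w - endo_apply (dunkl_op ?N k) schubert w"
  have "homogeneous (Suc (card (inversions w))) ?D"
    unfolding dunkl_op_def endo_apply_sum using less.prems w
    by (intro homogeneous_diff homogeneous.var homogeneous_schubert homogeneous_sum homogeneous_edge_op) auto
  moreover have "divided_difference i ?D = 0" if i: "1 \<le> i" for i
  proof -
    let ?s = "transpose i (Suc i)"
    let ?e = "of_bool (k = i) - of_bool (k = Suc i) :: ipoly"
    have ddS: "divided_difference i (schubert w) = descent_step i schubert w"
      using divided_difference_schubert[OF w i] by (simp add: descent_step_def)
    have lhs: "divided_difference i (var k * schubert w)
        = ?e * schubert w + var (?s k) * descent_step i schubert w"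
      by (simp add: divided_difference_mult divided_difference_var swap_vars_var ddS)
    have rhs: "divided_difference i (endo_apply (dunkl_op ?N k) schubert w)
        = (\<Sum>b\<in>{1..?N} - {k}. endo_apply (edge_op k b) (descent_step i schubert) w)"
      unfolding dunkl_op_def endo_apply_sum divided_difference_sum
      using less.prems i by (intro sum.cong refl divided_difference_edge_op[OF wN]) auto
    show ?thesis
    proof (cases "i \<le> M")
      \<comment> \<open>For i > M neither w nor its covers inside S_(M+1) descend at i, except that
        i = M + 1 needs the cutoff; and k is neither i nor i + 1. Hence both divided differences are
        0.\<close>
      case False
      then have "w i < w (Suc i)" using no_descent_beyond[OF less.prems(1)] by simp
      moreover have "endo_apply (edge_op k b) (descent_step i schubert) w = 0" if "b \<in> {1..?N}" for b
      proof -
        have "endo_apply (cover_op c d) (descent_step i schubert) w = 0" if "c \<in> {1..?N}" "d \<in> {1..?N}" for c d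
        proof -
          have "w \<circ> transpose c d permutes {1..?N}"
            using wN that by (intro permutes_comp_transpose) auto
          then show ?thesis
            using no_descent_beyond[of "w \<circ> transpose c d" ?N i] False
            by (simp add: descent_step_def del: o_apply)
        qed
        then show ?thesis using that less.prems by (simp add: edge_op_def)
      qed
      ultimately show ?thesis
        using False less.prems lhs rhs by (simp add: divided_difference_diff descent_step_def)
    next
      case True
      \<comment> \<open>Since i \<le> M and \<open>?N\<close> is M + 1, the neighbour of k in {i,
        i+1} lies in the summation range, and the corrections add up to the divided difference of
        x_k.\<close>
      have eps: "(\<Sum>b\<in>{1..?N} - {k}. (of_bool (k = i \<and> b = Suc i) - of_bool (k = Suc i \<and> b = i)) * schubert w) = ?e * schubert w"
      proof -
        have "(\<Sum>b\<in>{1..?N} - {k}. of_bool (k = i \<and> b = Suc i) :: ipoly) = of_bool (k = i)"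
          using True i by (cases "k = i") (auto simp: of_bool_def sum.delta)
        moreover have "(\<Sum>b\<in>{1..?N} - {k}. of_bool (k = Suc i \<and> b = i) :: ipoly) = of_bool (k = Suc i)"
          using True i by (cases "k = Suc i") (auto simp: of_bool_def sum.delta)
        ultimately show ?thesis by (simp only: sum_distrib_right[symmetric] sum_subtractf)
      qed
      have "(\<Sum>b\<in>{1..?N} - {k}. endo_apply (edge_op k b) (descent_step i schubert) w)
          = (\<Sum>b\<in>{1..?N} - {k}. descent_step i (endo_apply (edge_op (?s k) (?s b)) schubert) w) + ?e * schubert w"
        unfolding eps[symmetric] sum.distrib[symmetric]
        by (intro sum.cong refl edge_op_descent_step fin_perms_inj w)
      also have "(\<Sum>b\<in>{1..?N} - {k}. descent_step i (endo_apply (edge_op (?s k) (?s b)) schubert) w)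
          = (\<Sum>b\<in>{1..?N} - {?s k}. descent_step i (endo_apply (edge_op (?s k) b) schubert) w)"
        by (rule sum.reindex_bij_witness[where i = ?s and j = ?s])
          (use True i in \<open>auto simp: transpose_def split: if_splits\<close>)
      also have "\<dots> = descent_step i (endo_apply (dunkl_op ?N (?s k)) schubert) w"
        by (simp add: dunkl_op_def descent_step_def)
      finally have "divided_difference i ?D
          = var (?s k) * descent_step i schubert w - descent_step i (endo_apply (dunkl_op ?N (?s k)) schubert) w"
        by (simp add: divided_difference_diff lhs rhs)
      also have "\<dots> = 0"
      proof (cases "w (Suc i) < w i")
        case True
        \<comment> \<open>A descent at i forces i < M, so w s_i stays in S_M and the exchanged index
          stays in range for the induction.\<close>
        then have iM: "i < M" using no_descent_beyond[OF less.prems(1), of i] by linarith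
        have "endo_apply (dunkl_op ?N (?s k)) schubert (w \<circ> ?s) = var (?s k) * schubert (w \<circ> ?s)"
        proof (rule less.hyps)
          show "card (inversions (w \<circ> ?s)) < card (inversions w)"
            using card_inversions_descent[OF w i True] by simp
          show "w \<circ> ?s permutes {1..M}"
            using less.prems i iM by (intro permutes_comp_transpose) auto
          show "?s k \<in> {1..M}" using less.prems i iM by (auto simp: transpose_def)
        qed
        then show ?thesis using True by (simp add: descent_step_def)
      qed (simp add: descent_step_def)
      finally show ?thesis .
    qed
  qed
  ultimately have "?D = 0" by (rule homogeneous_symmetric_eq_0[OF _ zero_less_Suc])
  then show ?case by simp
qed

section \<open>The Pieri rule for chains\<close>

fun elem_sym :: "nat \<Rightarrow> nat \<Rightarrow> ipoly" where
  "elem_sym 0 k = 1"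
| "elem_sym (Suc m) 0 = 0"
| "elem_sym (Suc m) (Suc k) = elem_sym (Suc m) k + var (Suc k) * elem_sym m k"

section \<open>Expanding matchings into words\<close>

definition matching_words :: "nat set \<Rightarrow> nat list \<Rightarrow> (nat \<times> nat) list set" where
  "matching_words A bs = {cs. distinct (map fst cs) \<and> fst ` set cs = A \<and> snd ` set cs \<subseteq> set bs
     \<and> sorted_wrt (\<ge>) (map snd cs)}"

lemma finite_matching_words: "finite A \<Longrightarrow> finite (matching_words A bs)"
proof (rule finite_subset)
  assume A: "finite A"
  show "matching_words A bs \<subseteq> {cs. set cs \<subseteq> A \<times> set bs \<and> length cs \<le> card A}"
  proof
    fix cs assume cs: "cs \<in> matching_words A bs"
    then have "length cs = card (fst ` set cs)"
      using distinct_card[of "map fst cs"] by (simp add: matching_words_def)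
    then show "cs \<in> {cs. set cs \<subseteq> A \<times> set bs \<and> length cs \<le> card A}"
      using cs subset_fst_snd[of "set cs"] unfolding matching_words_def by auto
  qed
  show "finite {cs. set cs \<subseteq> A \<times> set bs \<and> length cs \<le> card A}"
    using A by (intro finite_lists_length_le) auto
qed

text \<open>As b exceeds all of \<open>bs\<close>, its letters form a prefix of every weakly
  decreasing word. That prefix is an ordering of the block B of b, and the rest is a word for A -
  B.\<close>

lemma sum_matching_words_Cons:
  assumes "finite A" "sorted_wrt (>) (b # bs)"
  shows "(\<Sum>cs\<in>matching_words A (b # bs). f cs)
    = (\<Sum>B\<in>Pow A. \<Sum>xs\<in>permutations_of_set B. \<Sum>cs\<in>matching_words (A - B) bs. f (map (\<lambda>a. (a, b)) xs @ cs))"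
proof -
  have fin: "finite (matching_words (A - B) bs)" "finite (permutations_of_set B)" if "B \<in> Pow A" for B
    using that assms(1) by (auto intro: finite_matching_words)
  have b: "b' < b" if "b' \<in> set bs" for b' using assms(2) that by auto
  let ?S = "Sigma (Pow A) (\<lambda>B. permutations_of_set B \<times> matching_words (A - B) bs)"
  let ?P = "\<lambda>p. snd p = b"
  let ?j = "\<lambda>cs. (fst ` set (takeWhile ?P cs), map fst (takeWhile ?P cs), dropWhile ?P cs)"
  let ?i = "\<lambda>(B, xs, cs). map (\<lambda>a. (a, b)) xs @ cs"
  have "(\<Sum>cs\<in>matching_words A (b # bs). f cs) = (\<Sum>x\<in>?S. f (?i x))"
  proof (rule sum.reindex_bij_witness[where i = ?i and j = ?j])
    fix cs assume cs: "cs \<in> matching_words A (b # bs)"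
    let ?t = "takeWhile ?P cs" and ?d = "dropWhile ?P cs"
    have t: "map (\<lambda>a. (a, b)) (map fst ?t) = ?t"
      unfolding map_map by (rule map_idI) (auto dest: set_takeWhileD)
    show "?i (?j cs) = cs" using t by simp
    show "f (?i (?j cs)) = f cs" using t by simp
    have cs': "?t @ ?d \<in> matching_words A (b # bs)" using cs by simp
    have "distinct (map fst t) \<and> distinct (map fst d) \<and> fst ` set t \<inter> fst ` set d = {}
        \<and> fst ` set t \<union> fst ` set d = A \<and> sorted_wrt (\<ge>) (map snd d) \<and> snd ` set d \<subseteq> set (b # bs)"
      if "t @ d \<in> matching_words A (b # bs)" for t d
      using that unfolding matching_words_def by (auto simp: sorted_wrt_append)
    note dist = this[OF cs', THEN conjunct1] this[OF cs', THEN conjunct2, THEN conjunct1]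
      this[OF cs', THEN conjunct2, THEN conjunct2, THEN conjunct1]
      this[OF cs', THEN conjunct2, THEN conjunct2, THEN conjunct2, THEN conjunct1]
      this[OF cs', THEN conjunct2, THEN conjunct2, THEN conjunct2, THEN conjunct2, THEN conjunct1]
      this[OF cs', THEN conjunct2, THEN conjunct2, THEN conjunct2, THEN conjunct2, THEN conjunct2]
    \<comment> \<open>The first letter after the prefix has a target below b, and targets never rise
      again.\<close>
    have "snd p \<noteq> b" if "p \<in> set ?d" for p
    proof (cases ?d)
      case (Cons q qs)
      then have "snd q \<noteq> b" using hd_dropWhile[of ?P cs] by simp
      moreover have "snd q \<in> set (b # bs)" using dist(6) Cons by auto
      ultimately have "snd q < b" using b by auto
      then show ?thesis using dist(5) that Cons by auto
    next
      case Nil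
      then show ?thesis using that by (metis empty_iff list.set(1))
    qed
    note ne = this
    have "snd ` set ?d \<subseteq> set bs"
    proof
      fix y assume "y \<in> snd ` set ?d"
      then obtain p where p: "p \<in> set ?d" "y = snd p" by blast
      then have "y \<in> set (b # bs)" "y \<noteq> b" using dist(6) ne[OF p(1)] by blast+
      then show "y \<in> set bs" by simp
    qed
    moreover have "fst ` set ?d = A - fst ` set ?t" using dist(3,4) by blast
    ultimately have "?d \<in> matching_words (A - fst ` set ?t) bs"
      using dist(2,5) unfolding matching_words_def by blast
    moreover have "map fst ?t \<in> permutations_of_set (fst ` set ?t)"
      using dist(1) by (simp add: permutations_of_set_def)
    moreover have "fst ` set ?t \<in> Pow A" using dist(4) by blast
    ultimately show "?j cs \<in> ?S" by blast
  next
    fix x assume "x \<in> ?S"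
    then obtain B xs cs where x: "x = (B, xs, cs)" "B \<subseteq> A" "set xs = B" "distinct xs"
      and cs: "cs \<in> matching_words (A - B) bs"
      by (auto simp: permutations_of_set_def)
    have "\<forall>p\<in>set cs. snd p \<noteq> b" using cs b by (fastforce simp: matching_words_def)
    then have "takeWhile ?P cs = []" "dropWhile ?P cs = cs" by (cases cs; auto)+
    then have "takeWhile ?P (map (\<lambda>a. (a, b)) xs @ cs) = map (\<lambda>a. (a, b)) xs"
      "dropWhile ?P (map (\<lambda>a. (a, b)) xs @ cs) = cs"
      by (induction xs) auto
    then show "?j (?i x) = x" using x by (simp add: comp_def image_image)
    have "sorted_wrt (\<ge>) (map (\<lambda>_. b) xs)" by (induction xs) auto
    then show "?i x \<in> matching_words A (b # bs)"
      using x cs b unfolding matching_words_def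
      by (auto simp: comp_def sorted_wrt_append image_Un image_image less_imp_le)
  qed
  also have "\<dots> = (\<Sum>B\<in>Pow A. \<Sum>xs\<in>permutations_of_set B. \<Sum>cs\<in>matching_words (A - B) bs. f (map (\<lambda>a. (a, b)) xs @ cs))"
  proof -
    have "(\<Sum>B\<in>Pow A. \<Sum>x\<in>permutations_of_set B \<times> matching_words (A - B) bs. f (?i (B, x)))
        = (\<Sum>x\<in>?S. f (?i x))"
      using assms(1) fin by (subst sum.Sigma) (auto simp: case_prod_unfold)
    then show ?thesis by (simp add: sum.cartesian_product case_prod_unfold)
  qed
  finally show ?thesis .
qed

lemma (in fk_algebra) matching_sum_words:
  assumes "finite A" "sorted_wrt (>) bs"
  shows "matching_sum A bs = (\<Sum>cs\<in>matching_words A bs. prod_list (map (\<lambda>(a, b). t a b) cs))"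
  using assms
proof (induction bs arbitrary: A)
  case Nil
  have "matching_words A [] = (if A = {} then {[]} else {})" by (auto simp: matching_words_def)
  then show ?case by simp
next
  case (Cons b bs)
  have "prod_list (map (\<lambda>(a, b). t a b) (map (\<lambda>a. (a, b)) xs @ cs)) = star xs b * prod_list (map (\<lambda>(a, b). t a b) cs)" for xs cs
    by (simp add: star_def comp_def)
  then show ?case
    using Cons unfolding sum_matching_words_Cons[OF Cons.prems]
    by (simp add: star_sum_def sum_product)
qed

definition pieri_words :: "nat \<Rightarrow> nat set \<Rightarrow> nat set \<Rightarrow> (nat \<times> nat) list set" where
  "pieri_words m I J = {cs. length cs = m \<and> distinct (map fst cs) \<and> set cs \<subseteq> I \<times> J
     \<and> sorted_wrt (\<ge>) (map snd cs)}"

lemma (in fk_algebra) e_sum_words: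
  assumes "finite I" "sorted_wrt (>) bs"
  shows "e_sum m I bs = (\<Sum>cs\<in>pieri_words m I (set bs). prod_list (map (\<lambda>(a, b). t a b) cs))"
proof -
  let ?P = "{A. A \<subseteq> I \<and> card A = m}"
  have fin: "finite ?P" "\<forall>A\<in>?P. finite A" using assms(1) by (auto intro: finite_subset)
  have len: "card (fst ` set cs) = length cs" if "distinct (map fst cs)" for cs :: "(nat \<times> nat) list"
    using distinct_card[OF that] by simp
  have "pieri_words m I (set bs) = (\<Union>A\<in>?P. matching_words A bs)"
  proof (intro set_eqI iffI)
    fix cs assume cs: "cs \<in> pieri_words m I (set bs)"
    then have "fst ` set cs \<in> ?P" by (force simp: pieri_words_def len)
    moreover have "cs \<in> matching_words (fst ` set cs) bs"
      using cs by (auto simp: pieri_words_def matching_words_def)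
    ultimately show "cs \<in> (\<Union>A\<in>?P. matching_words A bs)" by blast
  next
    fix cs assume "cs \<in> (\<Union>A\<in>?P. matching_words A bs)"
    then obtain A where A: "A \<subseteq> I" "card A = m" and cs: "cs \<in> matching_words A bs" by blast
    then have "fst ` set cs = A" "distinct (map fst cs)" by (simp_all add: matching_words_def)
    then have "length cs = m" using len[of cs] A by simp
    moreover have "set cs \<subseteq> I \<times> set bs"
      using cs A subset_fst_snd[of "set cs"] unfolding matching_words_def by blast
    ultimately show "cs \<in> pieri_words m I (set bs)"
      using cs by (simp add: pieri_words_def matching_words_def)
  qed
  moreover have "(\<Sum>cs\<in>(\<Union>A\<in>?P. matching_words A bs). prod_list (map (\<lambda>(a, b). t a b) cs))
      = (\<Sum>A\<in>?P. \<Sum>cs\<in>matching_words A bs. prod_list (map (\<lambda>(a, b). t a b) cs))"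
  proof (rule sum.UNION_disjoint)
    show "\<forall>A\<in>?P. \<forall>B\<in>?P. A \<noteq> B \<longrightarrow> matching_words A bs \<inter> matching_words B bs = {}"
      unfolding matching_words_def by blast
  qed (use fin finite_matching_words in blast)+
  moreover have "e_sum m I bs = (\<Sum>A\<in>?P. \<Sum>cs\<in>matching_words A bs. prod_list (map (\<lambda>(a, b). t a b) cs))"
    unfolding e_sum_def using fin(2) by (intro sum.cong refl matching_sum_words assms(2)) blast
  ultimately show ?thesis by (simp only:)
qed

text \<open>A step with b > n + 1 is no cover: position n + 1 lies between a and b, and its value n
  + 1 between w a \<le> n and w b = b. So each step enlarges the symmetric group by at most
  one.\<close>

lemma chain_end_permutes:
  assumes "k_bruhat_chain k w cs" "w permutes {1..n}" "k \<le> n"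
  shows "chain_end w cs permutes {1..n + length cs} \<and> (\<forall>(a, b)\<in>set cs. b \<le> n + length cs)"
  using assms
proof (induction cs arbitrary: w n)
  case (Cons p cs)
  obtain a b where p: "p = (a, b)" by (cases p)
  have w: "w \<in> fin_perms" using Cons.prems(2) by (rule permutes_fin_perms)
  have ab: "1 \<le> a" "a \<le> k" "k < b" and cov: "bruhat_cover w a b"
    and chain: "k_bruhat_chain k (w \<circ> transpose a b) cs"
    using Cons.prems(1) bruhat_cover_iff[OF w, of a b] unfolding p by auto
  have out: "w x = x" if "n < x" for x using that by (intro permutes_not_in[OF Cons.prems(2)]) auto
  have "a \<in> {1..n}" using ab Cons.prems(3) by simp
  then have "w a \<in> {1..n}" using Cons.prems(2) by (simp only: permutes_in_image)
  have "b \<le> Suc n"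
  proof (rule ccontr)
    assume "\<not> b \<le> Suc n"
    then have "a < Suc n \<and> Suc n < b" "w a < w (Suc n) \<and> w (Suc n) < w b"
      using out[of b] out[of "Suc n"] \<open>a \<in> {1..n}\<close> \<open>w a \<in> {1..n}\<close> by auto
    then show False using cov unfolding bruhat_cover_def by blast
  qed
  have v: "w \<circ> transpose a b permutes {1..Suc n}"
    using ab Cons.prems(3) \<open>b \<le> Suc n\<close>
    by (intro permutes_comp_transpose permutes_atLeastAtMost_mono[OF Cons.prems(2)]) auto
  have "chain_end (w \<circ> transpose a b) cs permutes {1..Suc n + length cs}
      \<and> (\<forall>(a, b)\<in>set cs. b \<le> Suc n + length cs)"
    by (rule Cons.IH[OF chain v]) (use Cons.prems(3) in simp)
  then show ?case using p \<open>b \<le> Suc n\<close> by simp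
qed simp

lemma endo_apply_word:
  assumes "w \<in> fin_perms" "set cs \<subseteq> {1..k} \<times> {Suc k..}"
  shows "endo_apply (prod_list (map (\<lambda>(a, b). edge_op a b) cs)) \<phi> w
    = (if k_bruhat_chain k w cs then \<phi> (chain_end w cs) else 0)"
  using assms
proof (induction cs arbitrary: w)
  case (Cons p cs)
  obtain a b where p: "p = (a, b)" by (cases p)
  have ab: "1 \<le> a" "a \<le> k" "k < b" using Cons.prems(2) p by auto
  have v: "w \<circ> transpose a b \<in> fin_perms" using Cons.prems(1) ab by (intro fin_perms_comp_transpose) auto
  have "edge_op a b = (cover_op a b :: (nat \<Rightarrow> nat, 'a) fun_endo)" using ab by (simp add: edge_op_def)
  then have "endo_apply (prod_list (map (\<lambda>(a, b). edge_op a b) (p # cs))) \<phi> w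
      = (if bruhat_cover w a b
         then endo_apply (prod_list (map (\<lambda>(a, b). edge_op a b) cs)) \<phi> (w \<circ> transpose a b) else 0)"
    using fin_perms_inj[OF Cons.prems(1)] by (simp add: p)
  also have "endo_apply (prod_list (map (\<lambda>(a, b). edge_op a b) cs)) \<phi> (w \<circ> transpose a b)
      = (if k_bruhat_chain k (w \<circ> transpose a b) cs then \<phi> (chain_end (w \<circ> transpose a b) cs) else 0)"
    using Cons.prems(2) by (intro Cons.IH[OF v]) auto
  finally show ?case
    using bruhat_cover_iff[OF Cons.prems(1) ab(1), of b] ab by (simp add: p)
qed simp

lemma endo_apply_e_sum:
  assumes "w \<in> fin_perms" "k \<le> N"
  shows "endo_apply (bruhat.e_sum m {1..k} (rev [Suc k..<Suc N])) \<phi> w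
    = (\<Sum>cs\<in>{cs \<in> pieri_words m {1..k} {Suc k..N}. k_bruhat_chain k w cs}. \<phi> (chain_end w cs))"
proof -
  have fin: "finite (pieri_words m {1..k} {Suc k..N})"
    by (rule finite_subset[OF _ finite_lists_length_eq[of "{1..k} \<times> {Suc k..N}" m]]) (auto simp: pieri_words_def)
  have set: "set (rev [Suc k..<Suc N]) = {Suc k..N}" by auto
  have "endo_apply (bruhat.e_sum m {1..k} (rev [Suc k..<Suc N])) \<phi> w
      = (\<Sum>cs\<in>pieri_words m {1..k} {Suc k..N}. if k_bruhat_chain k w cs then \<phi> (chain_end w cs) else 0)"
    by (subst bruhat.e_sum_words)
      (auto simp: set sorted_wrt_rev simp del: upt_Suc intro!: sum.cong endo_apply_word assms, auto simp: pieri_words_def)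
  then show ?thesis using fin by (simp add: sum.inter_filter)
qed

text \<open>Induction on k by \<open>e_sum_insert\<close>. The bound M + m \<le> N leaves room for
  Monk's rule: chains of length m - 1 end in S_(M+m-1), hence in S_(N-1), where the Dunkl operator
  up to N is valid.\<close>

lemma e_sum_schubert:
  assumes "w permutes {1..M}" "k \<le> M" "M + m \<le> N"
  shows "endo_apply (bruhat.e_sum m {1..k} (rev [Suc k..<Suc N])) schubert w = elem_sym m k * schubert w"
  using assms
proof (induction k arbitrary: m)
  case 0
  have "matching_words {} bs = {[]}" for bs by (auto simp: matching_words_def)
  then have "bruhat.matching_sum {} (rev [Suc 0..<Suc N]) = (1 :: (nat \<Rightarrow> nat, ipoly) fun_endo)"
    by (subst bruhat.matching_sum_words) (auto simp: sorted_wrt_rev simp del: upt_Suc)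
  moreover have S: "{A. A \<subseteq> {1..0::nat} \<and> card A = m} = (if m = 0 then {{}} else {})"
    by (cases m) auto
  ultimately show ?case
    unfolding bruhat.e_sum_def S by (cases m) (simp_all del: upt_Suc)
next
  case (Suc k)
  have w: "w \<in> fin_perms" using Suc.prems(1) by (rule permutes_fin_perms)
  have kM: "k \<le> M" using Suc.prems by simp
  show ?case
  proof (cases m)
    case 0
    have "pieri_words 0 I J = {[]}" for I J by (auto simp: pieri_words_def)
    then show ?thesis
      using endo_apply_e_sum[OF w, of "Suc k" N 0 schubert] Suc.prems 0 by (simp del: upt_Suc) (simp add: Collect_conv_if)
  next
    case (Suc m')
    let ?bs = "rev [Suc (Suc k)..<Suc N]"
    \<comment> \<open>As the smallest target, k + 1 stands last in the decreasing list, in the place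
      of j in \<open>e_sum_insert\<close>.\<close>
    have bs: "rev [Suc k..<Suc N] = ?bs @ [Suc k]"
      using Suc.prems by (subst upt_conv_Cons) auto
    let ?E = "\<lambda>m. bruhat.e_sum m {1..k} (?bs @ [Suc k]) :: (nat \<Rightarrow> nat, ipoly) fun_endo"
    have "(\<Sum>b\<in>set ?bs. edge_op (Suc k) b) + (\<Sum>a\<in>{1..k}. edge_op (Suc k) a) = dunkl_op N (Suc k)"
    proof -
      have "{1..N} - {Suc k} = set ?bs \<union> {1..k}" "set ?bs \<inter> {1..k} = {}"
        using Suc.prems by auto
      then show ?thesis unfolding dunkl_op_def by (simp add: sum.union_disjoint del: set_rev set_upt)
    qed
    moreover have "insert (Suc k) {1..k} = {1..Suc k}" by auto
    moreover have "bruhat.e_sum (Suc m') (insert (Suc k) {1..k}) ?bs = ?E (Suc m')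
        + ?E m' * ((\<Sum>b\<in>set ?bs. edge_op (Suc k) b) + (\<Sum>a\<in>{1..k}. edge_op (Suc k) a))"
      by (rule bruhat.e_sum_insert) auto
    ultimately have rec: "bruhat.e_sum (Suc m') {1..Suc k} ?bs = ?E (Suc m') + ?E m' * dunkl_op N (Suc k)"
      by (simp only:)
    \<comment> \<open>The Dunkl operator is evaluated at the ends of chains, where Monk's rule gives
      the same factor x_(k+1) for every chain.\<close>
    have "endo_apply (?E m') (endo_apply (dunkl_op N (Suc k)) schubert) w
        = var (Suc k) * endo_apply (?E m') schubert w"
    proof -
      have kN: "k \<le> N" using Suc.prems by simp
      have "endo_apply (dunkl_op N (Suc k)) schubert (chain_end w cs) = var (Suc k) * schubert (chain_end w cs)"
        if "cs \<in> pieri_words m' {1..k} {Suc k..N}" "k_bruhat_chain k w cs" for cs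
      proof -
        have "chain_end w cs permutes {1..M + m'}"
          using chain_end_permutes[OF that(2) Suc.prems(1) kM] that(1) by (auto simp: pieri_words_def)
        then have "chain_end w cs permutes {1..N - 1}"
          using Suc.prems Suc by (elim permutes_atLeastAtMost_mono) simp
        moreover have "Suc k \<in> {1..N - 1}" "Suc (N - 1) = N" using Suc.prems Suc by auto
        ultimately show ?thesis using monk[of "chain_end w cs" "N - 1" "Suc k"] by simp
      qed
      then show ?thesis
        unfolding bs[symmetric] endo_apply_e_sum[OF w kN] by (simp add: sum_distrib_left)
    qed
    moreover have "endo_apply (?E m') schubert w = elem_sym m' k * schubert w"
      "endo_apply (?E (Suc m')) schubert w = elem_sym (Suc m') k * schubert w"
      using Suc.IH[OF Suc.prems(1) kM] Suc.prems Suc unfolding bs by auto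
    ultimately show ?thesis
      unfolding Suc rec by (simp add: algebra_simps del: upt_Suc)
  qed
qed

text \<open>All targets of a chain of length m from S_n are at most n + m, so the words over this
  bounded range exhaust the chains.\<close>

lemma schubert_mult_elem_sym:
  assumes "w permutes {1..n}" "k \<le> n"
  shows "schubert w * elem_sym m k
    = (\<Sum>cs | length cs = m \<and> k_bruhat_chain k w cs \<and> sorted_wrt (\<ge>) (map snd cs) \<and> distinct (map fst cs).
        schubert (chain_end w cs))"
proof -
  have "{cs \<in> pieri_words m {1..k} {Suc k..n + m}. k_bruhat_chain k w cs}
      = {cs. length cs = m \<and> k_bruhat_chain k w cs \<and> sorted_wrt (\<ge>) (map snd cs) \<and> distinct (map fst cs)}"
  proof -
    have mem: "\<forall>(a, b)\<in>set cs. 1 \<le> a \<and> a \<le> k \<and> k < b" if "k_bruhat_chain k v cs" for v cs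
      using that
    proof (induction cs arbitrary: v)
      case (Cons p cs)
      then show ?case using Cons.IH[of "v \<circ> transpose (fst p) (snd p)"] by (cases p) auto
    qed simp
    have "set cs \<subseteq> {1..k} \<times> {Suc k..n + m}" if "k_bruhat_chain k w cs" "length cs = m" for cs
      using mem[OF that(1)] chain_end_permutes[OF that(1) assms] that(2) by fastforce
    then show ?thesis by (auto simp: pieri_words_def)
  qed
  then show ?thesis
    using e_sum_schubert[OF assms, of m "n + m"] endo_apply_e_sum[OF permutes_fin_perms[OF assms(1)], of k "n + m" m schubert] assms(2)
    by (simp add: mult.commute del: upt_Suc)
qed

section \<open>Cycles and tower diagrams\<close>

lemma homogeneous_elem_sym: "homogeneous m (elem_sym m k)"
proof (induction m k rule: elem_sym.induct)
  case (3 m k)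
  then show ?case by (simp add: homogeneous.add homogeneous.var)
qed (simp_all add: homogeneous.one homogeneous.zero)

lemma divided_difference_elem_sym_beyond: "k < i \<Longrightarrow> divided_difference i (elem_sym m k) = 0"
  by (induction m k rule: elem_sym.induct)
    (auto simp: divided_difference_eq_0 divided_difference_add divided_difference_mult divided_difference_var)

lemma divided_difference_elem_sym_last:
  "divided_difference (Suc k) (elem_sym (Suc m) (Suc k)) = elem_sym m k"
  by (simp add: divided_difference_add divided_difference_mult divided_difference_var
      divided_difference_elem_sym_beyond)

lemma divided_difference_elem_sym_inner:
  "1 \<le> i \<Longrightarrow> i < k \<Longrightarrow> divided_difference i (elem_sym m k) = 0"
proof (induction m k rule: elem_sym.induct)
  case (3 m k)
  show ?case
  proof (cases "i = k")
    case True
    then obtain j where j: "k = Suc j" using 3 by (cases k) auto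
    show ?thesis
    proof (cases m)
      case 0
      then show ?thesis
        using True j by (simp add: divided_difference_add divided_difference_mult divided_difference_var
            divided_difference_elem_sym_last divided_difference_eq_0 del: elem_sym.simps(3))
          (simp add: divided_difference_add divided_difference_mult divided_difference_var
            divided_difference_elem_sym_beyond divided_difference_eq_0)
    next
      case (Suc l)
      have "divided_difference i (elem_sym (Suc m) (Suc k))
          = divided_difference i (elem_sym (Suc m) k) + (- elem_sym m k + swap_vars i (var (Suc k)) * divided_difference i (elem_sym m k))"
        using True by (simp add: divided_difference_add divided_difference_mult divided_difference_var)
      also have "\<dots> = elem_sym m j + (- elem_sym m k + var k * elem_sym l j)"
        unfolding True j Suc divided_difference_elem_sym_last by (simp add: swap_vars_var)
      also have "\<dots> = 0" by (simp add: Suc j)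
      finally show ?thesis .
    qed
  next
    case False
    then show ?thesis
      using 3 by (simp add: divided_difference_add divided_difference_mult divided_difference_var)
  qed
qed (auto simp: divided_difference_eq_0)

lemma cycle_of_list_upt:
  "cycle_of_list [i..<i + Suc d] x = (if i \<le> x \<and> x < i + d then Suc x else if x = i + d then i else x)"
proof (induction d arbitrary: i)
  case (Suc d)
  have "[i..<i + Suc (Suc d)] = i # [Suc i..<Suc i + Suc d]"
    by (simp add: upt_conv_Cons del: upt_Suc)
  moreover have "[Suc i..<Suc i + Suc d] = Suc i # [Suc (Suc i)..<Suc i + Suc d]"
    by (simp add: upt_conv_Cons del: upt_Suc)
  ultimately have "cycle_of_list [i..<i + Suc (Suc d)] = transpose i (Suc i) \<circ> cycle_of_list [Suc i..<Suc i + Suc d]"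
    by (metis cycle_of_list.simps(1))
  then show ?case using Suc.IH[of "Suc i"] by (auto simp: transpose_def)
qed simp

lemma pieri_cycle_apply:
  assumes "m \<le> k"
  shows "pieri_cycle k m x
    = (if k - m + 1 \<le> x \<and> x \<le> k then Suc x else if x = Suc k then k - m + 1 else x)"
proof -
  have "[k - m + 1..<k + 2] = [k - m + 1..<k - m + 1 + Suc m]" using assms by simp
  then show ?thesis
    using assms unfolding pieri_cycle_def by (simp only: cycle_of_list_upt) auto
qed

lemma pieri_cycle_0: "pieri_cycle k 0 = id"
  by (auto simp: fun_eq_iff pieri_cycle_apply)

lemma pieri_cycle_comp_transpose:
  assumes "m \<le> k"
  shows "pieri_cycle (Suc k) (Suc m) \<circ> transpose (Suc k) (Suc (Suc k)) = pieri_cycle k m"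
  using assms by (auto simp: fun_eq_iff pieri_cycle_apply transpose_def)

lemma pieri_cycle_fin_perms: "m \<le> k \<Longrightarrow> pieri_cycle k m \<in> fin_perms"
proof (induction m arbitrary: k)
  case (Suc m)
  then obtain j where j: "k = Suc j" "m \<le> j" by (cases k) auto
  have "pieri_cycle j m \<circ> transpose (Suc j) (Suc (Suc j)) = pieri_cycle (Suc j) (Suc m)"
    unfolding pieri_cycle_comp_transpose[OF j(2), symmetric] by (simp add: comp_assoc)
  moreover have "pieri_cycle j m \<circ> transpose (Suc j) (Suc (Suc j)) \<in> fin_perms"
    using Suc.IH[OF j(2)] by (intro fin_perms_comp_transpose) auto
  ultimately show ?case using j by simp
qed (simp add: pieri_cycle_0)

text \<open>The cycle descends only at k, and there it becomes the cycle for k - 1 and m - 1. The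
  elementary symmetric polynomial has the same divided differences, and both are homogeneous of
  degree m > 0, so their difference is 0.\<close>

lemma schubert_pieri_cycle:
  "m \<le> k \<Longrightarrow> schubert (pieri_cycle k m) = elem_sym m k \<and> card (inversions (pieri_cycle k m)) = m"
proof (induction m arbitrary: k)
  case (Suc m)
  then obtain j where j: "k = Suc j" "m \<le> j" by (cases k) auto
  let ?c = "pieri_cycle k (Suc m)"
  have c: "?c \<in> fin_perms" using Suc.prems by (rule pieri_cycle_fin_perms)
  have step: "?c \<circ> transpose k (Suc k) = pieri_cycle j m"
    using pieri_cycle_comp_transpose[OF j(2)] j(1) by simp
  have desc: "?c (Suc i) < ?c i \<longleftrightarrow> i = k" if "1 \<le> i" for i
    using Suc.prems that by (auto simp: pieri_cycle_apply)
  have card: "card (inversions ?c) = Suc m"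
    using card_inversions_descent[OF c, of k] desc[of k] Suc.IH[OF j(2)] j(1) step by simp
  have "schubert ?c - elem_sym (Suc m) k = 0"
  proof (rule homogeneous_symmetric_eq_0[of "Suc m"])
    show "homogeneous (Suc m) (schubert ?c - elem_sym (Suc m) k)"
      using homogeneous_schubert[OF c] card by (intro homogeneous_diff homogeneous_elem_sym) simp
    fix i :: nat assume i: "1 \<le> i"
    consider "i = k" | "i < k" | "k < i" by linarith
    then show "divided_difference i (schubert ?c - elem_sym (Suc m) k) = 0"
    proof cases
      case 1
      then show ?thesis
        using divided_difference_schubert[OF c i] desc[OF i] step Suc.IH[OF j(2)] j(1)
        by (simp add: divided_difference_diff divided_difference_elem_sym_last del: elem_sym.simps)
    next
      case 2
      then show ?thesis
        using divided_difference_schubert[OF c i] desc[OF i] divided_difference_elem_sym_inner[OF i 2]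
        by (simp add: divided_difference_diff)
    next
      case 3
      then show ?thesis
        using divided_difference_schubert[OF c i] desc[OF i] divided_difference_elem_sym_beyond[OF 3]
        by (simp add: divided_difference_diff)
    qed
  qed simp
  then show ?case using card by simp
qed (simp add: pieri_cycle_0)

section \<open>Recovering a permutation from its tower diagram\<close>

lemma word_perm_append: "word_perm (\<alpha> @ \<beta>) = word_perm \<alpha> \<circ> word_perm \<beta>"
proof (induction \<beta> rule: rev_induct)
  case (snoc p \<beta>)
  show ?case
    unfolding append_assoc[symmetric] word_perm_simps snoc by (simp add: comp_assoc)
qed simp

lemma word_perm_upt:
  "word_perm [p..<p + h] x = (if p \<le> x \<and> x < p + h then Suc x else if x = p + h then p else x)"
proof (induction h arbitrary: x)
  case (Suc h)
  have "word_perm [p..<p + Suc h] = word_perm [p..<p + h] \<circ> transpose (p + h) (Suc (p + h))"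
    using word_perm_simps(2)[of "[p..<p + h]" "p + h"] by simp
  then show ?case using Suc.IH by (auto simp: transpose_def)
qed simp

text \<open>
  The permutation read off the towers \<open>p, \<dots>, M - 1\<close>, the later ones first; a tower of height \<open>h\<close>
  at \<open>p\<close> contributes \<open>s\<^sub>p \<dots> s\<^bsub>p+h-1\<^esub>\<close>.
\<close>

definition tower_perm :: "nat \<Rightarrow> nat \<Rightarrow> tower_diagram \<Rightarrow> nat \<Rightarrow> nat" where
  "tower_perm p M T = word_perm (concat (map (\<lambda>q. [q..<q + Poly_Mapping.lookup T q]) (rev [p..<M])))"

lemma tower_perm_step:
  "p < M \<Longrightarrow> tower_perm p M T = tower_perm (Suc p) M T \<circ> word_perm [p..<p + Poly_Mapping.lookup T p]"
  unfolding tower_perm_def by (subst upt_conv_Cons) (simp_all add: word_perm_append)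

lemma tower_perm_cong:
  "(\<And>q. p \<le> q \<Longrightarrow> Poly_Mapping.lookup T q = Poly_Mapping.lookup T' q) \<Longrightarrow> tower_perm p M T = tower_perm p M T'"
  unfolding tower_perm_def by (auto intro!: arg_cong[of _ _ word_perm] arg_cong[of _ _ concat])

text \<open>The slide rules move s_s to the left through the factor s_p ... s_(p+h-1) of tower p. It
  commutes with the factor, lengthens it, cancels its last letter, or passes and becomes s_(s+1), as
  the factor is a cycle shifting s to s + 1. L bounds the towers, and the bound on M keeps the whole
  slide in range.\<close>

lemma slide_from_tower_perm:
  assumes "p \<le> s" "\<And>q. L \<le> q \<Longrightarrow> Poly_Mapping.lookup T q = 0" "s + (L - p) < M"
  shows "(\<forall>q<p. Poly_Mapping.lookup (slide_from p s T) q = Poly_Mapping.lookup T q)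
    \<and> tower_perm p M (slide_from p s T) = tower_perm p M T \<circ> transpose s (Suc s)"
  using assms(1,3)
proof (induction "(L - p) + (s - p)" arbitrary: p s rule: less_induct)
  case less
  define h where "h = Poly_Mapping.lookup T p"
  have pM: "p < M" using less.prems by simp
  have unfold: "slide_from p s T =
     (if s > p + h then slide_from (p + 1) s T
      else if s = p + h then Poly_Mapping.update p (h + 1) T
      else if h \<ge> 1 \<and> s = p + h - 1 then Poly_Mapping.update p (h - 1) T
      else slide_from (p + 1) (s + 1) T)"
    by (subst slide_from.simps) (simp add: h_def Let_def)
  have update: "tower_perm p M (Poly_Mapping.update p g T) = tower_perm (Suc p) M T \<circ> word_perm [p..<p + g]" for g
    using tower_perm_step[OF pM, of "Poly_Mapping.update p g T"]
      tower_perm_cong[of "Suc p" "Poly_Mapping.update p g T" T M]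
    by (simp add: lookup_update)
  have T: "tower_perm p M T = tower_perm (Suc p) M T \<circ> word_perm [p..<p + h]"
    using tower_perm_step[OF pM, of T] by (simp add: h_def)
  have go_on: "(\<forall>q<p. Poly_Mapping.lookup (slide_from (Suc p) r T) q = Poly_Mapping.lookup T q)
      \<and> tower_perm p M (slide_from (Suc p) r T) = tower_perm p M T \<circ> transpose s (Suc s)"
    if IH: "(\<forall>q<Suc p. Poly_Mapping.lookup (slide_from (Suc p) r T) q = Poly_Mapping.lookup T q)
      \<and> tower_perm (Suc p) M (slide_from (Suc p) r T) = tower_perm (Suc p) M T \<circ> transpose r (Suc r)"
      and comm: "transpose r (Suc r) \<circ> word_perm [p..<p + h] = word_perm [p..<p + h] \<circ> transpose s (Suc s)" for r
  proof -
    have "tower_perm p M (slide_from (Suc p) r T)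
        = tower_perm (Suc p) M T \<circ> (transpose r (Suc r) \<circ> word_perm [p..<p + h])"
      using tower_perm_step[OF pM, of "slide_from (Suc p) r T"] IH by (simp add: h_def comp_assoc)
    then show ?thesis using IH T comm by (simp add: comp_assoc)
  qed
  consider "s > p + h" | "s = p + h" | "h \<ge> 1" "s = p + h - 1" | "s < p + h - 1" "h \<ge> 2"
    using less.prems by linarith
  then show ?case
  proof cases
    case 1
    have "(\<forall>q<Suc p. Poly_Mapping.lookup (slide_from (Suc p) s T) q = Poly_Mapping.lookup T q)
      \<and> tower_perm (Suc p) M (slide_from (Suc p) s T) = tower_perm (Suc p) M T \<circ> transpose s (Suc s)"
      using 1 less.prems by (intro less.hyps) auto
    moreover have "transpose s (Suc s) \<circ> word_perm [p..<p + h] = word_perm [p..<p + h] \<circ> transpose s (Suc s)"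
      using 1 by (auto simp: fun_eq_iff word_perm_upt transpose_def)
    ultimately show ?thesis using go_on[of s] 1 unfold by simp
  next
    case 2
    have "word_perm [p..<p + (h + 1)] = word_perm [p..<p + h] \<circ> transpose s (Suc s)"
      using word_perm_simps(2)[of "[p..<p + h]" "p + h"] 2 by simp
    then show ?thesis using 2 unfold update[of "h + 1"] T by (simp add: lookup_update comp_assoc)
  next
    case 3
    then obtain g where g: "h = Suc g" by (cases h) auto
    have "word_perm [p..<p + h] = word_perm [p..<p + g] \<circ> transpose s (Suc s)"
      using word_perm_simps(2)[of "[p..<p + g]" "p + g"] 3 g by simp
    then have "word_perm [p..<p + h] \<circ> transpose s (Suc s) = word_perm [p..<p + g]"
      by (simp add: comp_assoc)
    then show ?thesis using 3 g unfold update[of g] T by (simp add: lookup_update comp_assoc)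
  next
    case 4
    \<comment> \<open>The tower at p is nonempty, so L - p drops; s - p stays fixed here, and so
      does s + (L - p).\<close>
    have "p < L" using assms(2)[of p] 4 by (metis h_def le_less_linear not_numeral_le_zero)
    then have "(\<forall>q<Suc p. Poly_Mapping.lookup (slide_from (Suc p) (Suc s) T) q = Poly_Mapping.lookup T q)
      \<and> tower_perm (Suc p) M (slide_from (Suc p) (Suc s) T)
        = tower_perm (Suc p) M T \<circ> transpose (Suc s) (Suc (Suc s))"
      using less.prems by (intro less.hyps) auto
    moreover have "transpose (Suc s) (Suc (Suc s)) \<circ> word_perm [p..<p + h] = word_perm [p..<p + h] \<circ> transpose s (Suc s)"
      using 4 less.prems(1) by (auto simp: fun_eq_iff word_perm_upt transpose_def)
    moreover have "\<not> s > p + h" "s \<noteq> p + h" "s \<noteq> p + h - 1" using 4 by linarith+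
    then have "slide_from p s T = slide_from (Suc p) (Suc s) T" unfolding unfold by simp
    ultimately show ?thesis using go_on[of "Suc s"] by simp
  qed
qed

lemma slide_word_tower_perm:
  "\<forall>i\<in>set \<alpha>. 1 \<le> i \<Longrightarrow> \<exists>M0. \<forall>M\<ge>M0. tower_perm 1 M (slide_word \<alpha>) = word_perm \<alpha>"
proof (induction \<alpha> rule: rev_induct)
  case Nil
  have empty: "concat (map (\<lambda>q. []) qs) = ([] :: nat list)" for qs :: "nat list" by (induction qs) auto
  have "tower_perm 1 M (slide_word []) = word_perm []" for M
    by (simp add: slide_word_def tower_perm_def empty)
  then show ?case by blast
next
  case (snoc i \<alpha>)
  then obtain M0 where M0: "\<forall>M\<ge>M0. tower_perm 1 M (slide_word \<alpha>) = word_perm \<alpha>" by auto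
  let ?T = "slide_word \<alpha>"
  obtain L where L: "\<forall>q\<in>Poly_Mapping.keys ?T. q < L"
    using finite_nat_set_iff_bounded[of "Poly_Mapping.keys ?T"] by auto
  have "tower_perm 1 M (slide_word (\<alpha> @ [i])) = word_perm (\<alpha> @ [i])" if M: "max M0 (Suc (i + L)) \<le> M" for M
  proof -
    have "Poly_Mapping.lookup ?T q = 0" if "L \<le> q" for q
      using L that by (metis in_keys_iff leD)
    then have "tower_perm 1 M (slide_from 1 i ?T) = tower_perm 1 M ?T \<circ> transpose i (Suc i)"
      using slide_from_tower_perm[of 1 i L ?T M] snoc.prems M by auto
    moreover have "slide_word (\<alpha> @ [i]) = slide_from 1 i ?T" by (simp add: slide_word_def slide_def)
    moreover have "tower_perm 1 M ?T = word_perm \<alpha>" using M0 M by simp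
    ultimately show ?thesis by (simp only: word_perm_simps)
  qed
  then show ?case by blast
qed

text \<open>Reading the towers recovers the permutation from its diagram, whichever reduced word was
  chosen to build it.\<close>

lemma inj_on_tower_of: "inj_on tower_of fin_perms"
proof (rule inj_onI)
  fix v w assume vw: "v \<in> fin_perms" "w \<in> fin_perms" "tower_of v = tower_of w"
  have ex: "\<exists>\<alpha>. reduced_word u \<alpha>" if "u \<in> fin_perms" for u
    using exists_word[OF that] by (simp add: reduced_word_def coxeter_length_eq[OF that]) blast
  have "\<exists>M0. \<forall>M\<ge>M0. tower_perm 1 M (tower_of u) = u" if "u \<in> fin_perms" for u
  proof -
    have "reduced_word u (SOME \<alpha>. reduced_word u \<alpha>)" using ex[OF that] by (rule someI_ex)
    then show ?thesis
      using slide_word_tower_perm[of "SOME \<alpha>. reduced_word u \<alpha>"]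
      unfolding tower_of_def reduced_word_def by auto
  qed
  from this[OF vw(1)] this[OF vw(2)] obtain M N
    where "\<forall>M'\<ge>M. tower_perm 1 M' (tower_of v) = v" "\<forall>M'\<ge>N. tower_perm 1 M' (tower_of w) = w" by blast
  then show "v = w" using vw(3) by (metis max.cobounded1 max.cobounded2)
qed

lemma perm_of_tower_tower_of: "w \<in> fin_perms \<Longrightarrow> perm_of_tower (tower_of w) = w"
  unfolding perm_of_tower_def by (rule the_inv_into_f_f[OF inj_on_tower_of])

theorem theorem6p9:
  fixes n k m :: nat and \<omega> :: "nat \<Rightarrow> nat"
  assumes "1 \<le> m" and "m \<le> k" and "k \<le> n"
    and "\<omega> permutes {1..n}"
  shows "schubert \<omega> * schubert (pieri_cycle k m) =
    (\<Sum>X\<in>cycle_slides k m \<omega>. schubert (perm_of_tower (fst X)))"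
proof -
  let ?C = "{cs. length cs = m \<and> k_bruhat_chain k \<omega> cs \<and> sorted_wrt (\<ge>) (map snd cs) \<and> distinct (map fst cs)}"
  let ?g = "\<lambda>cs. (tower_of (chain_end \<omega> cs), zip [1..<m + 1] cs)"
  have zip: "map snd (zip [1..<m + 1] cs) = cs" if "length cs = m" for cs :: "(nat \<times> nat) list"
    using that by simp
  have labels: "map (\<lambda>(q, a, b). b) (zip [1..<m + 1] cs) = map snd cs"
    "map (\<lambda>(q, a, b). a) (zip [1..<m + 1] cs) = map fst cs"
    if "length cs = m" for cs :: "(nat \<times> nat) list"
    using arg_cong[OF zip[OF that], of "map snd"] arg_cong[OF zip[OF that], of "map fst"]
    by (simp_all add: comp_def case_prod_unfold)
  have "cycle_slides k m \<omega> = ?g ` ?C"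
    unfolding cycle_slides_def bruhat_slides_def using labels by (auto simp del: upt_Suc)
  \<comment> \<open>The labels contain the chain, so distinct chains stay distinct summands even if
    their diagrams coincide.\<close>
  moreover have "inj_on ?g ?C"
    by (rule inj_onI) (metis (mono_tags, lifting) zip mem_Collect_eq snd_conv)
  moreover have "schubert (perm_of_tower (fst (?g cs))) = schubert (chain_end \<omega> cs)" if "cs \<in> ?C" for cs
    using chain_end_permutes[of k \<omega> cs n] that assms(3,4) perm_of_tower_tower_of permutes_fin_perms by auto
  ultimately have "(\<Sum>X\<in>cycle_slides k m \<omega>. schubert (perm_of_tower (fst X))) = (\<Sum>cs\<in>?C. schubert (chain_end \<omega> cs))"
    by (simp only: sum.reindex comp_apply cong: sum.cong)
  then show ?thesis
    using schubert_mult_elem_sym[OF assms(4,3), of m] schubert_pieri_cycle[OF assms(2)] by simp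
qed

end
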